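(* Let $c_n:=\dfrac{4^{n}(n!)^2}{(2n-1)!}$. 1) For any complex Euclidean ball $\mathbb{B}\subset\mathbb{C}^n$, any function $u\in\mathcal{L}(\mathbb{C}^n)$ and any real number $0<\alpha<2$, $$\frac{1}{\lambda_{2n}(\mathbb{B})}\int_{\mathbb{B}}e^{\alpha|u-u_{\mathbb{B}}|}\,d\lambda_{2n}\le\Bigl(1+c_n\frac{\alpha}{2-\alpha}\Bigr)\exp\Bigl(\frac{\alpha c_n}{2}\Bigr),$$ where $u_{\mathbb{B}}:=\frac{1}{\lambda_{2n}(\mathbb{B})}\int_{\mathbb{B}}u\,d\lambda_{2n}$. 2) Let $\mathbb{G}\subset\mathbb{C}^n$ be a generic real subspace of complex dimension $0\le m\le n-1$. Then for any real Euclidean ball $B\subset\mathbb{G}$, any function $u\in\mathcal{L}(\mathbb{C}^n)$ and any real number $0<\alpha<1$, $$\frac{1}{\lambda_{n+m}(B)}\int_{B}e^{\alpha|u-u_{B}|}\,d\lambda_{n+m}\le\Bigl(1+8(n+m)\frac{\alpha}{1-\alpha}\Bigr)\exp\bigl(8\alpha(n+m)\bigr),$$ where $u_{B}:=\frac{1}{\lambda_{n+m}(B)}\int_{B}u\,d\lambda_{n+m}$.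
   Context: $\mathcal{L}(\mathbb{C}^n)$ is the Lelong class: the set of plurisubharmonic functions $u$ on $\mathbb{C}^n$ (not identically $-\infty$) with $\sup_{z\in\mathbb{C}^n}\{u(z)-\log^+|z|\}<+\infty$. A real linear subspace $\mathbb{G}\subset\mathbb{C}^n$ is generic if $\mathbb{G}+J\mathbb{G}=\mathbb{C}^n$, where $J$ is the complex structure (multiplication by $i$). Its complex dimension is $m:=\dim_{\mathbb{C}}(\mathbb{G}\cap J\mathbb{G})$, so $\dim_{\mathbb{R}}\mathbb{G}=n+m$. $\mathbb{G}$ carries the induced Euclidean structure with Lebesgue measure $\lambda_{n+m}$; $\lambda_{2n}$ is Lebesgue measure on $\mathbb{C}^n$. Balls have positive radius. *)

theory Defs
  imports "HOL-Analysis.Analysis"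
begin

section \<open>Means of extended real functions\<close>

text \<open>
  Functions with values in \<open>[-\<infinity>, \<infinity>)\<close> are modelled with values in \<^typ>\<open>ereal\<close>. The integral is that of the
  positive part minus that of the negative part (\<^const>\<open>e2ennreal\<close> sends negative numbers to \<open>0\<close>).
  It is only meaningful if one of the two parts is finite, since \<open>\<infinity> - \<infinity> = \<infinity>\<close> in \<^typ>\<open>ereal\<close>; below it is
  applied to upper semicontinuous functions \<open>< \<infinity>\<close> on bounded sets, where the positive part always is.
\<close>

definition ereal_set_integral :: "'a measure \<Rightarrow> 'a set \<Rightarrow> ('a \<Rightarrow> ereal) \<Rightarrow> ereal" where
  "ereal_set_integral M A f =
     enn2ereal (\<integral>\<^sup>+x\<in>A. e2ennreal (f x) \<partial>M) - enn2ereal (\<integral>\<^sup>+x\<in>A. e2ennreal (- f x) \<partial>M)"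

definition ereal_mean :: "'a measure \<Rightarrow> 'a set \<Rightarrow> ('a \<Rightarrow> ereal) \<Rightarrow> ereal" where
  "ereal_mean M A f = ereal_set_integral M A f / ereal (measure M A)"

definition exp_ereal :: "ereal \<Rightarrow> ennreal" where
  "exp_ereal x = (case x of ereal r \<Rightarrow> ennreal (exp r) | PInfty \<Rightarrow> \<infinity> | MInfty \<Rightarrow> 0)"

text \<open>
  The mean over \<open>A\<close> of \<open>exp (\<alpha> \<bar>u - u\<^sub>A\<bar>)\<close>, where \<open>u\<^sub>A\<close> is the mean of \<open>u\<close> over \<open>A\<close>. For \<open>\<alpha> > 0\<close> and
  \<open>0 < \<lambda>(A) < \<infinity>\<close> it is \<open>\<infinity>\<close> if \<open>u\<^sub>A\<close> is infinite, so a finite upper bound on it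
  includes the integrability of \<open>u\<close> on \<open>A\<close>.
\<close>

definition exp_oscillation_mean :: "'a measure \<Rightarrow> 'a set \<Rightarrow> real \<Rightarrow> ('a \<Rightarrow> ereal) \<Rightarrow> ennreal" where
  "exp_oscillation_mean M A \<alpha> u =
     (\<integral>\<^sup>+z\<in>A. exp_ereal (ereal \<alpha> * \<bar>u z - ereal_mean M A u\<bar>) \<partial>M) / emeasure M A"

section \<open>Plurisubharmonic functions and the Lelong class\<close>

definition upper_semicontinuous :: "('a::topological_space \<Rightarrow> ereal) \<Rightarrow> bool" where
  "upper_semicontinuous u \<longleftrightarrow> (\<forall>c. open {z. u z < c})"

text \<open>
  The constant \<open>-\<infinity>\<close> counts as plurisubharmonic here; it is excluded in the Lelong class.
  The last condition says that the restriction of \<open>u\<close> to every complex line satisfies the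
  sub-mean value inequality on every circle.
\<close>

definition plurisubharmonic :: "(complex^'n \<Rightarrow> ereal) \<Rightarrow> bool" where
  "plurisubharmonic u \<longleftrightarrow>
     (\<forall>z. u z < \<infinity>) \<and> upper_semicontinuous u \<and>
     (\<forall>a b. u a \<le> ereal_mean lborel {0..2 * pi} (\<lambda>t. u (a + cis t *s b)))"

text \<open>\<open>ln (max 1 \<bar>z\<bar>)\<close> is \<open>log\<^sup>+ \<bar>z\<bar>\<close>.\<close>

definition lelong_class :: "(complex^'n \<Rightarrow> ereal) set" where
  "lelong_class = {u. plurisubharmonic u \<and> (\<exists>z. u z \<noteq> -\<infinity>) \<and>
     (SUP z. u z - ereal (ln (max 1 (norm z)))) < \<infinity>}"

section \<open>Generic real subspaces and their Lebesgue measure\<close>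

definition generic_subspace :: "(complex^'n) set \<Rightarrow> bool" where
  "generic_subspace G \<longleftrightarrow> subspace G \<and> {x + y | x y. x \<in> G \<and> y \<in> (\<lambda>z. \<i> *s z) ` G} = UNIV"

text \<open>\<open>vec.dim\<close> is the dimension over the field of scalars, here \<open>\<complex>\<close>, whereas \<open>dim\<close> is the real one.\<close>

definition complex_dim :: "(complex^'n) set \<Rightarrow> nat" where
  "complex_dim G = vec.dim (G \<inter> (\<lambda>z. \<i> *s z) ` G)"

definition orthonormal_basis :: "'a::euclidean_space set \<Rightarrow> 'a set \<Rightarrow> bool" where
  "orthonormal_basis S b \<longleftrightarrow>
     b \<subseteq> S \<and> pairwise orthogonal b \<and> (\<forall>x\<in>b. norm x = 1) \<and> span b = S"

lemma orthonormal_basis_exists: "subspace S \<Longrightarrow> \<exists>b. orthonormal_basis S b"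
  unfolding orthonormal_basis_def by (meson orthonormal_basis_subspace)

text \<open>
  Lebesgue measure of dimension \<open>dim S\<close> on a subspace \<open>S\<close>, as a Borel measure on the ambient space carried
  by \<open>S\<close>: the image of the product measure under the linear isometry given by an orthonormal basis of \<open>S\<close>.
  By rotation invariance the choice of the basis is irrelevant. For \<open>S = UNIV\<close> and the basis \<open>Basis\<close> this
  is the formula of \<open>lborel_eq\<close>.
\<close>

definition subspace_lebesgue :: "'a::euclidean_space set \<Rightarrow> 'a measure" where
  "subspace_lebesgue S =
     (let b = (SOME b. orthonormal_basis S b)
      in distr (\<Pi>\<^sub>M x\<in>b. (lborel :: real measure)) borel (\<lambda>f. \<Sum>x\<in>b. f x *\<^sub>R x))"

definition bm_const :: "nat \<Rightarrow> real" where
  "bm_const n = 4 ^ n * (fact n)\<^sup>2 / fact (2 * n - 1)"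

end

theory Submission
  imports Defs "HOL-Complex_Analysis.Complex_Analysis" "HOL-Real_Asymp.Real_Asymp"
begin

text \<open>
  Let \<open>x\<close> be a maximum point of \<open>u\<close> on the closed ball. On a line through \<open>x\<close>, \<open>u\<close> is up to a constant the
  logarithmic potential of a measure of mass at most \<open>1\<close>, so Jensen's inequality bounds the integral of
  \<open>exp (\<alpha> (u x - u z))\<close> by its largest value for the functions \<open>u z = ln \<bar>z - w\<bar>\<close>, where it is computed by
  rearrangement. Integrating these one-dimensional bounds over all lines through \<open>x\<close> (complex lines and a point on
  the sphere for the first part, real rays inside the subspace for the second) bounds the mean of
  \<open>exp (\<alpha> (u x - u z)) - 1\<close> by \<open>c \<alpha> / (p - \<alpha>)\<close> with \<open>p = 2\<close> or \<open>p = 1\<close>. Letting \<open>\<alpha> \<rightarrow> 0\<close> bounds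
  \<open>u x - u\<^sub>B\<close> by \<open>c / p\<close>, and \<open>\<bar>u - u\<^sub>B\<bar> \<le> (u x - u) + (u x - u\<^sub>B)\<close>.

  The Riesz measure itself is avoided: \<open>u\<close> is replaced by averages for which the measure is the density
  \<open>(disc mean of u) - u\<close>, and the potential representation becomes an identity between iterated disc means.
\<close>

section \<open>Lebesgue measure and its symmetries\<close>

text \<open>The constants come from the slices. A complex line through a point of the sphere meets
  the ball in a disc with that point on its boundary circle. If its radius is \<rho>, the polar
  weight |\<zeta>|^(2n-2) is at most (2\<rho>)^(2n-2) there, and its integral is \<pi> \<rho>^(2n)
  (2n-1)!/(n!)^2. In one dimension the mean exceeds 1 by at most 4 \<alpha>/(2-\<alpha>), and
  together this gives c_n \<alpha>/(2-\<alpha>). On a subspace u need not be subharmonic, so its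
  maximum may be interior and no boundary circle is available; a ray of length L has weight t^(d-1)
  <= L^(d-1) with integral L^d/d, whence the factor d = n + m. Only the excess over 1 is compared
  with the maximal weight, otherwise the leading term 1 would grow as well. The one-dimensional
  kernel is |w|/|z - w| with an arbitrary pole w. Its numerator is unbounded; inversion in a circle
  replaces it by a constant before rearrangement applies. Since u may be -\<infinity>, almost
  everything is stated for H - u with an upper bound H of u: nonnegative integrals can be exchanged
  without integrability, but nothing may be subtracted.\<close>

lemma ball_measurable [measurable]: "ball c r \<in> sets borel"
  by simp

text \<open>Bathtub principle: the mass of \<open>A\<close> outside \<open>B\<close> lies where f <=
  c and is traded for equal mass of \<open>B\<close> outside \<open>A\<close>, where f >= c. It is
  applied with \<open>B\<close> a disc or an interval around the singularity of a decreasing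
  kernel.\<close>

lemma nn_integral_rearrangement:
  assumes [measurable]: "A \<in> sets M" "B \<in> sets M" "f \<in> borel_measurable M"
    and eq: "emeasure M A = emeasure M B" and fin: "emeasure M B \<noteq> \<infinity>"
    and le: "\<And>x. x \<in> A - B \<Longrightarrow> f x \<le> c" and ge: "\<And>x. x \<in> B - A \<Longrightarrow> c \<le> f x"
  shows "(\<integral>\<^sup>+x\<in>A. f x \<partial>M) \<le> (\<integral>\<^sup>+x\<in>B. f x \<partial>M)"
proof -
  have split: "(\<integral>\<^sup>+x\<in>X. f x \<partial>M) = (\<integral>\<^sup>+x\<in>X \<inter> Y. f x \<partial>M) + (\<integral>\<^sup>+x\<in>X - Y. f x \<partial>M)"
    if [measurable]: "X \<in> sets M" "Y \<in> sets M" for X Y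
    by (subst nn_integral_add[symmetric]) (auto intro!: nn_integral_cong split: split_indicator)
  have em: "emeasure M X = emeasure M (X \<inter> Y) + emeasure M (X - Y)"
    if "X \<in> sets M" "Y \<in> sets M" for X Y
    using that by (metis Int_Diff_Un Int_Diff_disjoint plus_emeasure sets.Diff sets.Int)
  have fin2: "emeasure M (A \<inter> B) \<noteq> \<infinity>"
    using fin by (metis assms(1,2) emeasure_mono inf_le2 infinity_ennreal_def neq_top_trans)
  have "emeasure M (A \<inter> B) + emeasure M (A - B) = emeasure M (A \<inter> B) + emeasure M (B - A)"
    using em[of A B] em[of B A] eq assms(1,2) by (metis Int_commute)
  then have d: "emeasure M (A - B) = emeasure M (B - A)"
    using fin2 by (metis ennreal_add_left_cancel infinity_ennreal_def)
  have "(\<integral>\<^sup>+x\<in>A - B. f x \<partial>M) \<le> (\<integral>\<^sup>+x\<in>A - B. c \<partial>M)"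
    using le by (intro nn_integral_mono) (auto split: split_indicator)
  also have "\<dots> = (\<integral>\<^sup>+x\<in>B - A. c \<partial>M)"
    by (simp add: nn_integral_cmult_indicator d)
  also have "\<dots> \<le> (\<integral>\<^sup>+x\<in>B - A. f x \<partial>M)"
    using ge by (intro nn_integral_mono) (auto split: split_indicator)
  finally show ?thesis
    using split[of A B] split[of B A] by (simp add: Int_commute add_left_mono)
qed

lemma nn_integral_lborel_shift:
  fixes a :: "'a::euclidean_space"
  assumes [measurable]: "f \<in> borel_measurable borel"
  shows "(\<integral>\<^sup>+x. f (a + x) \<partial>lborel) = (\<integral>\<^sup>+x. f x \<partial>lborel)"
  by (subst (2) lborel_distr_plus[of a, symmetric]) (simp add: nn_integral_distr)

text \<open>Uniqueness of translation invariant measures: the image of Lebesgue measure under \<open>T\<close> is compared with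
  Lebesgue measure itself by integrating \<open>1\<^bsub>ball 0 1\<^esub> (x) g (T y)\<close> in both orders.\<close>

lemma nn_integral_lborel_isometry:
  fixes T :: "'a::euclidean_space \<Rightarrow> 'a"
  assumes T: "linear T" "\<And>x. norm (T x) = norm x" and [measurable]: "g \<in> borel_measurable borel"
  shows "(\<integral>\<^sup>+x. g (T x) \<partial>lborel) = (\<integral>\<^sup>+x. g x \<partial>lborel)"
proof -
  have [measurable]: "T \<in> borel_measurable borel"
    using T(1) linear_continuous_on borel_measurable_continuous_onI linear_conv_bounded_linear by blast
  have "inj T"
    using T linear_injective_0 by (metis norm_eq_zero)
  then have "surj T" using T(1) linear_injective_imp_surjective by blast
  let ?i = "\<lambda>x::'a. if norm x < 1 then 1 else 0 :: ennreal"
  have volB: "(\<integral>\<^sup>+x. ?i x \<partial>lborel) = ennreal (unit_ball_vol DIM('a))"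
  proof -
    have "?i x = indicator (ball 0 1) x" for x by (simp split: split_indicator)
    then have "(\<integral>\<^sup>+x. ?i x \<partial>lborel) = emeasure lborel (ball (0::'a) 1)" by simp
    then show ?thesis by (simp add: emeasure_ball)
  qed
  have vol: "(\<integral>\<^sup>+y. ?i (x - T y) \<partial>lborel) = ennreal (unit_ball_vol DIM('a))" for x
  proof -
    obtain x' where x': "x = T x'" using \<open>surj T\<close> by (metis surjD)
    have "?i (x - T y) = indicator (ball x' 1) y" for y
      by (simp add: x' dist_norm linear_diff[OF T(1), symmetric] T(2) split: split_indicator)
    then have "(\<integral>\<^sup>+y. ?i (x - T y) \<partial>lborel) = emeasure lborel (ball x' 1)"
      by simp
    then show ?thesis by (simp add: emeasure_ball)
  qed
  have Tsh: "(\<integral>\<^sup>+y. g (x + T y) \<partial>lborel) = (\<integral>\<^sup>+y. g (T y) \<partial>lborel)" for x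
  proof -
    obtain x' where x': "x = T x'" using \<open>surj T\<close> by (metis surjD)
    show ?thesis
      using nn_integral_lborel_shift[of "\<lambda>y. g (T y)" x'] by (simp add: x' linear_add[OF T(1)])
  qed
  have "ennreal (unit_ball_vol DIM('a)) * (\<integral>\<^sup>+y. g (T y) \<partial>lborel)
      = (\<integral>\<^sup>+x. ?i x * (\<integral>\<^sup>+y. g (T y) \<partial>lborel) \<partial>(lborel :: 'a measure))"
    by (subst nn_integral_multc) (measurable, simp add: volB)
  also have "\<dots> = (\<integral>\<^sup>+x. \<integral>\<^sup>+y. ?i x * g (x + T y) \<partial>lborel \<partial>lborel)"
    by (simp add: nn_integral_cmult Tsh)
  also have "\<dots> = (\<integral>\<^sup>+y. \<integral>\<^sup>+x. ?i x * g (x + T y) \<partial>lborel \<partial>lborel)"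
    by (rule lborel_pair.Fubini') measurable
  also have "\<dots> = (\<integral>\<^sup>+y. \<integral>\<^sup>+x. ?i (x - T y) * g x \<partial>lborel \<partial>lborel)"
  proof (rule nn_integral_cong)
    fix y
    show "(\<integral>\<^sup>+x. ?i x * g (x + T y) \<partial>lborel) = (\<integral>\<^sup>+x. ?i (x - T y) * g x \<partial>lborel)"
      using nn_integral_lborel_shift[of "\<lambda>x. ?i (x - T y) * g x" "T y"] by (simp add: add.commute)
  qed
  also have "\<dots> = (\<integral>\<^sup>+x. \<integral>\<^sup>+y. ?i (x - T y) * g x \<partial>lborel \<partial>lborel)"
    by (rule lborel_pair.Fubini') measurable
  also have "\<dots> = ennreal (unit_ball_vol DIM('a)) * (\<integral>\<^sup>+x. g x \<partial>lborel)"
    by (simp add: nn_integral_multc vol nn_integral_cmult)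
  finally have "ennreal (unit_ball_vol DIM('a)) * (\<integral>\<^sup>+y. g (T y) \<partial>lborel)
      = ennreal (unit_ball_vol DIM('a)) * (\<integral>\<^sup>+x. g x \<partial>lborel)" .
  moreover have "unit_ball_vol (real DIM('a)) \<noteq> 0"
    by (metis less_irrefl of_nat_0_le_iff unit_ball_vol_pos)
  ultimately show ?thesis
    by (simp add: ennreal_mult_cancel_left)
qed

lemma nn_integral_lborel_reflect:
  fixes a :: "'a::euclidean_space"
  assumes [measurable]: "f \<in> borel_measurable borel"
  shows "(\<integral>\<^sup>+x. f (a - x) \<partial>lborel) = (\<integral>\<^sup>+x. f x \<partial>lborel)"
proof -
  have "(\<integral>\<^sup>+x. f (a - x) \<partial>lborel) = (\<integral>\<^sup>+x. f (a + x) \<partial>lborel)"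
    using nn_integral_lborel_isometry[of uminus "\<lambda>x. f (a + x)"] by (simp add: linear_uminus)
  then show ?thesis by (simp add: nn_integral_lborel_shift)
qed

lemma emeasure_ball_complex: "0 \<le> r \<Longrightarrow> emeasure lborel (ball (c::complex) r) = ennreal (pi * r\<^sup>2)"
  by (simp add: emeasure_ball unit_ball_vol_2)

text \<open>The image of planar Lebesgue measure under w -> |w|^2 is \<pi> times Lebesgue measure on
  the half line, as a comparison on the sets \<open>{..s}\<close> shows. With |w|^2 rather than |w|
  as the variable the density is constant.\<close>

lemma nn_integral_complex_radial:
  fixes \<phi> :: "real \<Rightarrow> ennreal"
  assumes [measurable]: "\<phi> \<in> borel_measurable borel"
  shows "(\<integral>\<^sup>+w. \<phi> ((norm (w::complex))\<^sup>2) \<partial>lborel) = ennreal pi * (\<integral>\<^sup>+s\<in>{0..}. \<phi> s \<partial>lborel)"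
proof -
  let ?N = "density lborel (\<lambda>s. ennreal pi * indicator {0..} s) :: real measure"
  have cb: "emeasure lborel (cball (0::complex) r) = ennreal (pi * r\<^sup>2)" if "0 \<le> r" for r
    using that by (simp add: emeasure_cball unit_ball_vol_2)
  have *: "emeasure (distr lborel borel (\<lambda>w::complex. (norm w)\<^sup>2)) {..s} = emeasure ?N {..s}" for s
  proof (cases "s \<ge> 0")
    case True
    have "(\<lambda>w::complex. (norm w)\<^sup>2) -` {..s} = cball 0 (sqrt s)"
      using True by (auto simp: real_le_rsqrt) (metis norm_ge_zero power_mono real_sqrt_pow2)
    then have "emeasure (distr lborel borel (\<lambda>w::complex. (norm w)\<^sup>2)) {..s} = ennreal (pi * s)"
      using True cb[of "sqrt s"] by (simp add: emeasure_distr)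
    moreover have "emeasure ?N {..s} = (\<integral>\<^sup>+x. ennreal pi * indicator {0..s} x \<partial>lborel)"
      by (subst emeasure_density) (auto intro!: nn_integral_cong split: split_indicator)
    ultimately show ?thesis
      using True by (simp add: nn_integral_cmult_indicator ennreal_mult)
  next
    case False
    then have "(\<lambda>w::complex. (norm w)\<^sup>2) -` {..s} = {}"
      by (auto simp: not_le) (meson leD less_le_trans zero_le_power2)
    moreover have "emeasure ?N {..s} = 0"
      using False by (subst emeasure_density) (auto simp: nn_integral_0_iff_AE split: split_indicator)
    ultimately show ?thesis by (simp add: emeasure_distr)
  qed
  have "distr lborel borel (\<lambda>w::complex. (norm w)\<^sup>2) = ?N"
  proof (rule measure_eqI_generator_eq[where E="range atMost" and \<Omega>=UNIV and A="\<lambda>i. {..real i}"])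
    show "Int_stable (range atMost :: real set set)"
      by (auto simp: Int_stable_def)
    show "sets (distr lborel borel (\<lambda>w::complex. (norm w)\<^sup>2)) = sigma_sets UNIV (range atMost)"
      "sets ?N = sigma_sets UNIV (range atMost)"
      by (simp_all only: sets_distr sets_density sets_lborel borel_eq_atMost) (simp_all add: sets_measure_of)
    show "(\<Union>i. {..real i}) = UNIV"
      using real_arch_simple by auto
    show "emeasure (distr lborel borel (\<lambda>w::complex. (norm w)\<^sup>2)) {..real i} \<noteq> \<infinity>" for i
    proof -
      have "emeasure ?N {..real i} \<le> (\<integral>\<^sup>+x. ennreal pi * indicator {0..real i} x \<partial>lborel)"
        by (subst emeasure_density) (auto intro!: nn_integral_mono split: split_indicator)
      also have "\<dots> < \<infinity>" by (simp add: nn_integral_cmult_indicator ennreal_mult_less_top)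
      finally show ?thesis by (simp add: *)
    qed
  qed (auto simp: *)
  then have "(\<integral>\<^sup>+w. \<phi> ((norm (w::complex))\<^sup>2) \<partial>lborel) = (\<integral>\<^sup>+s. \<phi> s \<partial>?N)"
    by (simp add: nn_integral_distr[symmetric, of _ lborel borel \<phi>])
  also have "\<dots> = ennreal pi * (\<integral>\<^sup>+s\<in>{0..}. \<phi> s \<partial>lborel)"
    by (simp add: nn_integral_density nn_integral_cmult[symmetric] mult_ac)
  finally show ?thesis .
qed

section \<open>Disc means of the logarithm\<close>

lemma null_sets_sphere: "sphere (c::'a::euclidean_space) r \<in> null_sets lborel"
proof -
  have "sphere c r \<in> null_sets lebesgue"
    using negligible_sphere negligible_iff_null_sets by blast
  then show ?thesis by (subst (asm) null_sets_completion_iff) auto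
qed

lemma cis_measurable [measurable]: "cis \<in> borel_measurable borel"
  by (intro borel_measurable_continuous_onI continuous_intros)

text \<open>Mean value property of the harmonic function ln |1 - q u|, obtained from Cauchy's
  formula at the centre, where \<open>Ln (1 - q * u)\<close> vanishes. The hypothesis |q| < 1 keeps
  1 - q u in the right half plane, away from the branch cut.\<close>

lemma circle_mean_ln_norm:
  assumes "norm q < 1"
  shows "((\<lambda>t. ln (norm (1 - q * cis t))) has_integral 0) {0..2 * pi}"
proof -
  have pos: "Re (1 - q * u) > 0" if "norm u \<le> 1" for u
  proof -
    have "norm (q * u) \<le> norm q * 1"
      unfolding norm_mult using that by (intro mult_left_mono) auto
    then have "Re (q * u) < 1"
      using assms complex_Re_le_cmod[of "q * u"] by linarith
    then show ?thesis by simp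
  qed
  have nonpos: "1 - q * u \<notin> \<real>\<^sub>\<le>\<^sub>0" if "norm u \<le> 1" for u
    using pos[OF that] by (auto simp: complex_nonpos_Reals_iff)
  have "((\<lambda>u. Ln (1 - q * u) / (u - 0)) has_contour_integral (2 * of_real pi * \<i> * Ln (1 - q * 0)))
         (circlepath 0 1)"
  proof (rule Cauchy_integral_circlepath)
    show "continuous_on (cball 0 1) (\<lambda>u. Ln (1 - q * u))"
      using nonpos by (intro continuous_intros) auto
    show "(\<lambda>u. Ln (1 - q * u)) holomorphic_on ball 0 1"
      using nonpos by (intro holomorphic_intros) auto
  qed auto
  then have "((\<lambda>t. Ln (1 - q * cis t) / cis t * 1 * \<i> * cis t) has_integral 0) {0..2 * pi}"
    unfolding circlepath_def
    by (subst (asm) has_contour_integral_part_circlepath_iff) auto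
  \<comment> \<open>The parametrised contour integrand is \<i> times the complex logarithm, so the
    logarithm of the modulus appears as its imaginary part.\<close>
  then have "((\<lambda>t. Im (\<i> * Ln (1 - q * cis t))) has_integral Im 0) {0..2 * pi}"
    by (intro has_integral_Im) (simp add: mult_ac)
  moreover have "Im (\<i> * Ln (1 - q * cis t)) = ln (norm (1 - q * cis t))" for t
  proof -
    have "1 - q * cis t \<noteq> 0" using pos[of "cis t"] by (metis less_irrefl norm_cis order_refl zero_complex.sel(1))
    then show ?thesis by simp
  qed
  ultimately show ?thesis by simp
qed

text \<open>The factor of larger modulus is pulled out, leaving 1 - q u with |q| < 1. The constant
  \<open>K\<close> keeps the integrand nonnegative, so that the formula fits a nonnegative
  integral.\<close>

lemma nn_integral_circle_ln:
  assumes ne: "norm a \<noteq> norm (b::complex)" and K: "norm a + norm b \<le> K"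
  shows "(\<integral>\<^sup>+t\<in>{0..2 * pi}. ennreal (ln (K / norm (a - cis t * b))) \<partial>lborel)
       = ennreal (2 * pi * ln (K / max (norm a) (norm b)))"
proof -
  define M where "M = max (norm a) (norm b)"
  have "M > 0" using ne unfolding M_def by (smt (verit) norm_ge_zero)
  have "K \<ge> M" using K unfolding M_def by (smt (verit) norm_ge_zero)
  obtain q where q: "norm q < 1" "\<And>t. norm (a - cis t * b) = M * norm (1 - q * cis t)"
  proof (cases "norm b < norm a")
    case True
    then have "a \<noteq> 0" by auto
    have "norm (a - cis t * b) = M * norm (1 - (b / a) * cis t)" for t
      using True \<open>a \<noteq> 0\<close> by (simp add: M_def norm_mult[symmetric] right_diff_distrib mult.commute)
    then show ?thesis using True \<open>a \<noteq> 0\<close> by (intro that[of "b / a"]) (auto simp: norm_divide)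
  next
    case False
    then have lt: "norm a < norm b" using ne by simp
    then have "b \<noteq> 0" by auto
    \<comment> \<open>With \<open>b\<close> dominant the quotient a/b multiplies
      \<open>cis (-t)\<close>; conjugation, which keeps the modulus, restores the form with
      \<open>cis t\<close>.\<close>
    have "norm (a - cis t * b) = M * norm (1 - cnj (a / b) * cis t)" for t
    proof -
      have "norm (1 - cnj (a / b) * cis t) = norm (cnj (1 - cnj (a / b) * cis t))"
        by (simp only: complex_mod_cnj)
      also have "\<dots> = norm (1 - a / b * cis (-t))" by (simp add: cis_cnj)
      also have "\<dots> = norm (cis t) * norm (1 - a / b * cis (-t))" by simp
      also have "\<dots> = norm (cis t - a / b * (cis t * cis (-t)))"
        unfolding norm_mult[symmetric] by (simp add: algebra_simps)
      also have "\<dots> = norm (cis t - a / b)" by (simp add: cis_mult)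
      finally have "M * norm (1 - cnj (a / b) * cis t) = norm (b * (cis t - a / b))"
        using lt by (simp add: M_def norm_mult)
      also have "b * (cis t - a / b) = cis t * b - a" using \<open>b \<noteq> 0\<close> by (simp add: field_simps)
      finally show ?thesis by (simp add: norm_minus_commute)
    qed
    then show ?thesis using lt \<open>b \<noteq> 0\<close> by (intro that[of "cnj (a / b)"]) (auto simp: norm_divide)
  qed
  have nz: "1 - q * cis t \<noteq> 0" for t
    using q(1) by (metis eq_iff_diff_eq_0 less_irrefl norm_cis norm_mult norm_one mult_1_right)
  define F where "F = (\<lambda>t. ln (K / norm (a - cis t * b)))"
  have F: "F t = ln (K / M) - ln (norm (1 - q * cis t))" for t
    using nz[of t] \<open>M > 0\<close> \<open>K \<ge> M\<close> by (simp add: F_def q(2) ln_mult ln_div)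
  have "F t \<ge> 0" for t
  proof -
    have "norm (a - cis t * b) \<le> K"
      using norm_triangle_ineq4[of a "cis t * b"] K by (simp add: norm_mult)
    moreover have "norm (a - cis t * b) > 0" using nz[of t] \<open>M > 0\<close> by (simp add: q(2))
    ultimately show ?thesis by (simp add: F_def)
  qed
  have "(F has_integral (2 * pi * ln (K / M) - 0)) {0..2 * pi}"
    unfolding F by (intro has_integral_diff circle_mean_ln_norm q(1))
      (use has_integral_const_real[of "ln (K / M)" 0 "2 * pi"] in simp)
  then have "((\<lambda>t. F t) has_integral (2 * pi * ln (K / M))) {0..2 * pi}" by simp
  moreover have "(\<integral>\<^sup>+t\<in>{0..2 * pi}. ennreal (F t) \<partial>lborel) = ennreal r"
    if "(F has_integral r) {0..2 * pi}" for r
  proof -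
    have "((\<lambda>t. F t * indicator {0..2*pi} t) has_integral r) UNIV"
    proof -
      have "(\<lambda>t. F t * indicator {0..2*pi} t) = (\<lambda>t. if t \<in> {0..2*pi} then F t else 0)" by auto
      then show ?thesis using that by (simp only: has_integral_restrict_UNIV)
    qed
    moreover have "(\<lambda>t. F t * indicator {0..2*pi} t) \<in> borel_measurable borel"
      unfolding F_def by measurable
    ultimately have "(\<integral>\<^sup>+t. ennreal (F t * indicator {0..2*pi} t) \<partial>lborel) = ennreal r"
      using \<open>\<And>t. F t \<ge> 0\<close> by (intro nn_integral_has_integral_lborel) auto
    then show ?thesis by (simp add: nn_integral_set_ennreal)
  qed
  ultimately show ?thesis unfolding F_def M_def by blast
qed

text \<open>The logarithmic potential of the normalised area of the disc of radius R about 0, that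
  is, the mean of ln |z - w| over w in that disc, as \<open>nn_integral_disc_ln\<close> confirms.
  The two branches agree at |z| = R.\<close>

definition logdisc :: "real \<Rightarrow> complex \<Rightarrow> real" where
  "logdisc R z = (if norm z < R then ln R - 1 / 2 + (norm z)\<^sup>2 / (2 * R\<^sup>2) else ln (norm z))"

lemma logdisc_measurable [measurable]: "logdisc R \<in> borel_measurable borel"
  unfolding logdisc_def by measurable

text \<open>In the variable s = |w|^2 the integrand is ln K - ln (max a s)/2 with a = |z|^2:
  constant up to a, with an elementary antiderivative beyond.\<close>

lemma nn_integral_disc_ln_max:
  assumes z: "z \<noteq> (0::complex)" and R: "R > 0" and K: "norm z + R \<le> K"
  shows "(\<integral>\<^sup>+w\<in>ball (0::complex) R. ennreal (ln (K / max (norm z) (norm w))) \<partial>lborel)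
       = ennreal (pi * R\<^sup>2 * (ln K - logdisc R z))"
proof -
  have "K > 0" using R K norm_ge_zero[of z] by linarith
  define a where "a = (norm z)\<^sup>2"
  have "a > 0" using z by (simp add: a_def)
  have lmax: "ln (K / max (norm z) (norm w)) = ln K - ln (max a ((norm w)\<^sup>2)) / 2" for w :: complex
  proof -
    have "max a ((norm w)\<^sup>2) = (max (norm z) (norm w))\<^sup>2"
      unfolding a_def by (auto simp: max_def abs_le_square_iff[symmetric])
    moreover have "max (norm z) (norm w) > 0" using z by (simp add: less_max_iff_disj)
    ultimately show ?thesis using \<open>K > 0\<close> by (simp add: ln_div ln_realpow)
  qed
  define h where "h = (\<lambda>s. ln K - ln (max a s) / 2)"
 have [measurable]: "h \<in> borel_measurable borel"
    unfolding h_def by measurable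
  have h0: "h s \<ge> 0" if "s \<le> R\<^sup>2" for s
  proof -
    have "R\<^sup>2 \<le> K\<^sup>2" "a \<le> K\<^sup>2" using K R norm_ge_zero[of z] unfolding a_def by (auto intro!: power_mono simp del: norm_ge_zero)
    then have "ln (max a s) \<le> ln (K\<^sup>2)" using that \<open>a > 0\<close> \<open>K > 0\<close> by (intro ln_mono) auto
    then show ?thesis using \<open>K > 0\<close> by (simp add: h_def ln_realpow)
  qed
  have "(\<integral>\<^sup>+w\<in>ball (0::complex) R. ennreal (ln (K / max (norm z) (norm w))) \<partial>lborel)
      = (\<integral>\<^sup>+w. (\<lambda>s. ennreal (h s) * indicator {..<R\<^sup>2} s) ((norm (w::complex))\<^sup>2) \<partial>lborel)"
  proof (intro nn_integral_cong)
    fix w :: complex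
    have "w \<in> ball 0 R \<longleftrightarrow> (norm w)\<^sup>2 \<in> {..<R\<^sup>2}"
      using R by (auto intro: power_strict_mono dest: power2_less_imp_less)
    then show "ennreal (ln (K / max (norm z) (norm w))) * indicator (ball 0 R) w
        = ennreal (h ((norm w)\<^sup>2)) * indicator {..<R\<^sup>2} ((norm w)\<^sup>2)"
      by (simp only: lmax h_def indicator_def)
  qed
  also have "\<dots> = ennreal pi * (\<integral>\<^sup>+s\<in>{0..}. (ennreal (h s) * indicator {..<R\<^sup>2} s) \<partial>lborel)"
    unfolding h_def by (rule nn_integral_complex_radial) measurable
  also have "(\<integral>\<^sup>+s\<in>{0..}. (ennreal (h s) * indicator {..<R\<^sup>2} s) \<partial>lborel) = (\<integral>\<^sup>+s\<in>{0..R\<^sup>2}. ennreal (h s) \<partial>lborel)"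
    using AE_lborel_singleton[of "R\<^sup>2"]
    by (intro nn_integral_cong_AE) (auto split: split_indicator elim!: eventually_mono)
  also have "\<dots> = ennreal (R\<^sup>2 * (ln K - logdisc R z))"
  proof (cases "norm z < R")
    case False
    then have "R\<^sup>2 \<le> a" using R unfolding a_def by (auto intro!: power_mono)
    then have "(\<integral>\<^sup>+s\<in>{0..R\<^sup>2}. ennreal (h s) \<partial>lborel) = (\<integral>\<^sup>+s\<in>{0..R\<^sup>2}. ennreal (h 0) \<partial>lborel)"
      using \<open>a > 0\<close> by (intro nn_integral_cong) (auto simp: h_def max.absorb1 split: split_indicator)
    also have "\<dots> = ennreal (R\<^sup>2 * h 0)"
      using h0[of 0] R by (simp add: nn_integral_cmult_indicator ennreal_mult mult.commute)
    also have "h 0 = ln K - logdisc R z"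
      using False \<open>a > 0\<close> z by (simp add: h_def logdisc_def a_def ln_realpow)
    finally show ?thesis .
  next
    case True
    then have aR: "a < R\<^sup>2" using R unfolding a_def by (auto intro!: power_strict_mono)
    have "(\<integral>\<^sup>+s\<in>{0..R\<^sup>2}. ennreal (h s) \<partial>lborel)
        = (\<integral>\<^sup>+s. ennreal (h s) * indicator {0..a} s + ennreal (h s) * indicator {a..R\<^sup>2} s \<partial>lborel)"
      using AE_lborel_singleton[of a] aR \<open>a > 0\<close>
      by (intro nn_integral_cong_AE) (auto split: split_indicator elim!: eventually_mono)
    also have "\<dots> = (\<integral>\<^sup>+s\<in>{0..a}. ennreal (h s) \<partial>lborel) + (\<integral>\<^sup>+s\<in>{a..R\<^sup>2}. ennreal (h s) \<partial>lborel)"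
      unfolding h_def by (rule nn_integral_add) measurable
    also have "(\<integral>\<^sup>+s\<in>{0..a}. ennreal (h s) \<partial>lborel) = (\<integral>\<^sup>+s\<in>{0..a}. ennreal (h 0) \<partial>lborel)"
      using \<open>a > 0\<close> by (intro nn_integral_cong) (auto simp: h_def max.absorb1 split: split_indicator)
    also have "\<dots> = ennreal (a * h 0)"
      using h0[of 0] \<open>a > 0\<close> by (simp add: nn_integral_cmult_indicator ennreal_mult mult.commute)
    also have "(\<integral>\<^sup>+s\<in>{a..R\<^sup>2}. ennreal (h s) \<partial>lborel)
       = ennreal ((R\<^sup>2 * ln K - (R\<^sup>2 * ln (R\<^sup>2) - R\<^sup>2) / 2) - (a * ln K - (a * ln a - a) / 2))"
    proof (rule nn_integral_FTC_Icc)
      show "((\<lambda>s. s * ln K - (s * ln s - s) / 2) has_real_derivative h s) (at s)" if "s \<in> {a..R\<^sup>2}" for s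
        using that \<open>a > 0\<close> by (auto intro!: derivative_eq_intros simp: h_def field_simps)
      show "0 \<le> h s" if "s \<in> {a..R\<^sup>2}" for s using that by (simp add: h0)
      show "a \<le> R\<^sup>2" using aR by simp
    qed measurable
    also have "ennreal (a * h 0) + \<dots> = ennreal (a * h 0 + ((R\<^sup>2 * ln K - (R\<^sup>2 * ln (R\<^sup>2) - R\<^sup>2) / 2) - (a * ln K - (a * ln a - a) / 2)))"
    proof (rule ennreal_plus[symmetric])
      have D: "((\<lambda>s. s * ln K - (s * ln s - s) / 2) has_real_derivative h s) (at s)" if "a \<le> s" "s \<le> R\<^sup>2" for s
        using that \<open>a > 0\<close> by (auto intro!: derivative_eq_intros simp: h_def field_simps)
      have "(a * ln K - (a * ln a - a) / 2) \<le> (R\<^sup>2 * ln K - (R\<^sup>2 * ln (R\<^sup>2) - R\<^sup>2) / 2)"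
      proof (rule DERIV_nonneg_imp_nondecreasing[where f="\<lambda>s. s * ln K - (s * ln s - s) / 2"])
        show "a \<le> R\<^sup>2" using aR by simp
        show "\<exists>y. ((\<lambda>s. s * ln K - (s * ln s - s) / 2) has_real_derivative y) (at s) \<and> 0 \<le> y"
          if "a \<le> s" "s \<le> R\<^sup>2" for s
          using D[OF that] h0[OF that(2)] by (intro exI conjI)
      qed
      then show "0 \<le> (R\<^sup>2 * ln K - (R\<^sup>2 * ln (R\<^sup>2) - R\<^sup>2) / 2) - (a * ln K - (a * ln a - a) / 2)" by simp
    qed (use h0[of 0] \<open>a > 0\<close> in auto)
    also have "a * h 0 + ((R\<^sup>2 * ln K - (R\<^sup>2 * ln (R\<^sup>2) - R\<^sup>2) / 2) - (a * ln K - (a * ln a - a) / 2))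
        = R\<^sup>2 * (ln K - (ln R - 1 / 2 + a / (2 * R\<^sup>2)))"
      using R \<open>a > 0\<close> by (simp add: h_def ln_realpow field_simps)
    finally show ?thesis using True by (simp add: logdisc_def a_def)
  qed
  finally show ?thesis
    by (simp add: ennreal_mult' mult.assoc)
qed

text \<open>Averaging over all rotations of the disc does not change the integral. After the
  exchange of integrals circle means remain, which replace |z - w| by the larger of |z| and |w|; the
  excluded circle |w| = |z| is a null set.\<close>

lemma nn_integral_disc_ln:
  assumes z: "z \<noteq> (0::complex)" and R: "R > 0" and K: "norm z + R \<le> K"
  shows "(\<integral>\<^sup>+w\<in>ball 0 R. ennreal (ln (K / norm (z - w))) \<partial>lborel)
       = ennreal (pi * R\<^sup>2 * (ln K - logdisc R z))"
proof -
  let ?f = "\<lambda>w. ennreal (ln (K / norm (z - w))) * indicator (ball 0 R) w"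
  have mf: "?f \<in> borel_measurable borel" by measurable
  have "ennreal (2 * pi) * (\<integral>\<^sup>+w. ?f w \<partial>lborel) = (\<integral>\<^sup>+t\<in>{0..2*pi}. (\<integral>\<^sup>+w. ?f w \<partial>lborel) \<partial>(lborel::real measure))"
  proof -
    have "(\<integral>\<^sup>+t\<in>{0..2*pi}. c \<partial>lborel) = c * ennreal (2 * pi)" for c :: ennreal
      by (simp add: nn_integral_cmult_indicator)
    from this[of "\<integral>\<^sup>+w. ?f w \<partial>lborel"] show ?thesis by (subst (asm) mult.commute) (rule sym)
  qed
  also have "\<dots> = (\<integral>\<^sup>+t\<in>{0..2*pi}. (\<integral>\<^sup>+w. ?f (cis t * w) \<partial>lborel) \<partial>lborel)"
  proof (intro nn_integral_cong)
    fix t :: real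
    have "linear (\<lambda>w. cis t * w)" by (simp add: linear_iff algebra_simps)
    then have "(\<integral>\<^sup>+w. ?f (cis t * w) \<partial>lborel) = (\<integral>\<^sup>+w. ?f w \<partial>lborel)"
      by (rule nn_integral_lborel_isometry[OF _ _ mf]) (simp add: norm_mult)
    then show "(\<integral>\<^sup>+w. ?f w \<partial>lborel) * indicator {0..2*pi} t = (\<integral>\<^sup>+w. ?f (cis t * w) \<partial>lborel) * indicator {0..2*pi} t"
      by simp
  qed
  also have "\<dots> = (\<integral>\<^sup>+t. \<integral>\<^sup>+w. ennreal (ln (K / norm (z - cis t * w))) * indicator {0..2*pi} t * indicator (ball 0 R) w \<partial>lborel \<partial>lborel)"
    by (subst nn_integral_multc[symmetric]) (auto intro!: nn_integral_cong simp: norm_mult split: split_indicator)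
  also have "\<dots> = (\<integral>\<^sup>+w. \<integral>\<^sup>+t. ennreal (ln (K / norm (z - cis t * w))) * indicator {0..2*pi} t * indicator (ball 0 R) w \<partial>lborel \<partial>lborel)"
    by (rule lborel_pair.Fubini') measurable
  also have "\<dots> = (\<integral>\<^sup>+w. ennreal (2 * pi) * (ennreal (ln (K / max (norm z) (norm w))) * indicator (ball (0::complex) R) w) \<partial>lborel)"
  proof (rule nn_integral_cong_AE)
    have "AE w in lborel. w \<notin> sphere (0::complex) (norm z)"
      by (rule AE_not_in[OF null_sets_sphere])
    then show "AE w in lborel. (\<integral>\<^sup>+t. ennreal (ln (K / norm (z - cis t * w))) * indicator {0..2*pi} t * indicator (ball 0 R) w \<partial>lborel)
       = ennreal (2 * pi) * (ennreal (ln (K / max (norm z) (norm w))) * indicator (ball 0 R) w)"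
    proof (rule eventually_mono)
      fix w :: complex assume w: "w \<notin> sphere 0 (norm z)"
      show "(\<integral>\<^sup>+t. ennreal (ln (K / norm (z - cis t * w))) * indicator {0..2*pi} t * indicator (ball 0 R) w \<partial>lborel)
         = ennreal (2 * pi) * (ennreal (ln (K / max (norm z) (norm w))) * indicator (ball 0 R) w)"
      proof (cases "w \<in> ball 0 R")
        case True
        then show ?thesis
          using w nn_integral_circle_ln[of z w K] K by (simp add: ennreal_mult')
      qed simp
    qed
  qed
  also have "\<dots> = ennreal (2 * pi) * ennreal (pi * R\<^sup>2 * (ln K - logdisc R z))"
    using nn_integral_disc_ln_max[OF assms] by (simp add: nn_integral_cmult)
  finally show ?thesis
    by (simp add: ennreal_mult_cancel_left)
qed

section \<open>Green's function of a disc and disc means\<close>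

text \<open>The difference of two logarithmic potentials, that of the normalised area of the disc
  and that of the unit mass at 0. It does for disc means what ln (R/|w|) does for circle means. The
  value at 0 is 0 rather than \<infinity>, which integrals over the plane do not see.\<close>

definition disc_green :: "real \<Rightarrow> complex \<Rightarrow> real" where
  "disc_green R w = (if 0 < norm w \<and> norm w < R
     then ln R - 1 / 2 + (norm w)\<^sup>2 / (2 * R\<^sup>2) - ln (norm w) else 0)"

lemma disc_green_measurable [measurable]: "disc_green R \<in> borel_measurable borel"
  unfolding disc_green_def by measurable

lemma disc_green_logdisc: "w \<noteq> 0 \<Longrightarrow> disc_green R w = logdisc R w - ln (norm w)"
  by (simp add: disc_green_def logdisc_def)

lemma disc_green_outside: "R \<le> norm w \<Longrightarrow> disc_green R w = 0"
  by (simp add: disc_green_def)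

lemma ln_le_quotient: "0 < x \<Longrightarrow> 0 < y \<Longrightarrow> ln y - ln x \<le> y / x - (1::real)"
  using ln_le_minus_one[of "y / x"] by (simp add: ln_div)

lemma disc_green_nonneg: "0 \<le> disc_green R w"
proof (cases "0 < norm w \<and> norm w < R")
  case True
  then have "ln ((norm w)\<^sup>2) - ln (R\<^sup>2) \<le> (norm w)\<^sup>2 / R\<^sup>2 - 1"
    by (intro ln_le_quotient) auto
  then show ?thesis using True by (simp add: disc_green_def ln_realpow)
qed (auto simp: disc_green_def)

text \<open>Since |w| <= R, the quadratic terms lose at most (1 - R^2/R'^2)/2, and ln R' - ln R
  makes up for it by ln x <= x - 1 at x = R^2/R'^2.\<close>

lemma disc_green_mono:
  assumes "R \<le> R'" shows "disc_green R w \<le> disc_green R' w"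
proof (cases "0 < norm w \<and> norm w < R")
  case True
  have R: "0 < R" "0 < R'" using conjunct1[OF True] conjunct2[OF True] assms by linarith+
  have "ln (R\<^sup>2) - ln (R'\<^sup>2) \<le> R\<^sup>2 / R'\<^sup>2 - 1"
    using R by (intro ln_le_quotient) auto
  moreover have "R\<^sup>2 * (1 / R\<^sup>2 - 1 / R'\<^sup>2) \<ge> (norm w)\<^sup>2 * (1 / R\<^sup>2 - 1 / R'\<^sup>2)"
    using True assms R by (intro mult_right_mono power_mono) (auto simp: frac_le power_mono)
  ultimately show ?thesis using True assms R
    by (simp add: disc_green_def ln_realpow algebra_simps)
next
  case False
  then have "disc_green R w = 0" by (auto simp: disc_green_def)
  then show ?thesis using disc_green_nonneg[of R' w] by simp
qed

text \<open>The radial profile \<open>\<phi>\<close> increases with slope s/R^2 inside the disc and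
  1/s outside, in both cases at most 1/R. For large R the potentials at two points of bounded
  distance are therefore almost equal.\<close>

lemma logdisc_lipschitz:
  assumes R: "R > 0" shows "logdisc R z - logdisc R w \<le> norm (z - w) / R"
proof -
  define \<phi> where "\<phi> = (\<lambda>x. if x < R then ln R - 1 / 2 + x\<^sup>2 / (2 * R\<^sup>2) else ln x)"
  have inner: "y\<^sup>2 / (2 * R\<^sup>2) - x\<^sup>2 / (2 * R\<^sup>2) \<le> (y - x) / R" if "0 \<le> x" "x \<le> y" "y \<le> R" for x y
  proof -
    have "(y + x) * (y - x) \<le> (2 * R) * (y - x)" using that by (intro mult_right_mono) auto
    then have "(y\<^sup>2 - x\<^sup>2) / (2 * R\<^sup>2) \<le> ((2 * R) * (y - x)) / (2 * R\<^sup>2)"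
      by (intro divide_right_mono) (auto simp: power2_eq_square algebra_simps)
    also have "\<dots> = (y - x) / R" using R by (simp add: power2_eq_square)
    finally show ?thesis by (simp add: diff_divide_distrib)
  qed
  have outer: "ln y - ln x \<le> (y - x) / R" if "R \<le> x" "x \<le> y" for x y
  proof -
    have "ln y - ln x \<le> y / x - 1" using that R by (intro ln_le_quotient) auto
    also have "\<dots> = (y - x) / x" using that R by (simp add: field_simps)
    also have "\<dots> \<le> (y - x) / R" using that R by (intro divide_left_mono) auto
    finally show ?thesis .
  qed
  have up: "\<phi> y - \<phi> x \<le> (y - x) / R" if "0 \<le> x" "x \<le> y" for x y
  proof -
    consider "y < R" | "R \<le> x" | "x < R" "R \<le> y" by linarith
    then show ?thesis
    proof cases
      case 1 then show ?thesis using inner[of x y] that by (simp add: \<phi>_def)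
    next
      case 2 then show ?thesis using outer[of x y] that by (simp add: \<phi>_def)
    next
      case 3 then show ?thesis using inner[of x R] outer[of R y] that R
        by (simp add: \<phi>_def diff_divide_distrib)
    qed
  qed
  have mono: "\<phi> x \<le> \<phi> y" if "0 \<le> x" "x \<le> y" for x y
  proof -
    have a: "x\<^sup>2 / (2 * R\<^sup>2) \<le> y\<^sup>2 / (2 * R\<^sup>2)" using that R by (intro divide_right_mono power_mono) auto
    have b: "x\<^sup>2 / (2 * R\<^sup>2) \<le> 1 / 2" if "x < R"
      using power_mono[of x R 2] \<open>0 \<le> x\<close> that R by (simp add: field_simps)
    consider "y < R" | "R \<le> x" | "x < R" "R \<le> y" by linarith
    then show ?thesis
    proof cases
      case 1 then show ?thesis using a that by (simp add: \<phi>_def)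
    next
      case 2 then show ?thesis using that R by (simp add: \<phi>_def)
    next
      case 3
      then have "ln R \<le> ln y" using R by simp
      then have "ln R - 1 / 2 + x\<^sup>2 / (2 * R\<^sup>2) \<le> ln y" using b[OF 3(1)] by linarith
      then show ?thesis using 3 by (simp add: \<phi>_def)
    qed
  qed
  have "logdisc R z = \<phi> (norm z)" for z by (simp add: logdisc_def \<phi>_def)
  moreover have "\<phi> (norm z) - \<phi> (norm w) \<le> norm (z - w) / R"
  proof (cases "norm w \<le> norm z")
    case True
    then show ?thesis
      using up[of "norm w" "norm z"] R norm_triangle_ineq2[of z w]
      by (smt (verit) divide_right_mono norm_ge_zero)
  next
    case False
    then have "\<phi> (norm z) - \<phi> (norm w) \<le> 0" using mono[of "norm z" "norm w"] by simp
    then show ?thesis using R by (smt (verit) divide_nonneg_pos norm_ge_zero)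
  qed
  ultimately show ?thesis by simp
qed

section \<open>Disc means and correlations of nonnegative functions\<close>

definition dmean :: "real \<Rightarrow> (complex \<Rightarrow> ennreal) \<Rightarrow> complex \<Rightarrow> ennreal" where
  "dmean R h z = (\<integral>\<^sup>+y\<in>ball 0 R. h (z + y) \<partial>lborel) / ennreal (pi * R\<^sup>2)"

text \<open>For an even kernel this is convolution. Values in \<open>ennreal\<close> let every
  exchange of integrals pass by Tonelli's theorem; the price is that identities are arranged without
  subtraction.\<close>

definition corr :: "(complex \<Rightarrow> ennreal) \<Rightarrow> (complex \<Rightarrow> ennreal) \<Rightarrow> complex \<Rightarrow> ennreal" where
  "corr h k z = (\<integral>\<^sup>+w. h (z + w) * k w \<partial>lborel)"

lemma dmean_measurable [measurable]:
  assumes [measurable]: "h \<in> borel_measurable borel"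
  shows "dmean R h \<in> borel_measurable borel"
  unfolding dmean_def[abs_def] by measurable

lemma corr_measurable [measurable]:
  assumes [measurable]: "h \<in> borel_measurable borel" "k \<in> borel_measurable borel"
  shows "corr h k \<in> borel_measurable borel"
  unfolding corr_def[abs_def] by measurable

lemma dmean_cong:
  "(\<And>w. w \<in> ball z R \<Longrightarrow> h w = k w) \<Longrightarrow> dmean R h z = dmean R k z"
  unfolding dmean_def
  by (intro arg_cong2[where f="(/)"] nn_integral_cong refl) (auto simp: dist_norm split: split_indicator)

lemma dmean_mono:
  "(\<And>w. w \<in> ball z R \<Longrightarrow> h w \<le> k w) \<Longrightarrow> dmean R h z \<le> dmean R k z"
  unfolding dmean_def
  by (intro divide_right_mono_ennreal nn_integral_mono) (auto simp: dist_norm split: split_indicator)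

lemma dmean_const: "R > 0 \<Longrightarrow> dmean R (\<lambda>_. c) z = c"
  unfolding dmean_def
  by (simp add: nn_integral_cmult_indicator emeasure_ball_complex ennreal_mult_divide_eq)

lemma dmean_add:
  assumes [measurable]: "h \<in> borel_measurable borel" "k \<in> borel_measurable borel"
  shows "dmean R (\<lambda>w. h w + k w) z = dmean R h z + dmean R k z"
  unfolding dmean_def
  by (simp add: distrib_right nn_integral_add add_divide_distrib_ennreal)

lemma dmean_corr:
  assumes [measurable]: "h \<in> borel_measurable borel" "k \<in> borel_measurable borel"
  shows "dmean R (corr h k) z = corr (dmean R h) k z"
proof -
  have "(\<integral>\<^sup>+y. (\<integral>\<^sup>+w. h (z + y + w) * k w \<partial>lborel) * indicator (ball 0 R) y \<partial>lborel)
      = (\<integral>\<^sup>+y. \<integral>\<^sup>+w. h (z + y + w) * indicator (ball 0 R) y * k w \<partial>lborel \<partial>lborel)"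
    by (subst nn_integral_multc[symmetric]) (auto simp: mult_ac)
  also have "\<dots> = (\<integral>\<^sup>+w. \<integral>\<^sup>+y. h (z + y + w) * indicator (ball 0 R) y * k w \<partial>lborel \<partial>lborel)"
    by (rule lborel_pair.Fubini') measurable
  also have "\<dots> = (\<integral>\<^sup>+w. (\<integral>\<^sup>+y. h (z + w + y) * indicator (ball 0 R) y \<partial>lborel) * k w \<partial>lborel)"
    by (subst nn_integral_multc[symmetric]) (auto simp: add_ac)
  finally have *: "(\<integral>\<^sup>+y. (\<integral>\<^sup>+w. h (z + y + w) * k w \<partial>lborel) * indicator (ball 0 R) y \<partial>lborel)
      = (\<integral>\<^sup>+w. (\<integral>\<^sup>+y. h (z + w + y) * indicator (ball 0 R) y \<partial>lborel) * k w \<partial>lborel)" .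
  have "(\<integral>\<^sup>+w. (\<integral>\<^sup>+y. h (z + w + y) * indicator (ball 0 R) y \<partial>lborel) * c * k w \<partial>lborel)
      = (\<integral>\<^sup>+w. (\<integral>\<^sup>+y. h (z + w + y) * indicator (ball 0 R) y \<partial>lborel) * k w \<partial>lborel) * c" for c
    by (subst nn_integral_multc[symmetric]) (measurable, simp add: mult_ac)
  then show ?thesis
    unfolding dmean_def corr_def divide_ennreal_def * by simp
qed

text \<open>A disc is symmetric about its centre, so a mean over the first argument can be moved
  onto the kernel by y -> -y and a shift of w.\<close>

lemma dmean_corr':
  assumes [measurable]: "h \<in> borel_measurable borel" "k \<in> borel_measurable borel"
  shows "dmean R (corr h k) z = corr h (dmean R k) z"
proof -
  have "(\<integral>\<^sup>+y. (\<integral>\<^sup>+w. h (z + y + w) * k w \<partial>lborel) * indicator (ball 0 R) y \<partial>lborel)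
      = (\<integral>\<^sup>+y. (\<integral>\<^sup>+w. h (z - y + w) * k w \<partial>lborel) * indicator (ball 0 R) y \<partial>lborel)"
    using nn_integral_lborel_reflect[of "\<lambda>y. (\<integral>\<^sup>+w. h (z + y + w) * k w \<partial>lborel) * indicator (ball 0 R) y" 0]
    by (simp add: indicator_def)
  also have "\<dots> = (\<integral>\<^sup>+y. (\<integral>\<^sup>+w. h (z + w) * k (y + w) \<partial>lborel) * indicator (ball 0 R) y \<partial>lborel)"
  proof (rule nn_integral_cong)
    fix y
    have "(\<integral>\<^sup>+w. h (z - y + w) * k w \<partial>lborel) = (\<integral>\<^sup>+w. h (z + w) * k (y + w) \<partial>lborel)"
      using nn_integral_lborel_shift[of "\<lambda>w. h (z - y + w) * k w" y] by simp
    then show "(\<integral>\<^sup>+w. h (z - y + w) * k w \<partial>lborel) * indicator (ball 0 R) y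
        = (\<integral>\<^sup>+w. h (z + w) * k (y + w) \<partial>lborel) * indicator (ball 0 R) y" by simp
  qed
  also have "\<dots> = (\<integral>\<^sup>+y. \<integral>\<^sup>+w. h (z + w) * k (w + y) * indicator (ball 0 R) y \<partial>lborel \<partial>lborel)"
    by (subst nn_integral_multc[symmetric]) (auto simp: add_ac)
  also have "\<dots> = (\<integral>\<^sup>+w. \<integral>\<^sup>+y. h (z + w) * k (w + y) * indicator (ball 0 R) y \<partial>lborel \<partial>lborel)"
    by (rule lborel_pair.Fubini') measurable
  also have "\<dots> = (\<integral>\<^sup>+w. h (z + w) * (\<integral>\<^sup>+y. k (w + y) * indicator (ball 0 R) y \<partial>lborel) \<partial>lborel)"
    by (subst nn_integral_cmult[symmetric]) (auto simp: mult_ac)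
  finally have *: "(\<integral>\<^sup>+y. (\<integral>\<^sup>+w. h (z + y + w) * k w \<partial>lborel) * indicator (ball 0 R) y \<partial>lborel)
      = (\<integral>\<^sup>+w. h (z + w) * (\<integral>\<^sup>+y. k (w + y) * indicator (ball 0 R) y \<partial>lborel) \<partial>lborel)" .
  have "(\<integral>\<^sup>+w. h (z + w) * ((\<integral>\<^sup>+y. k (w + y) * indicator (ball 0 R) y \<partial>lborel) * c) \<partial>lborel)
      = (\<integral>\<^sup>+w. h (z + w) * (\<integral>\<^sup>+y. k (w + y) * indicator (ball 0 R) y \<partial>lborel) \<partial>lborel) * c" for c
    by (subst nn_integral_multc[symmetric]) (measurable, simp add: mult_ac)
  then show ?thesis
    unfolding dmean_def corr_def divide_ennreal_def * by simp
qed

text \<open>A disc mean is itself a correlation, with the normalised indicator of the disc, so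
  \<open>dmean_corr\<close> gives the exchange.\<close>

lemma dmean_commute:
  assumes [measurable]: "h \<in> borel_measurable borel"
  shows "dmean R (dmean r h) z = dmean r (dmean R h) z"
proof -
  define k where "k = (\<lambda>w. indicator (ball (0::complex) r) w / ennreal (pi * r\<^sup>2))"
  have [measurable]: "k \<in> borel_measurable borel" unfolding k_def by measurable
  have "dmean r h = corr h k" if [measurable]: "h \<in> borel_measurable borel" for h
    unfolding dmean_def corr_def k_def divide_ennreal_def
    by (intro ext, subst nn_integral_multc[symmetric]) (measurable, simp add: mult.assoc)
  then show ?thesis by (simp add: dmean_corr)
qed

lemma dmean_ln:
  assumes "z \<noteq> 0" "R > 0" "norm z + R \<le> K"
  shows "dmean R (\<lambda>w. ennreal (ln (K / norm w))) z = ennreal (ln K - logdisc R z)"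
proof -
  have "(\<integral>\<^sup>+y\<in>ball 0 R. ennreal (ln (K / norm (z + y))) \<partial>lborel)
      = (\<integral>\<^sup>+y\<in>ball 0 R. ennreal (ln (K / norm (z - y))) \<partial>lborel)"
    using nn_integral_lborel_reflect[of "\<lambda>y. ennreal (ln (K / norm (z + y))) * indicator (ball 0 R) y" 0]
    by (simp add: indicator_def)
  moreover have "ennreal (pi * R\<^sup>2 * v) = ennreal v * ennreal (pi * R\<^sup>2)" for v
    by (subst mult.commute) (simp add: ennreal_mult'')
  moreover have "ennreal v * ennreal (pi * R\<^sup>2) / ennreal (pi * R\<^sup>2) = ennreal v" for v
    using \<open>R > 0\<close> by (intro ennreal_mult_divide_eq) auto
  ultimately show ?thesis
    unfolding dmean_def nn_integral_disc_ln[OF assms] by simp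
qed

text \<open>Both sides arise from \<open>ln * (\<delta>\<^sub>0 - \<chi>\<^sub>r) * (\<delta>\<^sub>0 - \<chi>\<^sub>R)\<close> with \<open>\<chi>\<^sub>r\<close> the normalised indicator of the disc,
  written without subtraction.\<close>

lemma disc_green_commute:
  assumes x: "x \<noteq> 0" and r: "r > 0" and R: "R > 0"
  shows "dmean R (disc_green r) x + disc_green R x = disc_green r x + dmean r (disc_green R) x"
proof -
  \<comment> \<open>Large enough for ln (K/|w|) to be nonnegative wherever two successive disc means
    around \<open>x\<close> evaluate it.\<close>
  define K where "K = norm x + R + r + R + r"
  have K: "K > 0" using r R norm_ge_zero[of x] unfolding K_def by linarith
  define l where "l = (\<lambda>w. ennreal (ln (K / norm (w::complex))))"
  have [measurable]: "l \<in> borel_measurable borel" unfolding l_def by measurable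
  have dl: "dmean s l w = ennreal (ln K - logdisc s w)" "logdisc s w \<le> ln K"
    if "w \<noteq> 0" "s > 0" "norm w + s \<le> K" for s w
  proof -
    show "dmean s l w = ennreal (ln K - logdisc s w)" unfolding l_def using that by (rule dmean_ln)
    have "norm w < s \<Longrightarrow> (norm w)\<^sup>2 / (2 * s\<^sup>2) \<le> 1 / 2"
      using power_mono[of "norm w" s 2] that by (simp add: field_simps)
    moreover have "ln s \<le> ln K" using that K norm_ge_zero[of w] by (intro ln_mono) linarith+
    moreover have "ln (norm w) \<le> ln K" using that K by (intro ln_mono) auto
    ultimately show "logdisc s w \<le> ln K" unfolding logdisc_def by auto
  qed
  have l_split: "l w = ennreal (disc_green s w) + dmean s l w"
    if "w \<noteq> 0" "s > 0" "norm w + s \<le> K" for s w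
  proof -
    have "ln (K / norm w) = disc_green s w + (ln K - logdisc s w)"
      using that K by (simp add: disc_green_logdisc ln_div)
    then have "l w = ennreal (disc_green s w + (ln K - logdisc s w))" by (simp add: l_def)
    then show ?thesis
      unfolding dl(1)[OF that] using dl(2)[OF that] disc_green_nonneg by simp
  qed
  have split: "dmean t l x = dmean t (disc_green s) x + dmean t (dmean s l) x"
    if "s > 0" "norm x + t + s \<le> K" for s t
  proof -
    have "dmean t l x = (\<integral>\<^sup>+y\<in>ball 0 t. ennreal (disc_green s (x + y)) + dmean s l (x + y) \<partial>lborel) / ennreal (pi * t\<^sup>2)"
      unfolding dmean_def[of t]
    proof (intro arg_cong2[where f="(/)"] refl nn_integral_cong_AE)
      show "AE y in lborel. l (x + y) * indicator (ball 0 t) y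
          = (ennreal (disc_green s (x + y)) + dmean s l (x + y)) * indicator (ball 0 t) y"
      proof (rule eventually_mono[OF AE_lborel_singleton[of "-x"]])
        fix y assume y: "y \<noteq> - x"
        have "l (x + y) = ennreal (disc_green s (x + y)) + dmean s l (x + y)" if "norm y < t"
          using y \<open>s > 0\<close> \<open>norm x + t + s \<le> K\<close> that norm_triangle_ineq[of x y]
          by (intro l_split) (auto simp: add_eq_0_iff)
        then show "l (x + y) * indicator (ball 0 t) y
          = (ennreal (disc_green s (x + y)) + dmean s l (x + y)) * indicator (ball 0 t) y"
          by (auto split: split_indicator)
      qed
    qed
    also have "\<dots> = dmean t (\<lambda>w. ennreal (disc_green s w) + dmean s l w) x"
      by (simp add: dmean_def)
    finally show ?thesis by (simp add: dmean_add)
  qed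
  \<comment> \<open>Splitting \<open>l\<close> for one radius under the mean of the other produces
    the same iterated mean in both lines. All terms are finite, so it can be cancelled in the
    reals.\<close>
  have 1: "ennreal (ln K - logdisc R x) = dmean R (disc_green r) x + dmean R (dmean r l) x"
    using split[of r R] dl(1)[of x R] x r R by (simp add: K_def)
  have 2: "ennreal (ln K - logdisc r x) = dmean r (disc_green R) x + dmean R (dmean r l) x"
    using split[of R r] dl(1)[of x r] x r R by (simp add: K_def dmean_commute[of l r R])
  have le: "logdisc R x \<le> ln K" "logdisc r x \<le> ln K"
    by (rule dl(2); use x r R in \<open>simp add: K_def\<close>)+
  obtain a where a: "dmean R (disc_green r) x = ennreal a" "0 \<le> a"
    using 1 by (metis ennreal_add_eq_top ennreal_cases ennreal_neq_top)
  obtain b where b: "dmean r (disc_green R) x = ennreal b" "0 \<le> b"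
    using 2 by (metis ennreal_add_eq_top ennreal_cases ennreal_neq_top)
  obtain c where c: "dmean R (dmean r l) x = ennreal c" "0 \<le> c"
    using 2 by (metis ennreal_add_eq_top ennreal_cases ennreal_neq_top)
  have "ln K - logdisc R x = a + c" "ln K - logdisc r x = b + c"
    using 1 2 a b c le by (simp_all flip: ennreal_plus)
  then have "a + disc_green R x = disc_green r x + b"
    using x by (simp add: disc_green_logdisc)
  then show ?thesis
    unfolding a(1) b(1) using a b disc_green_nonneg by (simp flip: ennreal_plus)
qed

text \<open>\<open>disc_green_commute\<close> integrated against \<open>p\<close>. For p = H - f it
  turns into a Jensen formula for the average of f against \<open>disc_green r\<close>, without any
  derivative of f.\<close>

lemma dmean_corr_disc_green:
  assumes [measurable]: "p \<in> borel_measurable borel" and "r > 0" "R > 0"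
  shows "dmean R (corr p (disc_green r)) z + corr p (disc_green R) z
       = corr p (disc_green r) z + corr (dmean r p) (disc_green R) z"
proof -
  have add: "corr p (\<lambda>w. a w + b w) z = corr p a z + corr p b z"
    if [measurable]: "a \<in> borel_measurable borel" "b \<in> borel_measurable borel" for a b
    unfolding corr_def by (simp add: distrib_left nn_integral_add)
  have "corr p (\<lambda>w. dmean R (disc_green r) w + disc_green R w) z
      = corr p (\<lambda>w. disc_green r w + dmean r (disc_green R) w) z"
    unfolding corr_def
    by (intro nn_integral_cong_AE eventually_mono[OF AE_lborel_singleton[of 0]])
      (use disc_green_commute assms in auto)
  then show ?thesis
    using assms by (simp add: add dmean_corr' dmean_corr[symmetric])
qed

text \<open>Finiteness: \<open>nn_integral_disc_ln\<close> needs its pole away from the centre of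
  the disc, so the kernel is moved to the point r and its support is covered by the disc of radius
  2r about 0. Positivity: for |w| < r/4 the kernel is at least ln 4 - 1/2 >= 1/2.\<close>

lemma disc_green_integral:
  assumes r: "r > 0"
  obtains \<kappa> where "\<kappa> > 0" "(\<integral>\<^sup>+w. disc_green r w \<partial>lborel) = ennreal \<kappa>"
proof -
  have "(\<integral>\<^sup>+w. disc_green r w \<partial>lborel) \<le> (\<integral>\<^sup>+w\<in>ball (0::complex) (2 * r). ennreal (ln (4 * r / norm (of_real r - w))) \<partial>lborel)"
  proof -
    have "(\<integral>\<^sup>+w. disc_green r w \<partial>lborel) = (\<integral>\<^sup>+w. disc_green r (of_real r - w) \<partial>lborel)"
      by (rule nn_integral_lborel_reflect[symmetric]) measurable
    also have "\<dots> \<le> (\<integral>\<^sup>+w\<in>ball (0::complex) (2 * r). ennreal (ln (4 * r / norm (of_real r - w))) \<partial>lborel)"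
    proof (intro nn_integral_mono)
      fix w :: complex
      show "ennreal (disc_green r (of_real r - w)) \<le> ennreal (ln (4 * r / norm (of_real r - w))) * indicator (ball 0 (2 * r)) w"
      proof (cases "0 < norm (of_real r - w) \<and> norm (of_real r - w) < r")
        case True
        define x where "x = norm (complex_of_real r - w)"
        have "norm w < 2 * r"
          using True r norm_triangle_ineq2[of w "of_real r"] by (simp add: norm_minus_commute)
        moreover have "x\<^sup>2 / (2 * r\<^sup>2) \<le> 1 / 2"
          using True power_mono[of x r 2] r by (simp add: field_simps x_def)
        moreover have "ln r \<le> ln (4 * r)" using r by simp
        ultimately have "norm w < 2 * r" "ln r - 1 / 2 + x\<^sup>2 / (2 * r\<^sup>2) - ln x \<le> ln (4 * r) - ln x"
          by linarith+
        then show ?thesis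
          using True r unfolding disc_green_def x_def[symmetric] by (auto simp: ln_div simp del: ln_mult intro!: ennreal_leI)
      qed (auto simp: disc_green_def)
    qed
    finally show ?thesis .
  qed
  also have "\<dots> < \<infinity>"
    using r by (subst nn_integral_disc_ln) auto
  finally have fin: "(\<integral>\<^sup>+w. disc_green r w \<partial>lborel) < \<infinity>" .
  define c :: real where "c = 1 / 2"
  have c: "c > 0" by (simp add: c_def)
  have "0 < ennreal c * emeasure lborel (ball (0::complex) (r / 4))"
    using r c by (simp add: emeasure_ball_complex ennreal_zero_less_mult_iff)
  also have "\<dots> = (\<integral>\<^sup>+w\<in>ball (0::complex) (r / 4). ennreal c \<partial>lborel)"
    by (simp add: nn_integral_cmult_indicator)
  also have "\<dots> \<le> (\<integral>\<^sup>+w. disc_green r w \<partial>lborel)"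
  proof (intro nn_integral_mono_AE eventually_mono[OF AE_lborel_singleton[of 0]])
    fix w :: complex assume "w \<noteq> 0"
    have "c \<le> disc_green r w" if "norm w < r / 4"
    proof -
      have "ln (norm w) - ln (r / 4) \<le> norm w / (r / 4) - 1"
        using \<open>w \<noteq> 0\<close> r by (intro ln_le_quotient) auto
      moreover have "norm w / (r / 4) \<le> 1" using that r by (simp add: field_simps)
      moreover have "ln (r / 4) = ln r - 2 * ln 2"
        using r ln_realpow[of 2 2] by (simp add: ln_div)
      moreover have "ln (2::real) \<ge> 1 / 2"
        using ln_le_quotient[of 2 1] by simp
      moreover have "(norm w)\<^sup>2 / (2 * r\<^sup>2) \<ge> 0" by simp
      ultimately have "c \<le> ln r - 1 / 2 + (norm w)\<^sup>2 / (2 * r\<^sup>2) - ln (norm w)"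
        unfolding c_def by linarith
      then show ?thesis using that r \<open>w \<noteq> 0\<close> by (simp add: disc_green_def)
    qed
    then show "ennreal c * indicator (ball 0 (r / 4)) w \<le> ennreal (disc_green r w)"
      by (auto split: split_indicator intro!: ennreal_leI)
  qed
  finally show ?thesis
    using fin that by (metis ennreal_cases ennreal_eq_zero_iff infinity_ennreal_def less_irrefl not_le order_less_le)
qed

section \<open>Jensen formula for regularised subharmonic functions\<close>

text \<open>Jensen's inequality for the probability measure that arises by adding an atom of the
  missing mass at which X is 0; the atom contributes exp 0 = 1 per unit of mass. The proof
  integrates the tangent of exp at c, the integral of X, and uses (1 - c) exp c <= 1 for the
  atom.\<close>

lemma exp_integral_le_subprobability:
  assumes int: "integrable N X" and le: "emeasure N (space N) \<le> 1"
  shows "ennreal (exp (\<integral>x. X x \<partial>N)) \<le> (\<integral>\<^sup>+x. ennreal (exp (X x)) \<partial>N) + (1 - emeasure N (space N))"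
proof (cases "(\<integral>\<^sup>+x. ennreal (exp (X x)) \<partial>N) = \<infinity>")
  case False
  have fin: "emeasure N (space N) \<noteq> \<infinity>"
    using le ennreal_one_less_top leD by (fastforce simp: less_top[symmetric])
  interpret finite_measure N
    by (rule finite_measureI) (rule fin)
  note [measurable] = borel_measurable_integrable[OF int]
  define c m where "c = (\<integral>x. X x \<partial>N)" and "m = measure N (space N)"
  have m: "emeasure N (space N) = ennreal m" "0 \<le> m" "m \<le> 1"
    using le by (simp_all add: m_def emeasure_eq_measure)
  have inte: "integrable N (\<lambda>x. exp (X x))"
    using False by (intro integrableI_nonneg) (auto simp: top.not_eq_extremum)
  have "(\<integral>x. exp c * (1 + (X x - c)) \<partial>N) \<le> (\<integral>x. exp (X x) \<partial>N)"
  proof (rule integral_mono)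
    show "exp c * (1 + (X x - c)) \<le> exp (X x)" for x
      using mult_left_mono[OF exp_ge_add_one_self[of "X x - c"], of "exp c"]
      by (simp add: mult_exp_exp)
    show "integrable N (\<lambda>x. exp c * (1 + (X x - c)))" using int by simp
  qed (fact inte)
  moreover have "(\<integral>x. exp c * (1 + (X x - c)) \<partial>N) = exp c * (m + (c - c * m))"
    using int by (simp add: c_def m_def mult.commute)
  moreover have "exp c * ((1 - c) * (1 - m)) \<le> 1 - m"
  proof -
    have "exp c * (1 - c) \<le> exp c * exp (- c)"
      using exp_ge_add_one_self[of "- c"] by (intro mult_left_mono) auto
    then have "exp c * (1 - c) \<le> 1" by (simp add: exp_minus)
    then have "exp c * (1 - c) * (1 - m) \<le> 1 * (1 - m)" using m by (intro mult_right_mono) auto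
    then show ?thesis by (simp add: mult.assoc)
  qed
  moreover have "exp c * (m + (c - c * m)) + exp c * ((1 - c) * (1 - m)) = exp c"
    by (simp add: algebra_simps)
  ultimately have "exp c \<le> (\<integral>x. exp (X x) \<partial>N) + (1 - m)"
    by linarith
  then have "ennreal (exp c) \<le> ennreal ((\<integral>x. exp (X x) \<partial>N) + (1 - m))" by (rule ennreal_leI)
  also have "\<dots> = (\<integral>\<^sup>+x. ennreal (exp (X x)) \<partial>N) + (1 - emeasure N (space N))"
    using m inte by (simp add: nn_integral_eq_integral ennreal_minus[symmetric])
  finally show ?thesis by (simp add: c_def)
qed simp

lemma ennreal_add_middle_cancel:
  fixes a b c d :: ennreal
  assumes "a + (b + c) = d + b" "b \<noteq> top"
  shows "a + c = d"
proof -
  have "b + (a + c) = b + d" using assms(1) by (simp add: ac_simps)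
  then show ?thesis using assms(2) by (simp add: ennreal_add_left_cancel)
qed

text \<open>Transfers between real integrals of f against a kernel supported in a disc and
  nonnegative integrals of H - f, where \<open>H\<close> bounds f on that disc only. It serves both
  \<open>disc_green r\<close> and the indicators of discs.\<close>

lemma nn_integral_continuous_kernel:
  fixes f k :: "complex \<Rightarrow> real"
  assumes cont: "continuous_on UNIV f" and [measurable]: "k \<in> borel_measurable borel"
    and k: "\<And>w. 0 \<le> k w" "\<And>w. r \<le> norm w \<Longrightarrow> k w = 0" "(\<integral>\<^sup>+w. k w \<partial>lborel) = ennreal \<kappa>" "0 \<le> \<kappa>"
  shows "integrable lborel k" "(\<integral>w. k w \<partial>lborel) = \<kappa>" "integrable lborel (\<lambda>w. f (z + w) * k w)"
    and "(\<And>w. norm w < r \<Longrightarrow> f (z + w) \<le> H) \<Longrightarrow>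
       (\<integral>\<^sup>+w. ennreal (H - f (z + w)) * ennreal (k w) \<partial>lborel) = ennreal (H * \<kappa> - (\<integral>w. f (z + w) * k w \<partial>lborel))
       \<and> (\<integral>w. f (z + w) * k w \<partial>lborel) \<le> H * \<kappa>"
proof -
  have [measurable]: "f \<in> borel_measurable borel" using cont by (rule borel_measurable_continuous_onI)
  show ik: "integrable lborel k" using k by (intro integrableI_nonneg) auto
  then show ek: "(\<integral>w. k w \<partial>lborel) = \<kappa>"
    using k by (simp add: integral_eq_nn_integral)
  have "compact (f ` cball z r)"
    using cont by (intro compact_continuous_image) (auto intro: continuous_on_subset)
  then obtain B where B: "\<And>w. w \<in> cball z r \<Longrightarrow> \<bar>f w\<bar> \<le> B"
    by (meson bounded_real compact_imp_bounded image_eqI)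
  show ifk: "integrable lborel (\<lambda>w. f (z + w) * k w)"
  proof (rule Bochner_Integration.integrable_bound)
    show "integrable lborel (\<lambda>w. B * k w)" using ik by simp
    show "AE w in lborel. norm (f (z + w) * k w) \<le> norm (B * k w)"
    proof (rule AE_I2)
      fix w :: complex
      show "norm (f (z + w) * k w) \<le> norm (B * k w)"
      proof (cases "norm w < r")
        case True
        then have "\<bar>f (z + w)\<bar> \<le> \<bar>B\<bar>" using B[of "z + w"] by (simp add: dist_norm)
        then show ?thesis by (simp add: abs_mult mult_right_mono)
      qed (use k in auto)
    qed
  qed measurable
  show "(\<integral>\<^sup>+w. ennreal (H - f (z + w)) * ennreal (k w) \<partial>lborel) = ennreal (H * \<kappa> - (\<integral>w. f (z + w) * k w \<partial>lborel))
       \<and> (\<integral>w. f (z + w) * k w \<partial>lborel) \<le> H * \<kappa>"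
    if H: "\<And>w. norm w < r \<Longrightarrow> f (z + w) \<le> H"
  proof -
    have nn: "0 \<le> (H - f (z + w)) * k w" for w
      using H[of w] k(1,2)[of w] by (cases "norm w < r") auto
    have int: "integrable lborel (\<lambda>w. (H - f (z + w)) * k w)"
      using ik ifk by (simp add: left_diff_distrib)
    have "(\<integral>\<^sup>+w. ennreal (H - f (z + w)) * ennreal (k w) \<partial>lborel) = (\<integral>\<^sup>+w. ennreal ((H - f (z + w)) * k w) \<partial>lborel)"
      using k(1) by (simp add: ennreal_mult'')
    also have "\<dots> = ennreal (\<integral>w. (H - f (z + w)) * k w \<partial>lborel)"
      using int nn by (simp add: nn_integral_eq_integral)
    also have eq: "(\<integral>w. (H - f (z + w)) * k w \<partial>lborel) = H * \<kappa> - (\<integral>w. f (z + w) * k w \<partial>lborel)"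
      using ik ifk by (simp add: left_diff_distrib ek)
    moreover have "0 \<le> (\<integral>w. (H - f (z + w)) * k w \<partial>lborel)"
      using nn by (intro Bochner_Integration.integral_nonneg)
    ultimately show ?thesis using eq by simp
  qed
qed

section \<open>Regularisation of continuous subharmonic functions\<close>

definition green_mean :: "(complex \<Rightarrow> real) \<Rightarrow> real \<Rightarrow> complex \<Rightarrow> real" where
  "green_mean f r z = (\<integral>w. f (z + w) * disc_green r w \<partial>lborel) / (\<integral>w. disc_green r w \<partial>lborel)"

definition area_mean :: "(complex \<Rightarrow> real) \<Rightarrow> real \<Rightarrow> complex \<Rightarrow> real" where
  "area_mean f r z = (\<integral>w. f (z + w) * indicator (ball 0 r) w \<partial>lborel) / (pi * r\<^sup>2)"

text \<open>The Riesz density of \<open>green_mean f r\<close>. The Laplacian of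
  \<open>disc_green r\<close> is 2\<pi> times the normalised area minus the unit mass at 0, so
  differentiating the average of f against it leaves disc mean minus f. Defined by this difference,
  it needs no smoothness of f.\<close>

definition laplace_mean :: "(complex \<Rightarrow> real) \<Rightarrow> real \<Rightarrow> complex \<Rightarrow> real" where
  "laplace_mean f r z = (area_mean f r z - f z) / (\<integral>w. disc_green r w \<partial>lborel)"

lemma disc_green_integral_pos:
  assumes "r > 0"
  shows "0 < (\<integral>w. disc_green r w \<partial>lborel)"
    "(\<integral>\<^sup>+w. disc_green r w \<partial>lborel) = ennreal (\<integral>w. disc_green r w \<partial>lborel)"
proof -
  obtain \<kappa> where "\<kappa> > 0" "(\<integral>\<^sup>+w. disc_green r w \<partial>lborel) = ennreal \<kappa>"
    using disc_green_integral[OF assms] .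
  then show "0 < (\<integral>w. disc_green r w \<partial>lborel)"
    "(\<integral>\<^sup>+w. disc_green r w \<partial>lborel) = ennreal (\<integral>w. disc_green r w \<partial>lborel)"
    by (simp_all add: integral_eq_nn_integral disc_green_nonneg)
qed

lemma green_mean_tendsto:
  assumes cont: "continuous_on UNIV f"
  shows "((\<lambda>r. green_mean f r z) \<longlongrightarrow> f z) (at_right 0)"
proof (rule tendstoI)
  fix e :: real assume "e > 0"
  obtain d where d: "d > 0" "\<And>w. norm w < d \<Longrightarrow> \<bar>f (z + w) - f z\<bar> < e / 2"
  proof -
    have "isCont f z" using cont by (simp add: continuous_on_eq_continuous_at)
    then obtain d where "d > 0" "\<And>w. dist w z < d \<Longrightarrow> dist (f w) (f z) < e / 2"
      using \<open>e > 0\<close> unfolding continuous_at_eps_delta by (metis half_gt_zero)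
    then show ?thesis by (intro that[of d]) (auto simp: dist_norm)
  qed
  have "dist (green_mean f r z) (f z) < e" if r: "0 < r" "r < d" for r
  proof -
    define \<kappa> where "\<kappa> = (\<integral>w. disc_green r w \<partial>lborel)"
    have \<kappa>: "\<kappa> > 0" "(\<integral>\<^sup>+w. disc_green r w \<partial>lborel) = ennreal \<kappa>"
      using disc_green_integral_pos[OF r(1)] by (simp_all add: \<kappa>_def)
    note I = nn_integral_continuous_kernel(1,2)[OF cont disc_green_measurable disc_green_nonneg disc_green_outside \<kappa>(2) less_imp_le[OF \<kappa>(1)]]
      nn_integral_continuous_kernel(3)[OF cont disc_green_measurable disc_green_nonneg disc_green_outside \<kappa>(2) less_imp_le[OF \<kappa>(1)], where z=z]
    have "\<bar>\<integral>w. (f (z + w) - f z) * disc_green r w \<partial>lborel\<bar> \<le> (\<integral>w. \<bar>(f (z + w) - f z) * disc_green r w\<bar> \<partial>lborel)"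
      by (rule integral_abs_bound)
    also have "\<dots> \<le> (\<integral>w. e / 2 * disc_green r w \<partial>lborel)"
    proof (rule integral_mono)
      show "integrable lborel (\<lambda>w. \<bar>(f (z + w) - f z) * disc_green r w\<bar>)"
        using I by (intro integrable_abs) (simp add: left_diff_distrib)
      show "integrable lborel (\<lambda>w. e / 2 * disc_green r w)" using I by simp
      fix w show "\<bar>(f (z + w) - f z) * disc_green r w\<bar> \<le> e / 2 * disc_green r w"
      proof (cases "norm w < r")
        case True
        then have "\<bar>f (z + w) - f z\<bar> \<le> e / 2" using d(2)[of w] r by simp
        from mult_right_mono[OF this disc_green_nonneg[of r w]] show ?thesis
          by (simp add: abs_mult disc_green_nonneg)
      qed (simp add: disc_green_outside)
    qed
    also have "\<dots> = e / 2 * \<kappa>" by (simp add: \<kappa>_def)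
    also have "(\<integral>w. (f (z + w) - f z) * disc_green r w \<partial>lborel) = green_mean f r z * \<kappa> - f z * \<kappa>"
      using I \<kappa>(1) by (simp add: left_diff_distrib green_mean_def \<kappa>_def[symmetric])
    also have "\<dots> = (green_mean f r z - f z) * \<kappa>" by (simp add: left_diff_distrib)
    finally have "\<bar>green_mean f r z - f z\<bar> \<le> e / 2" using \<kappa>(1) by (simp add: abs_mult)
    then show ?thesis using \<open>e > 0\<close> by (simp add: dist_norm)
  qed
  then show "\<forall>\<^sub>F r in at_right 0. dist (green_mean f r z) (f z) < e"
    using d(1) unfolding eventually_at_right_field by (intro exI[of _ d]) auto
qed

text \<open>The sub-mean inequality is stated for H - f, with \<open>H\<close> a bound on the disc,
  because disc means take values in \<open>ennreal\<close>. The radius \<open>r\<close> is the scale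
  of the regularisation \<open>P\<close>.\<close>

locale disc_subharmonic =
  fixes f :: "complex \<Rightarrow> real" and C r :: real
  assumes cont: "continuous_on UNIV f"
    and growth: "\<And>z. f z \<le> ln (max 1 (norm z)) + C"
    and submean: "\<And>z s H. s > 0 \<Longrightarrow> (\<And>w. w \<in> ball z s \<Longrightarrow> f w \<le> H) \<Longrightarrow>
       dmean s (\<lambda>w. ennreal (H - f w)) z \<le> ennreal (H - f z)"
    and r: "r > 0"
begin

abbreviation "\<kappa> \<equiv> (\<integral>w. disc_green r w \<partial>lborel)"
abbreviation "P \<equiv> green_mean f r"
abbreviation "m \<equiv> laplace_mean f r"

lemma f_measurable [measurable]: "f \<in> borel_measurable borel"
  using cont by (rule borel_measurable_continuous_onI)

lemma green_mean_measurable [measurable]: "P \<in> borel_measurable borel"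
  unfolding green_mean_def[abs_def] by measurable

lemma laplace_mean_measurable [measurable]: "m \<in> borel_measurable borel"
  unfolding laplace_mean_def[abs_def] area_mean_def[abs_def] by measurable

lemma kappa: "\<kappa> > 0" "(\<integral>\<^sup>+w. disc_green r w \<partial>lborel) = ennreal \<kappa>"
  using disc_green_integral_pos[OF r] .

lemma corr_green:
  assumes "\<And>w. norm w < r \<Longrightarrow> f (z + w) \<le> H"
  shows "corr (\<lambda>w. ennreal (H - f w)) (disc_green r) z = ennreal \<kappa> * ennreal (H - P z)" "P z \<le> H"
proof -
  have *: "(\<integral>\<^sup>+w. ennreal (H - f (z + w)) * ennreal (disc_green r w) \<partial>lborel) = ennreal (H * \<kappa> - (\<integral>w. f (z + w) * disc_green r w \<partial>lborel))
       \<and> (\<integral>w. f (z + w) * disc_green r w \<partial>lborel) \<le> H * \<kappa>"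
    using kappa assms
    by (intro nn_integral_continuous_kernel(4)[OF cont]) (auto simp: disc_green_nonneg disc_green_outside)
  have "(\<integral>w. f (z + w) * disc_green r w \<partial>lborel) = P z * \<kappa>"
    using kappa by (simp add: green_mean_def)
  with * kappa show "corr (\<lambda>w. ennreal (H - f w)) (disc_green r) z = ennreal \<kappa> * ennreal (H - P z)" "P z \<le> H"
    by (simp_all add: corr_def ennreal_mult'[symmetric] algebra_simps)
qed

lemma dmean_area:
  assumes "s > 0" "\<And>w. norm w < s \<Longrightarrow> f (z + w) \<le> H"
  shows "dmean s (\<lambda>w. ennreal (H - f w)) z = ennreal (H - area_mean f s z)" "area_mean f s z \<le> H"
proof -
  have ind: "(\<integral>\<^sup>+w. ennreal (indicator (ball (0::complex) s) w) \<partial>lborel) = ennreal (pi * s\<^sup>2)" 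
    using assms(1) by (simp add: ennreal_indicator emeasure_ball_complex)
  have *: "(\<integral>\<^sup>+w. ennreal (H - f (z + w)) * ennreal (indicator (ball 0 s) w) \<partial>lborel)
        = ennreal (H * (pi * s\<^sup>2) - (\<integral>w. f (z + w) * indicator (ball 0 s) w \<partial>lborel))
       \<and> (\<integral>w. f (z + w) * indicator (ball 0 s) w \<partial>lborel) \<le> H * (pi * s\<^sup>2)"
    using assms ind by (intro nn_integral_continuous_kernel(4)[OF cont]) auto
  have A: "(\<integral>w. f (z + w) * indicator (ball 0 s) w \<partial>lborel) = area_mean f s z * (pi * s\<^sup>2)"
    using assms by (simp add: area_mean_def)
  show "area_mean f s z \<le> H" using * assms(1) unfolding A by simp
  have "dmean s (\<lambda>w. ennreal (H - f w)) z = ennreal ((H - area_mean f s z) * (pi * s\<^sup>2)) / ennreal (pi * s\<^sup>2)"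
    unfolding dmean_def using * unfolding A by (simp add: ennreal_indicator left_diff_distrib)
  then show "dmean s (\<lambda>w. ennreal (H - f w)) z = ennreal (H - area_mean f s z)"
    using \<open>area_mean f s z \<le> H\<close> assms(1) by (simp add: divide_ennreal)
qed

lemma laplace_mean_nonneg: "0 \<le> m z"
proof -
  have "compact (f ` cball z r)"
    using cont by (intro compact_continuous_image) (auto intro: continuous_on_subset)
  then obtain H where H: "\<And>w. w \<in> cball z r \<Longrightarrow> \<bar>f w\<bar> \<le> H"
    by (meson bounded_real compact_imp_bounded image_eqI)
  have le: "f w \<le> H" if "w \<in> ball z r" for w using H[of w] that by auto
  have "dmean r (\<lambda>w. ennreal (H - f w)) z = ennreal (H - area_mean f r z)" "area_mean f r z \<le> H"
    using le r by (intro dmean_area; auto simp: dist_norm)+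
  moreover have "dmean r (\<lambda>w. ennreal (H - f w)) z \<le> ennreal (H - f z)"
    using r le by (rule submean)
  ultimately have "f z \<le> area_mean f r z"
    using le[of z] r by (simp add: ennreal_le_iff)
  then show ?thesis using kappa by (simp add: laplace_mean_def)
qed

text \<open>Wherever the disc of radius r stays within radius \<open>T\<close>, p = H - f is its own
  disc mean plus \<open>\<kappa>\<close> times m. Inserted into the correlation of p with
  \<open>disc_green R\<close> and compared with \<open>dmean_corr_disc_green\<close>, this puts the
  correlation of the disc mean on both sides. That term is finite, and cancelling it leaves the
  claim multiplied by \<open>\<kappa>\<close>.\<close>

lemma green_jensen_formula:
  assumes R: "R > 0" and T: "norm z + R + r \<le> T" and H: "\<And>w. norm w < T \<Longrightarrow> f w \<le> H"
  shows "ennreal (H - P z) = dmean R (\<lambda>w. ennreal (H - P w)) z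
     + (\<integral>\<^sup>+w. ennreal (m w) * ennreal (disc_green R (w - z)) \<partial>lborel)"
proof -
  define p where "p = (\<lambda>w. ennreal (H - f w))"
  have [measurable]: "p \<in> borel_measurable borel" unfolding p_def by measurable
  have Hz: "f (v + w) \<le> H" if "norm v + r \<le> T" "norm w < r" for v w
    using that norm_triangle_ineq[of v w] by (intro H) linarith
  have cg: "corr p (disc_green r) v = ennreal \<kappa> * ennreal (H - P v)" if "norm v + r \<le> T" for v
    unfolding p_def using Hz[OF that] by (rule corr_green)
  have p_split: "p v = dmean r p v + ennreal \<kappa> * ennreal (m v)" if v: "norm v + r \<le> T" for v
  proof -
    have "H - f v = (H - area_mean f r v) + \<kappa> * m v"
      using kappa by (simp add: laplace_mean_def)
    moreover have "dmean r p v = ennreal (H - area_mean f r v)" "area_mean f r v \<le> H"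
      unfolding p_def using Hz[OF v] r by (intro dmean_area; simp)+
    moreover have "ennreal ((H - area_mean f r v) + \<kappa> * m v) = ennreal (H - area_mean f r v) + ennreal (\<kappa> * m v)"
      using kappa laplace_mean_nonneg \<open>area_mean f r v \<le> H\<close> by (intro ennreal_plus) auto
    ultimately show ?thesis
      using kappa by (simp only: p_def ennreal_mult' less_imp_le)
  qed
  let ?J = "(\<integral>\<^sup>+w. ennreal (m (z + w)) * ennreal (disc_green R w) \<partial>lborel)"
  have fin: "corr p (disc_green R) z < \<infinity>"
  proof -
    have "(\<integral>\<^sup>+w. ennreal (H - f (z + w)) * ennreal (disc_green R w) \<partial>lborel)
        = ennreal (H * (\<integral>w. disc_green R w \<partial>lborel) - (\<integral>w. f (z + w) * disc_green R w \<partial>lborel))"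
    proof (rule conjunct1[OF nn_integral_continuous_kernel(4)[OF cont]])
      show "f (z + w) \<le> H" if "norm w < R" for w
        using that T r norm_triangle_ineq[of z w] by (intro H) linarith
    qed (use disc_green_integral_pos[OF R] in \<open>auto simp: disc_green_nonneg disc_green_outside\<close>)
    then show ?thesis by (simp add: corr_def p_def)
  qed
  have "corr p (disc_green R) z = (\<integral>\<^sup>+w. dmean r p (z + w) * ennreal (disc_green R w)
      + ennreal \<kappa> * (ennreal (m (z + w)) * ennreal (disc_green R w)) \<partial>lborel)"
    unfolding corr_def
  proof (rule nn_integral_cong)
    fix w
    show "p (z + w) * ennreal (disc_green R w) = dmean r p (z + w) * ennreal (disc_green R w)
      + ennreal \<kappa> * (ennreal (m (z + w)) * ennreal (disc_green R w))"
    proof (cases "norm w < R")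
      case True
      then have "norm (z + w) + r \<le> T" using T norm_triangle_ineq[of z w] by linarith
      from p_split[OF this] show ?thesis by (simp add: distrib_right mult.assoc)
    qed (simp add: disc_green_outside)
  qed
  also have "\<dots> = corr (dmean r p) (disc_green R) z + ennreal \<kappa> * ?J"
    unfolding corr_def by (subst nn_integral_add) (auto simp: nn_integral_cmult)
  finally have c: "corr p (disc_green R) z = corr (dmean r p) (disc_green R) z + ennreal \<kappa> * ?J" .
  have "dmean R (corr p (disc_green r)) z + (corr (dmean r p) (disc_green R) z + ennreal \<kappa> * ?J)
      = corr p (disc_green r) z + corr (dmean r p) (disc_green R) z"
    using dmean_corr_disc_green[of p r R z] r R c by simp
  moreover have "corr (dmean r p) (disc_green R) z \<noteq> top"
    using fin c by auto
  ultimately have "dmean R (corr p (disc_green r)) z + ennreal \<kappa> * ?J = corr p (disc_green r) z"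
    by (rule ennreal_add_middle_cancel)
  moreover have "dmean R (corr p (disc_green r)) z = dmean R (\<lambda>w. ennreal \<kappa> * ennreal (H - P w)) z"
  proof (rule dmean_cong)
    fix w assume "w \<in> ball z R"
    then have "norm w + r \<le> T"
      using T norm_triangle_ineq2[of w z] by (simp add: dist_norm norm_minus_commute)
    then show "corr p (disc_green r) w = ennreal \<kappa> * ennreal (H - P w)" by (rule cg)
  qed
  moreover have "\<dots> = ennreal \<kappa> * dmean R (\<lambda>w. ennreal (H - P w)) z"
    unfolding dmean_def by (simp add: nn_integral_cmult mult.assoc ennreal_times_divide)
  ultimately have "ennreal \<kappa> * (dmean R (\<lambda>w. ennreal (H - P w)) z + ?J) = ennreal \<kappa> * ennreal (H - P z)"
    using cg[of z] T R by (simp add: distrib_left)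
  then have "dmean R (\<lambda>w. ennreal (H - P w)) z + ?J = ennreal (H - P z)"
    using kappa by (simp add: ennreal_mult_cancel_left)
  moreover have "?J = (\<integral>\<^sup>+w. ennreal (m w) * ennreal (disc_green R (w - z)) \<partial>lborel)"
    using nn_integral_lborel_shift[of "\<lambda>w. ennreal (m w) * ennreal (disc_green R (w - z))" z] by simp
  ultimately show ?thesis by simp
qed

lemma growth_ball: "1 \<le> T \<Longrightarrow> norm w < T \<Longrightarrow> f w \<le> ln T + C"
  by (rule order_trans[OF growth add_right_mono[OF ln_mono]]) auto

text \<open>At the origin the potential term is at most ln (R + r) + C - P 0, while the kernel is at
  least ln R - ln T - 1/2 on the disc of radius T. Dividing and letting R tend to infinity leaves
  the coefficient of the logarithm in the growth condition, which is 1.\<close>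

lemma laplace_mass_le_1: "(\<integral>\<^sup>+w\<in>ball 0 T. ennreal (m w) \<partial>lborel) \<le> 1"
proof (cases "T > 0")
  case True
  let ?\<mu> = "(\<integral>\<^sup>+w\<in>ball 0 T. ennreal (m w) \<partial>lborel)"
  have bd: "ennreal (ln R - ln T - 1 / 2) * ?\<mu> \<le> ennreal (ln (R + r) + C - P 0)" if R: "R \<ge> 1" "R > T" for R
  proof -
    have "ennreal (ln R - ln T - 1 / 2) * ?\<mu>
        = (\<integral>\<^sup>+w. ennreal (ln R - ln T - 1 / 2) * (ennreal (m w) * indicator (ball 0 T) w) \<partial>lborel)"
      by (simp add: nn_integral_cmult)
    also have "\<dots> \<le> (\<integral>\<^sup>+w. ennreal (m w) * ennreal (disc_green R (w - 0)) \<partial>lborel)"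
    proof (intro nn_integral_mono_AE eventually_mono[OF AE_lborel_singleton[of 0]])
      fix w :: complex assume "w \<noteq> 0"
      have "ln R - ln T - 1 / 2 \<le> disc_green R w" if "norm w < T"
      proof -
        have "ln (norm w) \<le> ln T" using that \<open>w \<noteq> 0\<close> by (intro ln_mono) auto
        moreover have "(norm w)\<^sup>2 / (2 * R\<^sup>2) \<ge> 0" by simp
        ultimately have "ln R - ln T - 1 / 2 \<le> ln R - 1 / 2 + (norm w)\<^sup>2 / (2 * R\<^sup>2) - ln (norm w)"
          by linarith
        then show ?thesis using that R \<open>w \<noteq> 0\<close> by (simp add: disc_green_def)
      qed
      then show "ennreal (ln R - ln T - 1 / 2) * (ennreal (m w) * indicator (ball 0 T) w)
          \<le> ennreal (m w) * ennreal (disc_green R (w - 0))"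
        by (auto split: split_indicator simp: mult.commute[of "ennreal (m w)"] intro!: mult_right_mono ennreal_leI)
    qed
    also have "\<dots> \<le> ennreal (ln (R + r) + C - P 0)"
      using R r True by (subst green_jensen_formula[of R 0 "R + r"]) (auto intro!: growth_ball)
    finally show ?thesis .
  qed
  \<comment> \<open>One radius with ln R >= ln T + 1 already shows finiteness, so that the limit can
    be taken in the reals.\<close>
  have "?\<mu> < \<infinity>"
  proof -
    define R where "R = max 1 T * exp 1"
    have "max 1 T * 1 < R" unfolding R_def using True by (intro mult_strict_left_mono) auto
    then have R: "R \<ge> 1" "R > T" by auto
    have "ln T \<le> ln (max 1 T)" using True by (intro ln_mono) auto
    moreover have "ln R = ln (max 1 T) + ln (exp 1)" unfolding R_def using \<open>T > 0\<close> by (subst ln_mult) (auto simp: max_def)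
    ultimately have "ln R \<ge> ln T + 1" by simp
    then have "ennreal (1 / 2) * ?\<mu> \<le> ennreal (ln R - ln T - 1 / 2) * ?\<mu>"
      by (intro mult_right_mono ennreal_leI) auto
    also have "\<dots> \<le> ennreal (ln (R + r) + C - P 0)" using bd[OF R] .
    also have "\<dots> < \<infinity>" by simp
    finally show ?thesis by (auto simp: ennreal_mult_eq_top_iff top.not_eq_extremum[symmetric])
  qed
  then obtain \<mu> where \<mu>: "?\<mu> = ennreal \<mu>" "\<mu> \<ge> 0"
    by (metis ennreal_cases infinity_ennreal_def less_irrefl)
  define c t where "c = C - P 0" and "t = ln T"
  have "((\<lambda>R. (ln (R + r) + c) / (ln R - t - 1 / 2)) \<longlongrightarrow> 1) at_top"
    using r by real_asymp
  moreover have "\<forall>\<^sub>F R in at_top. \<mu> \<le> (ln (R + r) + c) / (ln R - t - 1 / 2)"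
  proof -
    have "\<forall>\<^sub>F R in at_top. ln R - t - 1 / 2 > 0" by real_asymp
    moreover have "\<forall>\<^sub>F R in at_top. ln (R + r) + c > 0" by real_asymp
    moreover have "\<forall>\<^sub>F R in at_top. R > max 1 T" by (rule eventually_gt_at_top)
    ultimately show ?thesis
    proof eventually_elim
      case (elim R)
      then have "ennreal ((ln R - t - 1 / 2) * \<mu>) \<le> ennreal (ln (R + r) + c)"
        using bd[of R] \<mu> by (simp add: ennreal_mult c_def t_def add_diff_eq)
      then show ?case using elim by (simp add: field_simps)
    qed
  qed
  ultimately have "\<mu> \<le> 1" by (intro tendsto_lowerbound) auto
  then show ?thesis using \<mu> by (simp add: ennreal_le_1)
next
  case False
  then have *: "ball (0::complex) T = {}" by simp
  show ?thesis unfolding * by simp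
qed

end

text \<open>Origin of the kernel |w|/|z - w|: the logarithms give it exactly, and the disc
  potentials differ by at most |z|/R, an error that disappears as R grows.\<close>

lemma exp_disc_green_diff_le:
  assumes "R > 0" "w \<noteq> 0" "w \<noteq> z"
  shows "exp (disc_green R (w - z) - disc_green R w) \<le> norm w / norm (z - w) * exp (norm z / R)"
proof -
  have "disc_green R (w - z) - disc_green R w
      = (ln (norm w) - ln (norm (z - w))) + (logdisc R (w - z) - logdisc R w)"
    using assms by (simp add: disc_green_logdisc norm_minus_commute)
  also have "\<dots> \<le> (ln (norm w) - ln (norm (z - w))) + norm z / R"
    using logdisc_lipschitz[OF assms(1), of "w - z" w] by simp
  finally have "exp (disc_green R (w - z) - disc_green R w)
      \<le> exp ((ln (norm w) - ln (norm (z - w))) + norm z / R)" by simp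
  also have "\<dots> = norm w / norm (z - w) * exp (norm z / R)"
    using assms by (simp add: exp_add exp_diff)
  finally show ?thesis .
qed

context disc_subharmonic
begin

text \<open>By the Jensen formula at 0 and z, P 0 - P z is a difference of disc means plus the
  integral of \<open>disc_green R (w - z) - disc_green R w\<close> against m. The first part goes
  into \<open>\<epsilon>\<close>, which tends to 0 as R grows. The second is exponentiated by
  Jensen's inequality for a measure of mass at most 1, which brings in the missing mass.\<close>

lemma green_mean_oscillation:
  assumes R: "R \<ge> 1" and z: "norm z \<le> K" and \<alpha>: "\<alpha> > 0"
  defines "\<epsilon> \<equiv> (2 * K / R + (K / R)\<^sup>2) * (ln (R + 2 * K + r) + C - P 0) + K / R"
  shows "ennreal (exp (\<alpha> * (P 0 - P z)))
    \<le> ennreal (exp (\<alpha> * \<epsilon>)) *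
      ((\<integral>\<^sup>+w. ennreal (m w) * indicator (ball 0 (R + K)) w * ennreal ((norm w / norm (z - w)) powr \<alpha>) \<partial>lborel)
       + (1 - (\<integral>\<^sup>+w\<in>ball 0 (R + K). ennreal (m w) \<partial>lborel)))"
proof -
  have "K \<ge> 0" using z norm_ge_zero[of z] by linarith
  define T H where "T = R + 2 * K + r" and "H = ln T + C"
  have "T \<ge> 1" using R \<open>K \<ge> 0\<close> r by (simp add: T_def)
  have fH: "f w \<le> H" if "norm w < T" for w
    unfolding H_def using \<open>T \<ge> 1\<close> that by (rule growth_ball)
  define J where "J = (\<lambda>s v. \<integral>\<^sup>+w. ennreal (m w) * ennreal (disc_green s (w - v)) \<partial>lborel)"
  define D where "D = (\<lambda>s v. dmean s (\<lambda>w. ennreal (H - P w)) v)"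
  have split: "ennreal (H - P v) = D s v + J s v" if "s > 0" "norm v + s + r \<le> T" for s v
    unfolding D_def J_def using that fH by (rule green_jensen_formula)
  have P_le: "P v \<le> H" if "norm v + r \<le> T" for v
    using that fH norm_triangle_ineq[of v] by (intro corr_green(2)) (smt (verit))
  have s0: "ennreal (H - P 0) = D R 0 + J R 0" using R \<open>K \<ge> 0\<close> by (intro split) (auto simp: T_def)
  have sK: "ennreal (H - P 0) = D (R + K) 0 + J (R + K) 0" using R \<open>K \<ge> 0\<close> by (intro split) (auto simp: T_def)
  have sz: "ennreal (H - P z) = D R z + J R z" using R z \<open>K \<ge> 0\<close> by (intro split) (auto simp: T_def)
  have le0: "P 0 \<le> H" "P z \<le> H" using R z \<open>K \<ge> 0\<close> by (auto intro!: P_le simp: T_def)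
  obtain d0 where d0: "D R 0 = ennreal d0" "d0 \<ge> 0" using s0 by (metis ennreal_add_eq_top ennreal_cases ennreal_neq_top)
  obtain j0 where j0: "J R 0 = ennreal j0" "j0 \<ge> 0" using s0 by (metis ennreal_add_eq_top ennreal_cases ennreal_neq_top)
  obtain dK where dK: "D (R + K) 0 = ennreal dK" "dK \<ge> 0" using sK by (metis ennreal_add_eq_top ennreal_cases ennreal_neq_top)
  obtain jK where jK: "J (R + K) 0 = ennreal jK" "jK \<ge> 0" using sK by (metis ennreal_add_eq_top ennreal_cases ennreal_neq_top)
  obtain dz where dz: "D R z = ennreal dz" "dz \<ge> 0" using sz by (metis ennreal_add_eq_top ennreal_cases ennreal_neq_top)
  obtain jz where jz: "J R z = ennreal jz" "jz \<ge> 0" using sz by (metis ennreal_add_eq_top ennreal_cases ennreal_neq_top)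
  have e0: "H - P 0 = d0 + j0" using s0 le0 d0 j0 by (simp flip: ennreal_plus)
  have eK: "H - P 0 = dK + jK" using sK le0 dK jK by (simp flip: ennreal_plus)
  have ez: "H - P z = dz + jz" using sz le0 dz jz by (simp flip: ennreal_plus)
  \<comment> \<open>A larger disc has a larger Green part, hence a smaller mean of H - P about
    0.\<close>
  have "J R 0 \<le> J (R + K) 0"
    unfolding J_def using \<open>K \<ge> 0\<close>
    by (intro nn_integral_mono mult_left_mono ennreal_leI disc_green_mono) auto
  then have "j0 \<le> jK" using j0 jK by simp
  then have dKd0: "dK \<le> d0" using e0 eK by simp
  have "ennreal (R\<^sup>2 * dz) \<le> ennreal ((R + K)\<^sup>2 * dK)"
  proof -
    let ?q = "\<lambda>w. ennreal (H - P w)"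
    have int: "(\<integral>\<^sup>+w\<in>ball v s. ?q w \<partial>lborel) = ennreal (pi * s\<^sup>2) * D s v" if "s > 0" for s v
    proof -
      have "(\<integral>\<^sup>+y\<in>ball 0 s. ?q (v + y) \<partial>lborel) = (\<integral>\<^sup>+y\<in>ball v s. ?q y \<partial>lborel)"
        using nn_integral_lborel_shift[of "\<lambda>y. ?q y * indicator (ball v s) y" v]
        by (simp add: indicator_def dist_norm)
      moreover have "ennreal (pi * s\<^sup>2) * (X / ennreal (pi * s\<^sup>2)) = X" for X
        using that by (subst ennreal_times_divide, subst mult.commute, intro ennreal_mult_divide_eq) auto
      ultimately show ?thesis
        unfolding D_def dmean_def by simp
    qed
    \<comment> \<open>The integrand \<open>?q\<close> is nonnegative, so its integral over the disc
      about z is at most that over the larger disc about 0. The ratio (R + K)^2/R^2 of the areas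
      tends to 1.\<close>
    have "ball z R \<subseteq> ball 0 (R + K)"
    proof
      fix w assume "w \<in> ball z R"
      then show "w \<in> ball 0 (R + K)"
        using z norm_triangle_ineq2[of w z] by (simp add: dist_norm norm_minus_commute)
    qed
    then have "(\<integral>\<^sup>+w\<in>ball z R. ?q w \<partial>lborel) \<le> (\<integral>\<^sup>+w\<in>ball 0 (R + K). ?q w \<partial>lborel)"
      by (intro nn_set_integral_set_mono)
    then have "ennreal (pi * R\<^sup>2) * ennreal dz \<le> ennreal (pi * (R + K)\<^sup>2) * ennreal dK"
      using R \<open>K \<ge> 0\<close> by (simp add: int dz dK)
    then have "pi * R\<^sup>2 * dz \<le> pi * (R + K)\<^sup>2 * dK"
      using dz dK by (simp add: ennreal_mult[symmetric])
    then have "pi * (R\<^sup>2 * dz) \<le> pi * ((R + K)\<^sup>2 * dK)" by (simp add: mult.assoc)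
    then have "R\<^sup>2 * dz \<le> (R + K)\<^sup>2 * dK" by (simp only: mult_le_cancel_left_pos[OF pi_gt_zero])
    then show ?thesis by (rule ennreal_leI)
  qed
  then have "R\<^sup>2 * dz \<le> (R + K)\<^sup>2 * dK" using dK by simp
  then have "dz \<le> (R + K)\<^sup>2 / R\<^sup>2 * dK" using R by (simp add: field_simps)
  also have "(R + K)\<^sup>2 / R\<^sup>2 = 1 + (2 * K / R + (K / R)\<^sup>2)"
    using R by (simp add: field_simps power2_eq_square)
  also have "(1 + (2 * K / R + (K / R)\<^sup>2)) * dK = dK + (2 * K / R + (K / R)\<^sup>2) * dK"
    by (simp add: distrib_right)
  also have "\<dots> \<le> d0 + (2 * K / R + (K / R)\<^sup>2) * (H - P 0)"
    using dKd0 eK jK R \<open>K \<ge> 0\<close> by (intro add_mono mult_left_mono) auto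
  finally have dz0: "dz - d0 \<le> \<epsilon> - K / R" by (simp add: \<epsilon>_def H_def T_def)
  have up: "P 0 - P z \<le> (\<epsilon> - K / R) + (jz - j0)" using e0 ez dz0 by simp

  have density_measurable: "(\<lambda>w. ennreal (m w) * indicator (ball 0 (R + K)) w) \<in> borel_measurable lborel"
    by measurable
  \<comment> \<open>For |v| <= K the kernel \<open>disc_green R (w - v)\<close> vanishes outside
    this disc, so the restriction keeps its integrals, and the mass is at most 1 by
    \<open>laplace_mass_le_1\<close>.\<close>
  define N where "N = density lborel (\<lambda>w. ennreal (m w) * indicator (ball 0 (R + K)) w)"
  have [measurable_cong]: "sets N = sets borel" by (simp add: N_def)
  have N_int: "(\<integral>\<^sup>+w. g w \<partial>N) = (\<integral>\<^sup>+w. ennreal (m w) * indicator (ball 0 (R + K)) w * g w \<partial>lborel)"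
    if [measurable]: "g \<in> borel_measurable borel" for g
    unfolding N_def by (rule nn_integral_density) measurable
  have green_N: "(\<integral>\<^sup>+w. disc_green R (w - v) \<partial>N) = J R v" if "norm v \<le> K" for v
    unfolding J_def
  proof (subst N_int)
    have "disc_green R (w - v) = 0" if "w \<notin> ball 0 (R + K)" for w
      using that \<open>norm v \<le> K\<close> norm_triangle_ineq2[of w v] by (intro disc_green_outside) auto
    then show "(\<integral>\<^sup>+w. ennreal (m w) * indicator (ball 0 (R + K)) w * ennreal (disc_green R (w - v)) \<partial>lborel)
      = (\<integral>\<^sup>+w. ennreal (m w) * ennreal (disc_green R (w - v)) \<partial>lborel)"
      by (intro nn_integral_cong) (auto split: split_indicator)
  qed measurable
  have intz: "integrable N (\<lambda>w. disc_green R (w - z))" "(\<integral>w. disc_green R (w - z) \<partial>N) = jz"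
  proof -
    show "integrable N (\<lambda>w. disc_green R (w - z))"
      using green_N[OF z] jz by (intro integrableI_nonneg) (auto simp: disc_green_nonneg)
    show "(\<integral>w. disc_green R (w - z) \<partial>N) = jz"
      using green_N[OF z] jz by (subst integral_eq_nn_integral) (auto simp: disc_green_nonneg)
  qed
  have int0: "integrable N (\<lambda>w. disc_green R (w - 0))" "(\<integral>w. disc_green R (w - 0) \<partial>N) = j0"
  proof -
    show "integrable N (\<lambda>w. disc_green R (w - 0))"
      using green_N[of 0] j0 \<open>K \<ge> 0\<close> by (intro integrableI_nonneg) (auto simp: disc_green_nonneg)
    show "(\<integral>w. disc_green R (w - 0) \<partial>N) = j0"
      using green_N[of 0] j0 \<open>K \<ge> 0\<close> by (subst integral_eq_nn_integral) (auto simp: disc_green_nonneg)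
  qed
  let ?X = "\<lambda>w. \<alpha> * (disc_green R (w - z) - disc_green R (w - 0))"
  have mass: "emeasure N (space N) = (\<integral>\<^sup>+w\<in>ball 0 (R + K). ennreal (m w) \<partial>lborel)"
    by (simp add: N_def emeasure_density)
  have "ennreal (exp (\<integral>w. ?X w \<partial>N)) \<le> (\<integral>\<^sup>+w. ennreal (exp (?X w)) \<partial>N) + (1 - emeasure N (space N))"
    using intz int0 laplace_mass_le_1[of "R + K"] by (intro exp_integral_le_subprobability) (auto simp: mass)
  also have "(\<integral>w. ?X w \<partial>N) = \<alpha> * (jz - j0)"
    using intz int0 by simp
  also have "(\<integral>\<^sup>+w. ennreal (exp (?X w)) \<partial>N)
      \<le> (\<integral>\<^sup>+w. ennreal (exp (\<alpha> * (K / R))) * ennreal ((norm w / norm (z - w)) powr \<alpha>) \<partial>N)"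
  proof (rule nn_integral_mono_AE)
    have "AE w in lborel. w \<noteq> 0 \<and> w \<noteq> z"
      using AE_lborel_singleton[of 0] AE_lborel_singleton[of z] by eventually_elim auto
    then have "AE w in N. w \<noteq> 0 \<and> w \<noteq> z"
      unfolding N_def AE_density[OF density_measurable] by (rule eventually_mono) simp
    then show "AE w in N. ennreal (exp (?X w)) \<le> ennreal (exp (\<alpha> * (K / R))) * ennreal ((norm w / norm (z - w)) powr \<alpha>)"
    proof eventually_elim
      case (elim w)
      have "exp (disc_green R (w - z) - disc_green R w) \<le> norm w / norm (z - w) * exp (norm z / R)"
        using elim R by (intro exp_disc_green_diff_le) auto
      also have "\<dots> \<le> norm w / norm (z - w) * exp (K / R)"
        using z R by (intro mult_left_mono) (auto simp: divide_right_mono)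
      finally have "exp (disc_green R (w - z) - disc_green R w) powr \<alpha> \<le> (norm w / norm (z - w) * exp (K / R)) powr \<alpha>"
        using \<alpha> by (intro powr_mono2) auto
      then have "exp (?X w) \<le> exp (\<alpha> * (K / R)) * (norm w / norm (z - w)) powr \<alpha>"
        by (subst (asm) powr_mult) (simp_all add: exp_powr_real mult_ac)
      then show ?case by (simp add: ennreal_leI flip: ennreal_mult)
    qed
  qed
  also have "\<dots> = ennreal (exp (\<alpha> * (K / R))) * (\<integral>\<^sup>+w. ennreal ((norm w / norm (z - w)) powr \<alpha>) \<partial>N)"
    by (rule nn_integral_cmult) measurable
  finally have J: "ennreal (exp (\<alpha> * (jz - j0))) \<le> ennreal (exp (\<alpha> * (K / R))) * (\<integral>\<^sup>+w. ennreal ((norm w / norm (z - w)) powr \<alpha>) \<partial>N)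
     + (1 - emeasure N (space N))"
    by (simp add: add_right_mono)
  have "ennreal (exp (\<alpha> * (P 0 - P z))) \<le> ennreal (exp (\<alpha> * (\<epsilon> - K / R)) * exp (\<alpha> * (jz - j0)))"
    using up \<alpha> by (intro ennreal_leI) (simp add: mult_exp_exp flip: distrib_left)
  also have "\<dots> \<le> ennreal (exp (\<alpha> * (\<epsilon> - K / R))) * (ennreal (exp (\<alpha> * (K / R))) * (\<integral>\<^sup>+w. ennreal ((norm w / norm (z - w)) powr \<alpha>) \<partial>N)
     + (1 - emeasure N (space N)))"
    using J by (simp add: ennreal_mult mult_left_mono)
  also have "\<dots> \<le> ennreal (exp (\<alpha> * (\<epsilon> - K / R))) * (ennreal (exp (\<alpha> * (K / R))) * (\<integral>\<^sup>+w. ennreal ((norm w / norm (z - w)) powr \<alpha>) \<partial>N)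
     + ennreal (exp (\<alpha> * (K / R))) * (1 - emeasure N (space N)))"
  proof -
    \<comment> \<open>The factor exp (\<alpha> K/R) >= 1 is put on the missing mass too, so that it
      can be taken out of the sum.\<close>
    have "1 * x \<le> ennreal (exp (\<alpha> * (K / R))) * x" for x
      using \<alpha> R \<open>K \<ge> 0\<close> by (intro mult_right_mono) (auto simp: ennreal_1[symmetric] simp del: ennreal_1 intro!: ennreal_leI)
    then show ?thesis by (intro mult_left_mono add_left_mono) auto
  qed
  also have "\<dots> = ennreal (exp (\<alpha> * (\<epsilon> - K / R)) * exp (\<alpha> * (K / R))) * ((\<integral>\<^sup>+w. ennreal ((norm w / norm (z - w)) powr \<alpha>) \<partial>N)
     + (1 - emeasure N (space N)))"
    by (simp add: ennreal_mult distrib_left mult.assoc)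
  also have "exp (\<alpha> * (\<epsilon> - K / R)) * exp (\<alpha> * (K / R)) = exp (\<alpha> * \<epsilon>)"
    by (simp add: mult_exp_exp right_diff_distrib)
  finally show ?thesis
    by (simp add: mass N_int)
qed

text \<open>After exchanging the integrals each pole w contributes at most \<open>S\<close>. The
  mass missing from 1 contributes the total mass of \<open>\<nu>\<close>, as if it sat at infinity,
  where the kernel |w|/|z - w| tends to 1; hence the second bound S'. The weights add up to 1, and R
  tends to infinity.\<close>

lemma green_mean_exp_integral:
  assumes \<nu>: "finite_measure \<nu>" "sets \<nu> = sets borel" "AE z in \<nu>. norm z \<le> K" and \<alpha>: "\<alpha> > 0"
    and S: "\<And>w. (\<integral>\<^sup>+z. ennreal ((norm w / norm (z - w)) powr \<alpha>) \<partial>\<nu>) \<le> S" and S': "emeasure \<nu> UNIV \<le> S"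
  shows "(\<integral>\<^sup>+z. ennreal (exp (\<alpha> * (P 0 - P z))) \<partial>\<nu>) \<le> S"
proof (cases S)
  case (real s)
  note [measurable_cong] = \<nu>(2)
  interpret finite_measure \<nu> by (rule \<nu>(1))
  interpret pair_sigma_finite \<nu> lborel ..
  define K' where "K' = max K 1"
  have "K' > 0" by (simp add: K'_def)
  define \<epsilon> where "\<epsilon> = (\<lambda>R. (2 * K' / R + (K' / R)\<^sup>2) * (ln (R + 2 * K' + r) + C - P 0) + K' / R)"
  have bd: "(\<integral>\<^sup>+z. ennreal (exp (\<alpha> * (P 0 - P z))) \<partial>\<nu>) \<le> ennreal (exp (\<alpha> * \<epsilon> R)) * S" if R: "R \<ge> 1" for R
  proof -
    let ?k = "\<lambda>w. ennreal (m w) * indicator (ball 0 (R + K')) w"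
    let ?\<mu> = "\<integral>\<^sup>+w. ?k w \<partial>lborel"
    have "(\<integral>\<^sup>+z. ennreal (exp (\<alpha> * (P 0 - P z))) \<partial>\<nu>)
        \<le> (\<integral>\<^sup>+z. ennreal (exp (\<alpha> * \<epsilon> R)) * ((\<integral>\<^sup>+w. ?k w * ennreal ((norm w / norm (z - w)) powr \<alpha>) \<partial>lborel) + (1 - ?\<mu>)) \<partial>\<nu>)"
    proof (rule nn_integral_mono_AE)
      show "AE z in \<nu>. ennreal (exp (\<alpha> * (P 0 - P z)))
          \<le> ennreal (exp (\<alpha> * \<epsilon> R)) * ((\<integral>\<^sup>+w. ?k w * ennreal ((norm w / norm (z - w)) powr \<alpha>) \<partial>lborel) + (1 - ?\<mu>))"
        using \<nu>(3)
      proof eventually_elim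
        case (elim z)
        show ?case unfolding \<epsilon>_def using R _ \<alpha>
          by (rule green_mean_oscillation) (use elim in \<open>auto simp: K'_def\<close>)
      qed
    qed
    also have "\<dots> = ennreal (exp (\<alpha> * \<epsilon> R)) *
        ((\<integral>\<^sup>+z. \<integral>\<^sup>+w. ?k w * ennreal ((norm w / norm (z - w)) powr \<alpha>) \<partial>lborel \<partial>\<nu>) + (1 - ?\<mu>) * emeasure \<nu> UNIV)"
    proof -
      have "space \<nu> = UNIV" using sets_eq_imp_space_eq[OF \<nu>(2)] by simp
      then show ?thesis by (simp add: nn_integral_cmult nn_integral_add)
    qed
    also have "(\<integral>\<^sup>+z. \<integral>\<^sup>+w. ?k w * ennreal ((norm w / norm (z - w)) powr \<alpha>) \<partial>lborel \<partial>\<nu>)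
        = (\<integral>\<^sup>+w. \<integral>\<^sup>+z. ?k w * ennreal ((norm w / norm (z - w)) powr \<alpha>) \<partial>\<nu> \<partial>lborel)"
      by (rule Fubini'[symmetric]) measurable
    also have "\<dots> = (\<integral>\<^sup>+w. ?k w * (\<integral>\<^sup>+z. ennreal ((norm w / norm (z - w)) powr \<alpha>) \<partial>\<nu>) \<partial>lborel)"
      by (intro nn_integral_cong nn_integral_cmult) measurable
    also have "\<dots> \<le> (\<integral>\<^sup>+w. ?k w * S \<partial>lborel)"
      by (intro nn_integral_mono mult_left_mono S) auto
    also have "\<dots> = ?\<mu> * S" by (rule nn_integral_multc) measurable
    finally have "(\<integral>\<^sup>+z. ennreal (exp (\<alpha> * (P 0 - P z))) \<partial>\<nu>)
        \<le> ennreal (exp (\<alpha> * \<epsilon> R)) * (?\<mu> * S + (1 - ?\<mu>) * emeasure \<nu> UNIV)"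
      by (simp add: mult_left_mono add_right_mono)
    also have "\<dots> \<le> ennreal (exp (\<alpha> * \<epsilon> R)) * (?\<mu> * S + (1 - ?\<mu>) * S)"
      using S' by (intro mult_left_mono add_left_mono) auto
    also have "?\<mu> * S + (1 - ?\<mu>) * S = S"
      using laplace_mass_le_1[of "R + K'"]
      by (simp add: distrib_right[symmetric] add_diff_inverse_ennreal)
    finally show ?thesis .
  qed
  have "(\<epsilon> \<longlongrightarrow> 0) at_top"
  proof -
    define c where "c = C - P 0"
    have "((\<lambda>R. (2 * K' / R + (K' / R)\<^sup>2) * (ln (R + 2 * K' + r) + c) + K' / R) \<longlongrightarrow> 0) at_top"
      using \<open>K' > 0\<close> by real_asymp
    then show ?thesis by (simp add: \<epsilon>_def c_def add_diff_eq)
  qed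
  then have "((\<lambda>R. exp (\<alpha> * \<epsilon> R) * s) \<longlongrightarrow> exp (\<alpha> * 0) * s) at_top"
    by (intro tendsto_intros)
  then have "((\<lambda>R. ennreal (exp (\<alpha> * \<epsilon> R) * s)) \<longlongrightarrow> ennreal (exp (\<alpha> * 0) * s)) at_top"
    by (intro tendsto_ennrealI)
  moreover have "\<forall>\<^sub>F R in at_top. (\<integral>\<^sup>+z. ennreal (exp (\<alpha> * (P 0 - P z))) \<partial>\<nu>) \<le> ennreal (exp (\<alpha> * \<epsilon> R) * s)"
    using eventually_ge_at_top[of 1]
    by eventually_elim (use bd real in \<open>simp add: ennreal_mult\<close>)
  ultimately have "(\<integral>\<^sup>+z. ennreal (exp (\<alpha> * (P 0 - P z))) \<partial>\<nu>) \<le> ennreal (exp (\<alpha> * 0) * s)"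
    by (intro tendsto_lowerbound) auto
  then show ?thesis using real by simp
qed simp

end

text \<open>The radius of regularisation tends to 0. Fatou's lemma suffices, since only an upper
  bound has to survive the limit.\<close>

lemma continuous_exp_integral:
  fixes f :: "complex \<Rightarrow> real"
  assumes f: "\<And>r. r > 0 \<Longrightarrow> disc_subharmonic f C r"
    and \<nu>: "finite_measure \<nu>" "sets \<nu> = sets borel" "AE z in \<nu>. norm z \<le> K" and \<alpha>: "\<alpha> > 0"
    and S: "\<And>w. (\<integral>\<^sup>+z. ennreal ((norm w / norm (z - w)) powr \<alpha>) \<partial>\<nu>) \<le> S" and S': "emeasure \<nu> UNIV \<le> S"
  shows "(\<integral>\<^sup>+z. ennreal (exp (\<alpha> * (f 0 - f z))) \<partial>\<nu>) \<le> S"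
proof -
  note [measurable_cong] = \<nu>(2)
  define r where "r = (\<lambda>n. 1 / real (Suc n))"
  have r: "r n > 0" for n by (simp add: r_def)
  have sub: "disc_subharmonic f C (r n)" for n using f r .
  interpret disc_subharmonic f C 1 by (rule f) simp
  have [measurable]: "green_mean f (r n) \<in> borel_measurable borel" for n
    by (rule disc_subharmonic.green_mean_measurable[OF sub])
  have r0: "filterlim r (at_right 0) sequentially"
    unfolding r_def filterlim_at using LIMSEQ_inverse_real_of_nat by (auto simp: inverse_eq_divide)
  have lim: "(\<lambda>n. green_mean f (r n) z) \<longlonglongrightarrow> f z" for z
    using green_mean_tendsto[OF cont] r0 by (rule filterlim_compose)
  have "(\<lambda>n. ennreal (exp (\<alpha> * (green_mean f (r n) 0 - green_mean f (r n) z)))) \<longlonglongrightarrow> ennreal (exp (\<alpha> * (f 0 - f z)))" for z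
    by (intro tendsto_intros lim tendsto_ennrealI)
  then have "(\<integral>\<^sup>+z. ennreal (exp (\<alpha> * (f 0 - f z))) \<partial>\<nu>)
      = (\<integral>\<^sup>+z. liminf (\<lambda>n. ennreal (exp (\<alpha> * (green_mean f (r n) 0 - green_mean f (r n) z)))) \<partial>\<nu>)"
    by (intro nn_integral_cong) (metis lim_imp_Liminf sequentially_bot)
  also have "\<dots> \<le> liminf (\<lambda>n. \<integral>\<^sup>+z. ennreal (exp (\<alpha> * (green_mean f (r n) 0 - green_mean f (r n) z))) \<partial>\<nu>)"
    by (rule nn_integral_liminf) measurable
  also have "\<dots> \<le> S"
    by (rule Liminf_le) (use disc_subharmonic.green_mean_exp_integral[OF sub \<nu> \<alpha> S S'] in auto)
  finally show ?thesis .
qed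

section \<open>Exponential integrals on complex lines\<close>

text \<open>The pointwise identity (H - g) + g^+ = H + g^- integrates to Q + A = 2\<pi> H + B, with
  no subtraction. A is finite because g <= H, and the mean inequality then bounds Q. For a =
  -\<infinity> the right-hand side is \<infinity>.\<close>

lemma ereal_mean_circle_le:
  fixes g :: "real \<Rightarrow> ereal"
  assumes [measurable]: "g \<in> borel_measurable borel" and H: "0 \<le> H" "\<And>t. g t \<le> ereal H"
    and a: "a \<noteq> \<infinity>" "a \<le> ereal_mean lborel {0..2 * pi} g"
  shows "(\<integral>\<^sup>+t\<in>{0..2 * pi}. e2ennreal (ereal H - g t) \<partial>lborel) \<le> ennreal (2 * pi) * e2ennreal (ereal H - a)"
proof (cases "a = - \<infinity>")
  case True
  then show ?thesis by (simp add: ennreal_mult_top)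
next
  case False
  then obtain x where x: "a = ereal x" using a(1) by (cases a) auto
  define A B Q where "A = (\<integral>\<^sup>+t\<in>{0..2 * pi}. e2ennreal (g t) \<partial>lborel)"
    and "B = (\<integral>\<^sup>+t\<in>{0..2 * pi}. e2ennreal (- g t) \<partial>lborel)"
    and "Q = (\<integral>\<^sup>+t\<in>{0..2 * pi}. e2ennreal (ereal H - g t) \<partial>lborel)"
  have const: "(\<integral>\<^sup>+t\<in>{0..2 * pi}. ennreal H \<partial>lborel) = ennreal (2 * pi * H)"
    using H by (simp add: nn_integral_cmult_indicator ennreal_mult' mult.commute)
  have "A \<le> (\<integral>\<^sup>+t\<in>{0..2 * pi}. ennreal H \<partial>lborel)"
    unfolding A_def using e2ennreal_mono[OF H(2)] by (intro nn_integral_mono mult_right_mono) auto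
  then have "A < \<infinity>" by (simp add: const order_le_less_trans)
  then obtain p where p: "A = ennreal p" "p \<ge> 0" by (metis ennreal_cases infinity_ennreal_def less_irrefl)
  have "Q + A = (\<integral>\<^sup>+t\<in>{0..2 * pi}. (e2ennreal (ereal H - g t) + e2ennreal (g t)) \<partial>lborel)"
    unfolding Q_def A_def by (simp add: distrib_right nn_integral_add)
  also have "\<dots> = (\<integral>\<^sup>+t\<in>{0..2 * pi}. (ennreal H + e2ennreal (- g t)) \<partial>lborel)"
  proof (intro nn_integral_cong arg_cong2[where f="(*)"] refl)
    fix t
    show "e2ennreal (ereal H - g t) + e2ennreal (g t) = ennreal H + e2ennreal (- g t)"
    proof (cases "g t")
      case (real y)
      then have "y \<le> H" using H(2)[of t] by simp
      then show ?thesis using real H(1)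
        by (cases "y \<ge> 0") (auto simp: ennreal_neg simp flip: ennreal_plus)
    next
      case PInf
      then show ?thesis using H(2)[of t] by simp
    qed (simp add: e2ennreal_neg)
  qed
  also have "\<dots> = ennreal (2 * pi * H) + B"
    unfolding B_def const[symmetric] by (simp add: distrib_right nn_integral_add)
  finally have QA: "Q + A = ennreal (2 * pi * H) + B" .
  have pi2: "measure lborel {0..2 * pi} = 2 * pi" by simp
  have mean: "ereal x \<le> (enn2ereal A - enn2ereal B) / ereal (2 * pi)"
    using a(2) unfolding x ereal_mean_def ereal_set_integral_def pi2 A_def B_def .
  show ?thesis
  proof (cases B)
    case (real b)
    have "ereal x \<le> ereal ((p - b) / (2 * pi))"
      using mean p real by (simp add: enn2ereal_ennreal)
    then have "x * (2 * pi) \<le> p - b" by (simp add: field_simps)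
    moreover obtain q where q: "Q = ennreal q" "q \<ge> 0"
      using QA real by (metis ennreal_add_eq_top ennreal_cases ennreal_neq_top)
    moreover have "q + p = 2 * pi * H + b"
      using QA p q real H by (simp flip: ennreal_plus)
    ultimately have "q \<le> 2 * pi * (H - x)" by (simp add: algebra_simps)
    then have "ennreal q \<le> ennreal (2 * pi) * ennreal (H - x)"
      by (simp add: ennreal_mult'[symmetric] ennreal_leI)
    then show ?thesis using q by (simp add: Q_def x)
  next
    case top
    then show ?thesis using mean p by (simp add: enn2ereal_ennreal)
  qed
qed

lemma upper_semicontinuous_measurable:
  assumes "upper_semicontinuous u" shows "u \<in> borel_measurable borel"
  using assms by (intro borel_measurableI_less) (auto simp: upper_semicontinuous_def intro!: borel_open)

text \<open>What remains of the Lelong class on a complex line, up to the additive constant in the growth condition.\<close>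

definition line_lelong :: "(complex \<Rightarrow> ereal) \<Rightarrow> bool" where
  "line_lelong u \<longleftrightarrow> (\<forall>z. u z < \<infinity>) \<and> upper_semicontinuous u \<and>
     (\<forall>a b. u a \<le> ereal_mean lborel {0..2 * pi} (\<lambda>t. u (a + cis t * b))) \<and>
     (\<exists>C. \<forall>z. u z \<le> ereal (ln (max 1 (norm z)) + C))"

lemma norm_vector_scalar_mult: "norm (c *s (v::complex^'n)) = norm c * norm v"
  by (simp add: norm_vec_def L2_set_def norm_mult power_mult_distrib sum_distrib_left[symmetric] real_sqrt_mult)

lemma continuous_on_vector_scalar_mult [continuous_intros]:
  "continuous_on S (\<lambda>c. c *s (v::complex^'n))"
  unfolding vector_scalar_mult_def by (intro continuous_intros)

text \<open>Only the growth constant changes, through max 1 |x + c v| <= (1 + |x| + |v|) max 1 |c|.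
  A line may lie inside the set where u is -\<infinity>, which is why \<open>line_lelong\<close>
  admits the constant -\<infinity>.\<close>

lemma lelong_class_line:
  assumes "u \<in> lelong_class"
  shows "line_lelong (\<lambda>c. u (x + c *s v))"
  unfolding line_lelong_def
proof (intro conjI allI)
  have psh: "plurisubharmonic u" and S: "(SUP z. u z - ereal (ln (max 1 (norm z)))) < \<infinity>"
    using assms by (auto simp: lelong_class_def)
  show "u (x + c *s v) < \<infinity>" for c using psh by (simp add: plurisubharmonic_def)
  show "upper_semicontinuous (\<lambda>c. u (x + c *s v))"
    unfolding upper_semicontinuous_def
  proof
    fix c
    have "open ((\<lambda>c. x + c *s v) -` {z. u z < c})"
      using psh by (intro open_vimage continuous_intros) (auto simp: plurisubharmonic_def upper_semicontinuous_def)
    then show "open {z. u (x + z *s v) < c}" by (simp add: vimage_def)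
  qed
  show "u (x + a *s v) \<le> ereal_mean lborel {0..2 * pi} (\<lambda>t. u (x + (a + cis t * b) *s v))" for a b
  proof -
    have "u (x + a *s v) \<le> ereal_mean lborel {0..2 * pi} (\<lambda>t. u (x + a *s v + cis t *s (b *s v)))"
      using psh unfolding plurisubharmonic_def by blast
    then show ?thesis by (simp add: vec.scale_left_distrib vector_smult_assoc add.assoc)
  qed
  obtain C where C: "\<And>z. u z \<le> ereal (ln (max 1 (norm z)) + C)"
  proof -
    obtain C where "(SUP z. u z - ereal (ln (max 1 (norm z)))) \<le> ereal C"
      using S by (metis ereal_less_eq(2) less_PInf_Ex_of_nat linorder_not_less order.strict_implies_order order_refl)
    then have le: "u z - ereal (ln (max 1 (norm z))) \<le> ereal C" for z
      by (meson SUP_le_iff UNIV_I)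
    then have "u z \<le> ereal (ln (max 1 (norm z)) + C)" for z
      using le[of z] by (cases "u z") auto
    then show ?thesis by (rule that)
  qed
  show "\<exists>C. \<forall>c. u (x + c *s v) \<le> ereal (ln (max 1 (norm c)) + C)"
  proof (intro exI allI)
    fix c
    let ?M = "1 + norm x + norm v"
    have pos: "?M > 0" using norm_ge_zero[of x] norm_ge_zero[of v] by linarith
    have "norm (x + c *s v) \<le> norm x + norm c * norm v"
      using norm_triangle_ineq[of x "c *s v"] by (simp add: norm_vector_scalar_mult)
    also have "\<dots> \<le> norm x * max 1 (norm c) + max 1 (norm c) * norm v"
      by (intro add_mono mult_right_mono) (auto simp: mult_le_cancel_left1)
    finally have "norm (x + c *s v) \<le> norm x * max 1 (norm c) + max 1 (norm c) * norm v" .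
    moreover have "0 \<le> norm x * max 1 (norm c) + max 1 (norm c) * norm v" by simp
    moreover have "?M * max 1 (norm c) = max 1 (norm c) + (norm x * max 1 (norm c) + max 1 (norm c) * norm v)"
      by (simp only: distrib_left distrib_right mult_1_left mult_1_right ac_simps)
    moreover have "1 \<le> max 1 (norm c)" by simp
    ultimately have "max 1 (norm (x + c *s v)) \<le> ?M * max 1 (norm c)"
      by (simp only: max.bounded_iff) linarith
    then have "ln (max 1 (norm (x + c *s v))) \<le> ln (?M * max 1 (norm c))" by (intro ln_mono) auto
    also have "\<dots> = ln ?M + ln (max 1 (norm c))" using pos by (subst ln_mult) (auto simp: max_def)
    finally have "ln (max 1 (norm (x + c *s v))) + C \<le> ln (max 1 (norm c)) + (ln ?M + C)" by simp
    then show "u (x + c *s v) \<le> ereal (ln (max 1 (norm c)) + (ln ?M + C))"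
      using C[of "x + c *s v"] by (meson ereal_less_eq(3) order_trans)
  qed
qed

section \<open>Local integrability and disc means on a complex line\<close>

locale line_lelong_class =
  fixes u :: "complex \<Rightarrow> ereal" and C :: real
  assumes lt_top: "\<And>z. u z < \<infinity>" and usc: "upper_semicontinuous u"
    and circle: "\<And>a b. u a \<le> ereal_mean lborel {0..2 * pi} (\<lambda>t. u (a + cis t * b))"
    and growth: "\<And>z. u z \<le> ereal (ln (max 1 (norm z)) + C)"
    and finite_0: "u 0 \<noteq> - \<infinity>"
begin

lemma u_measurable [measurable]: "u \<in> borel_measurable borel"
  using usc by (rule upper_semicontinuous_measurable)

definition q :: "real \<Rightarrow> complex \<Rightarrow> ennreal" where
  "q H z = e2ennreal (ereal H - u z)"

text \<open>\<open>real_of_ereal\<close> sends -\<infinity> to 0; by \<open>AE_finite\<close> this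
  concerns only a null set.\<close>

definition v :: "complex \<Rightarrow> real" where
  "v z = real_of_ereal (u z)"

lemma q_measurable [measurable]: "q H \<in> borel_measurable borel"
  unfolding q_def[abs_def] by measurable

lemma v_measurable [measurable]: "v \<in> borel_measurable borel"
  unfolding v_def[abs_def] by measurable

lemma growth_ball: "norm z < T \<Longrightarrow> 1 \<le> T \<Longrightarrow> u z \<le> ereal (max 0 (ln T + C))"
proof -
  assume "norm z < T" "1 \<le> T"
  then have "ln (max 1 (norm z)) \<le> ln T" by (intro ln_mono) auto
  then have "ln (max 1 (norm z)) + C \<le> max 0 (ln T + C)" by linarith
  then have "ereal (ln (max 1 (norm z)) + C) \<le> ereal (max 0 (ln T + C))" by (simp only: ereal_less_eq)
  then show ?thesis using growth[of z] order_trans by blast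
qed

text \<open>Rotation invariance turns the disc integral into an average of circle integrals about
  \<open>a\<close>, and on each circle the sub-mean inequality applies in the form of
  \<open>ereal_mean_circle_le\<close>.\<close>

lemma dmean_q_le:
  assumes R: "R > 0" and H: "0 \<le> H" "\<And>w. w \<in> ball a R \<Longrightarrow> u w \<le> ereal H"
  shows "dmean R (q H) a \<le> q H a"
proof -
  let ?f = "\<lambda>w. q H (a + w) * indicator (ball 0 R) w"
  have mf: "?f \<in> borel_measurable borel" by measurable
  have "(\<integral>\<^sup>+w. ?f w \<partial>lborel) * ennreal (2 * pi) = (\<integral>\<^sup>+t\<in>{0..2*pi}. (\<integral>\<^sup>+w. ?f w \<partial>lborel) \<partial>(lborel::real measure))"
    by (subst nn_integral_cmult_indicator) auto
  also have "\<dots> = (\<integral>\<^sup>+t\<in>{0..2*pi}. (\<integral>\<^sup>+w. ?f (cis t * w) \<partial>lborel) \<partial>lborel)"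
  proof (rule nn_integral_cong)
    fix t :: real
    have "linear (\<lambda>w. cis t * w)" by (simp add: linear_iff algebra_simps)
    then have "(\<integral>\<^sup>+w. ?f (cis t * w) \<partial>lborel) = (\<integral>\<^sup>+w. ?f w \<partial>lborel)"
      by (rule nn_integral_lborel_isometry[OF _ _ mf]) (simp add: norm_mult)
    then show "(\<integral>\<^sup>+w. ?f w \<partial>lborel) * indicator {0..2*pi} t = (\<integral>\<^sup>+w. ?f (cis t * w) \<partial>lborel) * indicator {0..2*pi} t"
      by simp
  qed
  also have "\<dots> = (\<integral>\<^sup>+t. \<integral>\<^sup>+w. q H (a + cis t * w) * indicator {0..2*pi} t * indicator (ball 0 R) w \<partial>lborel \<partial>lborel)"
    by (subst nn_integral_multc[symmetric]) (auto intro!: nn_integral_cong simp: norm_mult split: split_indicator)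
  also have "\<dots> = (\<integral>\<^sup>+w. \<integral>\<^sup>+t. q H (a + cis t * w) * indicator {0..2*pi} t * indicator (ball 0 R) w \<partial>lborel \<partial>lborel)"
    by (rule lborel_pair.Fubini') measurable
  also have "\<dots> \<le> (\<integral>\<^sup>+w. (ennreal (2 * pi) * q H a) * indicator (ball (0::complex) R) w \<partial>lborel)"
  proof (rule nn_integral_mono)
    fix w :: complex
    show "(\<integral>\<^sup>+t. q H (a + cis t * w) * indicator {0..2*pi} t * indicator (ball 0 R) w \<partial>lborel)
        \<le> (ennreal (2 * pi) * q H a) * indicator (ball 0 R) w"
    proof (cases "w \<in> ball 0 R")
      case True
      have "(\<integral>\<^sup>+t\<in>{0..2 * pi}. e2ennreal (ereal H - u (a + cis t * w)) \<partial>lborel) \<le> ennreal (2 * pi) * e2ennreal (ereal H - u a)"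
      proof (rule ereal_mean_circle_le[OF _ H(1) _ _ circle])
        show "u (a + cis t * w) \<le> ereal H" for t
          using True by (intro H(2)) (simp add: dist_norm norm_mult)
        show "u a \<noteq> \<infinity>" using lt_top[of a] by auto
      qed measurable
      then show ?thesis using True by (simp add: q_def)
    qed simp
  qed
  also have "\<dots> = ennreal (2 * pi) * q H a * ennreal (pi * R\<^sup>2)"
    using R by (simp add: nn_integral_cmult_indicator emeasure_ball_complex)
  finally have "ennreal (2 * pi) * (\<integral>\<^sup>+w. ?f w \<partial>lborel) \<le> ennreal (2 * pi) * (q H a * ennreal (pi * R\<^sup>2))"
    by (simp add: mult_ac)
  then have "(\<integral>\<^sup>+w. ?f w \<partial>lborel) \<le> q H a * ennreal (pi * R\<^sup>2)"
    by (simp add: ennreal_mult_le_mult_iff)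
  then show ?thesis
    unfolding dmean_def using R by (intro divide_le_posI_ennreal) (auto simp: mult.commute)
qed

text \<open>The sub-mean inequality at the centre 0, where u is finite, gives integrability on the
  whole disc. Both \<open>AE_finite\<close> and \<open>v_integrable\<close> rest on this.\<close>

lemma q_integral_finite:
  assumes "T \<ge> 1" "H \<ge> 0" "\<And>w. w \<in> ball 0 T \<Longrightarrow> u w \<le> ereal H"
  shows "(\<integral>\<^sup>+w\<in>ball 0 T. q H w \<partial>lborel) < \<infinity>"
proof -
  have "(\<integral>\<^sup>+w\<in>ball 0 T. q H w \<partial>lborel) = dmean T (q H) 0 * ennreal (pi * T\<^sup>2)"
    using assms(1) by (simp add: dmean_def ennreal_divide_times divide_mult_eq)
  also have "\<dots> \<le> q H 0 * ennreal (pi * T\<^sup>2)"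
    using assms by (intro mult_right_mono dmean_q_le) auto
  also have "\<dots> < \<infinity>"
    using finite_0 lt_top[of 0] by (cases "u 0") (auto simp: q_def ennreal_mult_less_top)
  finally show ?thesis .
qed

lemma AE_finite: "AE z in lborel. u z \<noteq> - \<infinity>"
proof -
  have "AE z in lborel. \<forall>n::nat. z \<in> ball 0 (real (Suc n)) \<longrightarrow> u z \<noteq> - \<infinity>"
    unfolding AE_all_countable
  proof
    fix n :: nat
    define H where "H = max 0 (ln (real (Suc n)) + C)"
    have "(\<integral>\<^sup>+w\<in>ball 0 (real (Suc n)). q H w \<partial>lborel) \<noteq> \<infinity>"
      using q_integral_finite[of "real (Suc n)" H] growth_ball[of _ "real (Suc n)"]
      by (auto simp: H_def top.not_eq_extremum simp del: of_nat_Suc)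
    then have "AE w in lborel. q H w * indicator (ball 0 (real (Suc n))) w \<noteq> \<infinity>"
      by (intro nn_integral_noteq_infinite) auto
    then show "AE z in lborel. z \<in> ball 0 (real (Suc n)) \<longrightarrow> u z \<noteq> - \<infinity>"
      by eventually_elim (auto simp: q_def)
  qed
  then show ?thesis
  proof eventually_elim
    case (elim z)
    obtain n where "norm z < real (Suc n)" using reals_Archimedean2 by (metis lessI less_trans of_nat_less_iff)
    then show ?case using elim by auto
  qed
qed

lemma AE_q: "AE z in lborel. u z \<le> ereal H \<longrightarrow> q H z = ennreal (H - v z) \<and> v z \<le> H"
  using AE_finite
proof eventually_elim
  case (elim z)
  then show ?case using lt_top[of z] by (cases "u z") (auto simp: q_def v_def)
qed

lemma v_integrable: "integrable lborel (\<lambda>w. v w * indicator (ball 0 T) w)"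
proof -
  define T' where "T' = max 1 T"
  define H where "H = max 0 (ln T' + C)"
  have H: "u w \<le> ereal H" if "w \<in> ball 0 T'" for w
    unfolding H_def using that by (intro growth_ball) (auto simp: T'_def)
  have "integrable lborel (\<lambda>w. (H - v w) * indicator (ball 0 T') w)"
  proof (rule integrableI_nonneg)
    show "AE x in lborel. 0 \<le> (H - v x) * indicator (ball 0 T') x"
      using AE_q[of H] by eventually_elim (use H in \<open>auto split: split_indicator\<close>)
    have "(\<integral>\<^sup>+ x. ennreal ((H - v x) * indicator (ball 0 T') x) \<partial>lborel) = (\<integral>\<^sup>+w\<in>ball 0 T'. q H w \<partial>lborel)"
      using AE_q[of H] by (intro nn_integral_cong_AE, eventually_elim) (use H in \<open>auto split: split_indicator\<close>)
    also have "\<dots> < \<infinity>" using H by (intro q_integral_finite) (auto simp: H_def T'_def)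
    finally show "(\<integral>\<^sup>+ x. ennreal ((H - v x) * indicator (ball 0 T') x) \<partial>lborel) < \<infinity>" .
  qed measurable
  moreover have "integrable lborel (\<lambda>w. H * indicator (ball (0::complex) T') w)"
    by (intro integrable_mult_right integrable_real_indicator) (auto simp: emeasure_ball_complex T'_def)
  ultimately have "integrable lborel (\<lambda>w. H * indicator (ball 0 T') w - (H - v w) * indicator (ball 0 T') w)"
    by (rule Bochner_Integration.integrable_diff[rotated])
  then have "integrable lborel (\<lambda>w. v w * indicator (ball 0 T') w)"
    by (simp add: algebra_simps)
  then show ?thesis
    by (rule Bochner_Integration.integrable_bound) (auto simp: T'_def split: split_indicator)
qed

lemma v_integrable': "integrable lborel (\<lambda>w. v (z + w) * indicator (ball 0 s) w)"
proof -
  have "integrable lborel (\<lambda>w. v w * indicator (ball z s) w)"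
  proof (rule Bochner_Integration.integrable_bound[OF v_integrable[of "norm z + s"]])
    show "AE w in lborel. norm (v w * indicator (ball z s) w) \<le> norm (v w * indicator (ball 0 (norm z + s)) w)"
    proof (rule AE_I2)
      fix w
      have "w \<in> ball 0 (norm z + s)" if "w \<in> ball z s"
        using that norm_triangle_ineq2[of w z] by (simp add: dist_norm norm_minus_commute)
      then show "norm (v w * indicator (ball z s) w) \<le> norm (v w * indicator (ball 0 (norm z + s)) w)"
        by (auto split: split_indicator)
    qed
  qed measurable
  then have "integrable (distr lborel borel ((+) z)) (\<lambda>w. v w * indicator (ball z s) w)"
    by (simp add: lborel_distr_plus)
  then have "integrable lborel (\<lambda>w. v (z + w) * indicator (ball z s) (z + w))"
    by (subst (asm) integrable_distr_eq) auto
  then show ?thesis by (simp add: indicator_def dist_norm)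
qed

lemma dmean_q:
  assumes s: "s > 0" and H: "0 \<le> H" "\<And>w. w \<in> ball z s \<Longrightarrow> u w \<le> ereal H"
  shows "dmean s (q H) z = ennreal (H - area_mean v s z)" "area_mean v s z \<le> H"
proof -
  let ?I = "\<lambda>w. indicator (ball (0::complex) s) w :: real"
  have ae: "AE w in lborel. u (z + w) \<le> ereal H \<longrightarrow> q H (z + w) = ennreal (H - v (z + w)) \<and> v (z + w) \<le> H"
  proof -
    have "AE w in distr lborel borel ((+) z). u w \<le> ereal H \<longrightarrow> q H w = ennreal (H - v w) \<and> v w \<le> H"
      unfolding lborel_distr_plus by (rule AE_q)
    then show ?thesis by (subst (asm) AE_distr_iff) auto
  qed
  have intI: "integrable lborel ?I" "(\<integral>w. ?I w \<partial>lborel) = pi * s\<^sup>2"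
    using s by (auto simp: emeasure_ball_complex measure_def)
  have int: "integrable lborel (\<lambda>w. (H - v (z + w)) * ?I w)"
    using v_integrable'[of z s] intI(1) by (simp add: left_diff_distrib)
  have eq: "(\<integral>w. (H - v (z + w)) * ?I w \<partial>lborel) = (H - area_mean v s z) * (pi * s\<^sup>2)"
    using v_integrable'[of z s] intI s by (simp add: left_diff_distrib area_mean_def)
  have nn: "AE w in lborel. 0 \<le> (H - v (z + w)) * ?I w"
    using ae by eventually_elim (use H in \<open>auto split: split_indicator simp: dist_norm\<close>)
  then have "0 \<le> (H - area_mean v s z) * (pi * s\<^sup>2)"
    unfolding eq[symmetric] by (rule integral_nonneg_AE)
  then show le: "area_mean v s z \<le> H" using s pi_gt_zero zero_less_power[of s 2]
    by (metis diff_ge_0_iff_ge mult_pos_pos zero_le_mult_iff not_le)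
  have "(\<integral>\<^sup>+y\<in>ball 0 s. q H (z + y) \<partial>lborel) = (\<integral>\<^sup>+w. ennreal ((H - v (z + w)) * ?I w) \<partial>lborel)"
    using ae by (intro nn_integral_cong_AE, eventually_elim) (use H in \<open>auto split: split_indicator simp: dist_norm\<close>)
  also have "\<dots> = ennreal ((H - area_mean v s z) * (pi * s\<^sup>2))"
    using int nn by (simp add: nn_integral_eq_integral eq)
  finally show "dmean s (q H) z = ennreal (H - area_mean v s z)"
    unfolding dmean_def using s le by (simp add: divide_ennreal)
qed

lemma u_le_area_mean:
  assumes "s > 0" shows "u z \<le> ereal (area_mean v s z)"
proof -
  define T where "T = norm z + s + 1"
  define H where "H = max 0 (ln T + C)"
  have le: "u w \<le> ereal H" if "w \<in> ball z s" for w
    unfolding H_def using that norm_triangle_ineq2[of w z] \<open>s > 0\<close>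
    by (intro growth_ball) (auto simp: T_def dist_norm norm_minus_commute)
  have "ennreal (H - area_mean v s z) \<le> e2ennreal (ereal H - u z)" "area_mean v s z \<le> H"
    using dmean_q_le[where a=z and H=H, OF assms _ le] dmean_q[where z=z and H=H, OF assms _ le] by (auto simp: H_def q_def)
  then show ?thesis
    using le[of z] assms lt_top[of z] by (cases "u z") (auto simp: ennreal_le_iff)
qed

lemma area_mean_le:
  assumes "s > 0" and H: "\<And>w. w \<in> ball z s \<Longrightarrow> u w \<le> ereal H"
  shows "area_mean v s z \<le> H"
proof -
  \<comment> \<open>\<open>dmean_q\<close> asks for a nonnegative bound, whereas H may be negative;
    comparing q H' with the constant H' - H recovers the bound by H.\<close>
  define H' where "H' = max 0 H"
  have le: "u w \<le> ereal H'" if "w \<in> ball z s" for w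
    using H[OF that] by (rule order_trans) (simp add: H'_def)
  have eqs: "dmean s (q H') z = ennreal (H' - area_mean v s z)" "area_mean v s z \<le> H'"
    using dmean_q[where z=z and H=H', OF assms(1) _ le] by (auto simp: H'_def)
  have "ennreal (H' - H) = dmean s (\<lambda>_. ennreal (H' - H)) z" using assms by (simp add: dmean_const)
  also have "\<dots> \<le> dmean s (q H') z"
  proof (rule dmean_mono)
    fix w assume "w \<in> ball z s"
    then show "ennreal (H' - H) \<le> q H' w"
      using H[of w] lt_top[of w] by (cases "u w") (auto simp: q_def intro!: ennreal_leI)
  qed
  finally show ?thesis using eqs by (simp add: H'_def ennreal_le_iff)
qed

text \<open>Dominated convergence: as the centre moves, the indicator of the ball converges off the
  limiting sphere, which is a null set.\<close>

lemma continuous_area_mean: "continuous_on UNIV (area_mean v s)"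
proof (cases "s > 0")
  case s: True
  have shift: "(\<integral>w. v (z + w) * indicator (ball 0 s) w \<partial>lborel) = (\<integral>w. v w * indicator (ball z s) w \<partial>lborel)" for z
  proof -
    have "(\<integral>w. v w * indicator (ball z s) w \<partial>lborel) = (\<integral>w. v w * indicator (ball z s) w \<partial>distr lborel borel ((+) z))"
      by (simp add: lborel_distr_plus)
    also have "\<dots> = (\<integral>w. v (z + w) * indicator (ball z s) (z + w) \<partial>lborel)"
      by (rule integral_distr) auto
    finally show ?thesis by (simp add: indicator_def dist_norm)
  qed
  have "(\<lambda>n. \<integral>w. v w * indicator (ball (x n) s) w \<partial>lborel) \<longlonglongrightarrow> (\<integral>w. v w * indicator (ball z s) w \<partial>lborel)"
    if x: "x \<longlonglongrightarrow> z" for x z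
  proof -
    obtain B where B: "\<And>n. norm (x n) \<le> B"
      using convergent_imp_Bseq[of x] x by (auto simp: Bseq_def convergent_def)
    show ?thesis
    proof (rule integral_dominated_convergence[where w="\<lambda>w. norm (v w * indicator (ball 0 (B + s)) w)"])
      show "integrable lborel (\<lambda>w. norm (v w * indicator (ball 0 (B + s)) w))"
        by (intro integrable_norm v_integrable)
      show "AE w in lborel. norm (v w * indicator (ball (x n) s) w) \<le> norm (v w * indicator (ball 0 (B + s)) w)" for n
      proof (rule AE_I2)
        fix w
        have "w \<in> ball 0 (B + s)" if "w \<in> ball (x n) s"
          using that B[of n] norm_triangle_ineq2[of w "x n"] by (simp add: dist_norm norm_minus_commute)
        then show "norm (v w * indicator (ball (x n) s) w) \<le> norm (v w * indicator (ball 0 (B + s)) w)"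
          by (auto split: split_indicator)
      qed
      show "AE w in lborel. (\<lambda>n. v w * indicator (ball (x n) s) w) \<longlonglongrightarrow> v w * indicator (ball z s) w"
      proof (rule eventually_mono[OF AE_not_in[OF null_sets_sphere]])
        fix w assume "w \<notin> sphere z s"
        then have "dist z w \<noteq> s" by simp
        have "(\<lambda>n. dist (x n) w) \<longlonglongrightarrow> dist z w" using x by (intro tendsto_intros)
        have "\<forall>\<^sub>F n in sequentially. (w \<in> ball (x n) s) = (w \<in> ball z s)"
        proof (cases "dist z w < s")
          case True
          then show ?thesis
            using order_tendstoD(2)[OF \<open>(\<lambda>n. dist (x n) w) \<longlonglongrightarrow> dist z w\<close>, of s]
            by (auto elim: eventually_mono)
        next
          case False
          then show ?thesis
            using order_tendstoD(1)[OF \<open>(\<lambda>n. dist (x n) w) \<longlonglongrightarrow> dist z w\<close>, of s] \<open>dist z w \<noteq> s\<close>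
            by (auto elim: eventually_mono)
        qed
        then have "\<forall>\<^sub>F n in sequentially. v w * indicator (ball (x n) s) w = v w * indicator (ball z s) w"
          by eventually_elim (simp only: indicator_def)
        then show "(\<lambda>n. v w * indicator (ball (x n) s) w) \<longlonglongrightarrow> v w * indicator (ball z s) w"
          by (rule tendsto_eventually)
      qed
    qed measurable
  qed
  then have "continuous_on UNIV (\<lambda>z. \<integral>w. v w * indicator (ball z s) w \<partial>lborel)"
    by (auto simp: continuous_on_sequentially o_def)
  then show ?thesis
    unfolding area_mean_def[abs_def] shift using s by (intro continuous_intros) auto
next
  case False
  then have *: "ball (0::complex) s = {}" by simp
  show ?thesis unfolding area_mean_def[abs_def] * by simp
qed

text \<open>Disc means commute, so the mean over radius t of means over radius s is a mean over
  radius s of something at most q H'. The growth constant gains ln 2 because |w| <= |z| + 1 <= 2 max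
  1 |z|.\<close>

lemma area_mean_disc_subharmonic:
  assumes s: "0 < s" "s \<le> 1" and r: "r > 0"
  shows "disc_subharmonic (area_mean v s) (C + ln 2) r"
proof
  show "continuous_on UNIV (area_mean v s)" by (rule continuous_area_mean)
  show "area_mean v s z \<le> ln (max 1 (norm z)) + (C + ln 2)" for z
  proof (rule area_mean_le[OF s(1)])
    fix w assume "w \<in> ball z s"
    then have "norm w \<le> norm z + 1"
      using norm_triangle_ineq2[of w z] s by (simp add: dist_norm norm_minus_commute)
    then have "ln (max 1 (norm w)) \<le> ln (2 * max 1 (norm z))" by (intro ln_mono) auto
    also have "\<dots> = ln 2 + ln (max 1 (norm z))" by (subst ln_mult) (auto simp: max_def)
    finally have "ereal (ln (max 1 (norm w)) + C) \<le> ereal (ln (max 1 (norm z)) + (C + ln 2))" by simp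
    then show "u w \<le> ereal (ln (max 1 (norm z)) + (C + ln 2))"
      using growth[of w] order_trans by blast
  qed
  show "dmean t (\<lambda>w. ennreal (H - area_mean v s w)) z \<le> ennreal (H - area_mean v s z)"
    if t: "t > 0" and H: "\<And>w. w \<in> ball z t \<Longrightarrow> area_mean v s w \<le> H" for z t H
  proof -
    define T where "T = norm z + t + s + 1"
    \<comment> \<open>H bounds only the averages; H' also bounds u on the discs that enter them and
      is nonnegative, as \<open>dmean_q\<close> requires. The constant H' - H is cancelled at the
      end.\<close>
    define H' where "H' = max H (max 0 (ln T + C))"
    have uH: "u w \<le> ereal H'" if "norm (w - z) < t + s" for w
    proof -
      have "norm w < T" using that norm_triangle_ineq2[of w z] by (simp add: T_def)
      then have "u w \<le> ereal (max 0 (ln T + C))" using s t by (intro growth_ball) (auto simp: T_def)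
      then show ?thesis by (rule order_trans) (simp add: H'_def)
    qed
    have H'0: "H' \<ge> 0" by (simp add: H'_def)
    have eq: "dmean s (q H') w = ennreal (H' - area_mean v s w)" "area_mean v s w \<le> H'" if "dist z w < t" for w
    proof -
      have *: "u y \<le> ereal H'" if "y \<in> ball w s" for y
        using that \<open>dist z w < t\<close> norm_triangle_ineq[of "y - w" "w - z"]
        by (intro uH) (simp add: dist_norm norm_minus_commute)
      show "dmean s (q H') w = ennreal (H' - area_mean v s w)" "area_mean v s w \<le> H'"
        by (rule dmean_q[OF s(1) H'0 *]; simp)+
    qed
    have [measurable]: "area_mean v s \<in> borel_measurable borel"
      using continuous_area_mean by (rule borel_measurable_continuous_onI)
    have "dmean t (\<lambda>w. ennreal (H' - H)) z + dmean t (\<lambda>w. ennreal (H - area_mean v s w)) z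
        = dmean t (\<lambda>w. ennreal (H' - H) + ennreal (H - area_mean v s w)) z"
      by (rule dmean_add[symmetric]) measurable
    also have "\<dots> = dmean t (dmean s (q H')) z"
      using H eq(1) by (intro dmean_cong) (auto simp: H'_def simp flip: ennreal_plus)
    also have "\<dots> = dmean s (dmean t (q H')) z"
      by (rule dmean_commute) measurable
    also have "\<dots> \<le> dmean s (q H') z"
    proof (rule dmean_mono)
      fix w assume w: "w \<in> ball z s"
      show "dmean t (q H') w \<le> q H' w"
      proof (rule dmean_q_le[OF t H'0])
        fix y assume "y \<in> ball w t"
        then show "u y \<le> ereal H'"
          using w norm_triangle_ineq[of "y - w" "w - z"]
          by (intro uH) (simp add: dist_norm norm_minus_commute)
      qed
    qed
    also have "\<dots> = ennreal (H' - H) + ennreal (H - area_mean v s z)"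
      using H[of z] eq(1)[of z] t by (auto simp: H'_def simp flip: ennreal_plus)
    finally show ?thesis
      using t by (simp add: dmean_const ennreal_add_left_cancel_le)
  qed
qed (rule r)

text \<open>Both errors of the approximation by disc means have the right sign: at 0 the means are
  at least u 0, and by upper semicontinuity their upper limit at z is at most u z. The integrand is
  thus below the lower limit of the regularised ones, and Fatou's lemma applies.\<close>

lemma exp_integral_le:
  assumes \<nu>: "finite_measure \<nu>" "sets \<nu> = sets borel" "AE z in \<nu>. norm z \<le> K" and \<alpha>: "\<alpha> > 0"
    and S: "\<And>w. (\<integral>\<^sup>+z. ennreal ((norm w / norm (z - w)) powr \<alpha>) \<partial>\<nu>) \<le> S" and S': "emeasure \<nu> UNIV \<le> S"
  shows "(\<integral>\<^sup>+z. exp_ereal (ereal \<alpha> * (u 0 - u z)) \<partial>\<nu>) \<le> S"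
proof -
  note [measurable_cong] = \<nu>(2)
  define s where "s = (\<lambda>n. 1 / real (Suc n))"
  have s: "0 < s n" "s n \<le> 1" for n by (simp_all add: s_def)
  have s0: "s \<longlonglongrightarrow> 0" unfolding s_def using LIMSEQ_inverse_real_of_nat by (simp add: inverse_eq_divide)
  define f where "f = (\<lambda>n. area_mean v (s n))"
  have [measurable]: "f n \<in> borel_measurable borel" for n
    unfolding f_def using continuous_area_mean by (rule borel_measurable_continuous_onI)
  obtain x where x: "u 0 = ereal x" using finite_0 lt_top[of 0] by (cases "u 0") auto
  have x_le: "x \<le> f n 0" for n
    using u_le_area_mean[OF s(1), of 0 n] by (simp add: f_def x)
  have "exp_ereal (ereal \<alpha> * (u 0 - u z)) \<le> liminf (\<lambda>n. ennreal (exp (\<alpha> * (f n 0 - f n z))))" (is "_ \<le> ?L") for z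
  proof -
    have lower: "ennreal (exp (\<alpha> * (x - c))) \<le> ?L" if c: "u z < ereal c" for c
    proof (rule Liminf_bounded)
      have "open {w. u w < ereal c}" using usc by (simp add: upper_semicontinuous_def)
      then obtain d where d: "d > 0" "ball z d \<subseteq> {w. u w < ereal c}"
        using c by (meson mem_Collect_eq openE)
      have "\<forall>\<^sub>F n in sequentially. s n < d" using order_tendstoD(2)[OF s0 d(1)] .
      then show "\<forall>\<^sub>F n in sequentially. ennreal (exp (\<alpha> * (x - c))) \<le> ennreal (exp (\<alpha> * (f n 0 - f n z)))"
      proof eventually_elim
        case (elim n)
        have "f n z \<le> c"
          unfolding f_def using d(2) elim by (intro area_mean_le s) (auto simp: subset_iff intro!: less_imp_le)
        then show ?case using x_le[of n] \<alpha> by (intro ennreal_leI) simp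
      qed
    qed
    show ?thesis
    proof (cases "u z")
      case (real y)
      have "((\<lambda>c. ennreal (exp (\<alpha> * (x - c)))) \<longlongrightarrow> ennreal (exp (\<alpha> * (x - y)))) (at_right y)"
        by (intro tendsto_ennrealI tendsto_intros)
      moreover have "\<forall>\<^sub>F c in at_right y. ennreal (exp (\<alpha> * (x - c))) \<le> ?L"
        unfolding eventually_at_right_field using lower real by (auto intro!: exI[of _ "y + 1"])
      ultimately have "ennreal (exp (\<alpha> * (x - y))) \<le> ?L"
        by (intro tendsto_upperbound) auto
      then show ?thesis by (simp add: real x exp_ereal_def)
    next
      case MInf
      \<comment> \<open>If the lower limit were a real number l, the level c = x - l/\<alpha> would
        give exp l <= l.\<close>
      have "?L = top"
      proof (rule ccontr)
        assume "?L \<noteq> top"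
        then obtain l where l: "?L = ennreal l" "l \<ge> 0" by (cases ?L) auto
        have "ennreal (exp (\<alpha> * (x - (x - l / \<alpha>)))) \<le> ennreal l"
          unfolding l(1)[symmetric] by (rule lower) (simp add: MInf)
        then have "exp l \<le> l" using l(2) \<alpha> by simp
        then show False using exp_ge_add_one_self[of l] by simp
      qed
      then show ?thesis by simp
    next
      case PInf
      then show ?thesis using lt_top[of z] by simp
    qed
  qed
  then have "(\<integral>\<^sup>+z. exp_ereal (ereal \<alpha> * (u 0 - u z)) \<partial>\<nu>)
      \<le> (\<integral>\<^sup>+z. liminf (\<lambda>n. ennreal (exp (\<alpha> * (f n 0 - f n z)))) \<partial>\<nu>)"
    by (rule nn_integral_mono)
  also have "\<dots> \<le> liminf (\<lambda>n. \<integral>\<^sup>+z. ennreal (exp (\<alpha> * (f n 0 - f n z))) \<partial>\<nu>)"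
    by (rule nn_integral_liminf) measurable
  also have "\<dots> \<le> S"
  proof (rule Liminf_le)
    show "\<forall>\<^sub>F n in sequentially. (\<integral>\<^sup>+z. ennreal (exp (\<alpha> * (f n 0 - f n z))) \<partial>\<nu>) \<le> S"
      unfolding f_def using area_mean_disc_subharmonic[OF s]
      by (intro always_eventually allI continuous_exp_integral[OF _ \<nu> \<alpha> S S'])
  qed simp
  finally show ?thesis .
qed

end

lemma line_lelong_exp_integral_le:
  assumes "line_lelong u" "u 0 \<noteq> - \<infinity>"
    and "finite_measure \<nu>" "sets \<nu> = sets borel" "AE z in \<nu>. norm z \<le> K" "\<alpha> > 0"
    and "\<And>w. (\<integral>\<^sup>+z. ennreal ((norm w / norm (z - w)) powr \<alpha>) \<partial>\<nu>) \<le> S" "emeasure \<nu> UNIV \<le> S"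
  shows "(\<integral>\<^sup>+z. exp_ereal (ereal \<alpha> * (u 0 - u z)) \<partial>\<nu>) \<le> S"
proof -
  obtain C where "line_lelong_class u C"
    using assms(1,2) unfolding line_lelong_def line_lelong_class_def by blast
  then show ?thesis using assms(3-) by (rule line_lelong_class.exp_integral_le)
qed

lemma exp_ereal_measurable [measurable]: "exp_ereal \<in> borel_measurable borel"
proof -
  have eq: "exp_ereal = (\<lambda>x. if x = \<infinity> then \<infinity> else if x = - \<infinity> then 0 else ennreal (exp (real_of_ereal x)))"
    by (rule ext) (auto simp: exp_ereal_def split: ereal.split)
  show ?thesis by (subst eq) measurable
qed

section \<open>Kernel integrals over discs and segments\<close>

text \<open>For \<open>\<bar>w\<bar> > d\<close> the point \<open>w'\<close> is the inverse of \<open>w\<close> with respect to the circle \<open>\<bar>z\<bar> = d\<close>.\<close>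

lemma inversion_quotient_le:
  assumes d: "d > 0"
  obtains w' where "\<And>z. norm z \<le> d \<Longrightarrow> norm (w::complex) * norm (z - w') \<le> d * norm (z - w)"
proof (cases "norm w \<le> d")
  case True
  then show ?thesis by (intro that[of w]) (simp add: mult_right_mono)
next
  case False
  then have w: "w \<noteq> 0" "d\<^sup>2 \<le> (norm w)\<^sup>2" using d by (auto intro!: power_mono)
  define t where "t = d\<^sup>2 / (norm w)\<^sup>2"
  have t: "t * (norm w)\<^sup>2 = d\<^sup>2" using w by (simp add: t_def)
  show ?thesis
  proof (rule that[of "of_real t * w"])
    fix z :: complex assume z: "norm z \<le> d"
    have nd: "(norm (z - of_real s * w))\<^sup>2 = (norm z)\<^sup>2 - 2 * s * (Re z * Re w + Im z * Im w) + s\<^sup>2 * (norm w)\<^sup>2" for s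
      by (simp only: cmod_power2) (simp add: power2_eq_square algebra_simps)
    have "(norm w * norm (z - of_real t * w))\<^sup>2
        = (norm w)\<^sup>2 * (norm z)\<^sup>2 - 2 * (t * (norm w)\<^sup>2) * (Re z * Re w + Im z * Im w) + (t * (norm w)\<^sup>2)\<^sup>2"
      by (simp only: power_mult_distrib nd) (simp add: power2_eq_square algebra_simps)
    then have "(norm w * norm (z - of_real t * w))\<^sup>2
        = (norm w)\<^sup>2 * (norm z)\<^sup>2 - 2 * d\<^sup>2 * (Re z * Re w + Im z * Im w) + (d\<^sup>2)\<^sup>2"
      by (simp only: t)
    moreover have "(d * norm (z - w))\<^sup>2 = d\<^sup>2 * ((norm z)\<^sup>2 - 2 * (Re z * Re w + Im z * Im w) + (norm w)\<^sup>2)"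
      using nd[of 1] by (simp add: power_mult_distrib)
    \<comment> \<open>This product is exactly the difference of the two squares; it is nonnegative
      because |z| <= d <= |w|.\<close>
    moreover have "0 \<le> (d\<^sup>2 - (norm z)\<^sup>2) * ((norm w)\<^sup>2 - d\<^sup>2)"
      using z w d by (intro mult_nonneg_nonneg) (auto intro!: power_mono)
    ultimately have "(norm w * norm (z - of_real t * w))\<^sup>2 \<le> (d * norm (z - w))\<^sup>2"
      by (simp add: power2_eq_square algebra_simps)
    then show "norm w * norm (z - of_real t * w) \<le> d * norm (z - w)"
      by (rule power2_le_imp_le) (use d in simp)
  qed
qed

text \<open>Trades the singularity at w, with numerator |w|, for one at w' with the fixed numerator
  \<open>d\<close>. At z = w the left-hand side is 0 by the convention for division by 0.\<close>

lemma powr_quotient_le: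
  assumes "norm (w::complex) * norm (z - w') \<le> d * norm (z - w)" "z \<noteq> w'" "0 < d" "0 < \<alpha>"
  shows "(norm w / norm (z - w)) powr \<alpha> \<le> (d / norm (z - w')) powr \<alpha>"
proof (cases "z = w")
  case False
  then have "norm w / norm (z - w) \<le> d / norm (z - w')"
    using assms by (simp add: divide_le_eq mult.commute pos_le_divide_eq)
  then show ?thesis using assms(4) by (intro powr_mono2) auto
qed simp

lemma nn_integral_powr_from_0:
  assumes "a > -1" "b \<ge> 0"
  shows "(\<integral>\<^sup>+s\<in>{0..b}. ennreal (s powr a) \<partial>lborel) = ennreal (b powr (a + 1) / (a + 1))"
proof -
  have "(\<lambda>s. s powr a * indicator {0..b} s) = (\<lambda>s. if s \<in> {0..b} then s powr a else 0)" by auto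
  then have "((\<lambda>s. s powr a * indicator {0..b} s) has_integral (b powr (a + 1) / (a + 1))) UNIV"
    using has_integral_powr_from_0[OF assms] by (simp only: has_integral_restrict_UNIV)
  then have "(\<integral>\<^sup>+s. ennreal (s powr a * indicator {0..b} s) \<partial>lborel) = ennreal (b powr (a + 1) / (a + 1))"
    by (intro nn_integral_has_integral_lborel) auto
  then show ?thesis by (simp add: nn_integral_set_ennreal)
qed

lemma nn_integral_disc_powr:
  fixes p :: complex
  assumes \<alpha>: "0 < \<alpha>" "\<alpha> < 2" and \<rho>: "\<rho> > 0" and d: "d > 0"
  shows "(\<integral>\<^sup>+z\<in>ball p \<rho>. ennreal ((d / norm (z - p)) powr \<alpha>) \<partial>lborel)
    \<le> ennreal (2 * pi * \<rho>\<^sup>2 * (d / \<rho>) powr \<alpha> / (2 - \<alpha>))"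
proof -
  have "(\<integral>\<^sup>+z\<in>ball p \<rho>. ennreal ((d / norm (z - p)) powr \<alpha>) \<partial>lborel)
      = (\<integral>\<^sup>+z\<in>ball (0::complex) \<rho>. ennreal ((d / norm z) powr \<alpha>) \<partial>lborel)"
    using nn_integral_lborel_shift[of "\<lambda>z. ennreal ((d / norm (z - p)) powr \<alpha>) * indicator (ball p \<rho>) z" p]
    by (simp add: indicator_def dist_norm)
  also have "\<dots> \<le> (\<integral>\<^sup>+z. (\<lambda>s. ennreal (d powr \<alpha>) * (ennreal (s powr (- \<alpha> / 2)) * indicator {0..\<rho>\<^sup>2} s)) ((norm (z::complex))\<^sup>2) \<partial>lborel)"
  proof (intro nn_integral_mono_AE eventually_mono[OF AE_lborel_singleton[of 0]])
    fix z :: complex assume "z \<noteq> 0"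
    have E: "((norm z)\<^sup>2) powr (- \<alpha> / 2) = norm z powr (- \<alpha>)"
    proof -
      have "(norm z)\<^sup>2 = norm z powr 2" using \<open>z \<noteq> 0\<close> by simp
      then have "((norm z)\<^sup>2) powr (- \<alpha> / 2) = norm z powr (2 * (- \<alpha> / 2))" by (simp only: powr_powr)
      then show ?thesis by simp
    qed
    have "(d / norm z) powr \<alpha> = d powr \<alpha> * ((norm z)\<^sup>2) powr (- \<alpha> / 2)"
      unfolding E using d by (simp add: powr_divide powr_minus_divide)
    moreover have "z \<in> ball 0 \<rho> \<Longrightarrow> (norm z)\<^sup>2 \<in> {0..\<rho>\<^sup>2}"
      using \<rho> by (auto intro!: power_mono)
    ultimately show "ennreal ((d / norm z) powr \<alpha>) * indicator (ball 0 \<rho>) z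
        \<le> ennreal (d powr \<alpha>) * (ennreal ((norm z)\<^sup>2 powr (- \<alpha> / 2)) * indicator {0..\<rho>\<^sup>2} ((norm z)\<^sup>2))"
      by (auto split: split_indicator simp: ennreal_mult)
  qed
  also have "\<dots> = ennreal pi * (\<integral>\<^sup>+s\<in>{0..}. (ennreal (d powr \<alpha>) * (ennreal (s powr (- \<alpha> / 2)) * indicator {0..\<rho>\<^sup>2} s)) \<partial>lborel)"
    by (rule nn_integral_complex_radial) measurable
  also have "(\<integral>\<^sup>+s\<in>{0..}. (ennreal (d powr \<alpha>) * (ennreal (s powr (- \<alpha> / 2)) * indicator {0..\<rho>\<^sup>2} s)) \<partial>lborel)
      = ennreal (d powr \<alpha>) * (\<integral>\<^sup>+s\<in>{0..\<rho>\<^sup>2}. ennreal (s powr (- \<alpha> / 2)) \<partial>lborel)"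
    by (subst nn_integral_cmult[symmetric]) (auto intro!: nn_integral_cong split: split_indicator)
  also have "(\<integral>\<^sup>+s\<in>{0..\<rho>\<^sup>2}. ennreal (s powr (- \<alpha> / 2)) \<partial>lborel) = ennreal ((\<rho>\<^sup>2) powr (- \<alpha> / 2 + 1) / (- \<alpha> / 2 + 1))"
    using \<alpha> by (intro nn_integral_powr_from_0) auto
  also have "ennreal pi * (ennreal (d powr \<alpha>) * \<dots>) = ennreal (pi * (d powr \<alpha> * ((\<rho>\<^sup>2) powr (- \<alpha> / 2 + 1) / (- \<alpha> / 2 + 1))))"
    using \<alpha> by (simp flip: ennreal_mult)
  also have "(\<rho>\<^sup>2) powr (- \<alpha> / 2 + 1) = \<rho>\<^sup>2 / \<rho> powr \<alpha>"
  proof -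
    have "\<rho>\<^sup>2 = \<rho> powr 2" using \<rho> by simp
    then have "(\<rho>\<^sup>2) powr (- \<alpha> / 2 + 1) = \<rho> powr (2 * (- \<alpha> / 2 + 1))" by (simp only: powr_powr)
    also have "2 * (- \<alpha> / 2 + 1) = 2 - \<alpha>" by simp
    also have "\<rho> powr (2 - \<alpha>) = \<rho>\<^sup>2 / \<rho> powr \<alpha>" using \<rho> by (simp add: powr_diff)
    finally show ?thesis .
  qed
  also have "pi * (d powr \<alpha> * (\<rho>\<^sup>2 / \<rho> powr \<alpha> / (- \<alpha> / 2 + 1))) = 2 * pi * \<rho>\<^sup>2 * (d / \<rho>) powr \<alpha> / (2 - \<alpha>)"
    using \<alpha> \<rho> d by (simp add: powr_divide field_simps)
  finally show ?thesis .
qed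

text \<open>The disc has 0 on its boundary and lies in |z| <= 2|c| = d. Inversion in the circle |z|
  = d replaces the numerator |w| by d, and rearrangement moves the disc onto the singularity w'; the
  bound no longer depends on w.\<close>

lemma nn_integral_disc_quotient_le:
  assumes \<alpha>: "0 < \<alpha>" "\<alpha> < 2" and c: "c \<noteq> (0::complex)"
  shows "(\<integral>\<^sup>+z\<in>ball c (norm c). ennreal ((norm w / norm (z - w)) powr \<alpha>) \<partial>lborel)
    \<le> ennreal (2 * pi * (norm c)\<^sup>2 * 2 powr \<alpha> / (2 - \<alpha>))"
proof -
  define \<rho> d where "\<rho> = norm c" and "d = 2 * \<rho>"
  have \<rho>: "\<rho> > 0" "d > 0" using c by (simp_all add: \<rho>_def d_def)
  obtain w' where w': "\<And>z. norm z \<le> d \<Longrightarrow> norm w * norm (z - w') \<le> d * norm (z - w)"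
    using inversion_quotient_le[OF \<rho>(2)] by blast
  define f where "f = (\<lambda>z. ennreal ((d / norm (z - w')) powr \<alpha>))"
  have [measurable]: "f \<in> borel_measurable borel" unfolding f_def by measurable
  have "(\<integral>\<^sup>+z\<in>ball c \<rho>. ennreal ((norm w / norm (z - w)) powr \<alpha>) \<partial>lborel) \<le> (\<integral>\<^sup>+z\<in>ball c \<rho>. f z \<partial>lborel)"
  proof (intro nn_integral_mono_AE eventually_mono[OF AE_lborel_singleton[of w']])
    fix z assume "z \<noteq> w'"
    have "ennreal ((norm w / norm (z - w)) powr \<alpha>) \<le> f z" if "z \<in> ball c \<rho>"
    proof -
      have "norm z \<le> d"
        using that norm_triangle_ineq2[of z c] by (simp add: d_def \<rho>_def dist_norm norm_minus_commute)
      then show ?thesis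
        unfolding f_def using \<open>z \<noteq> w'\<close> \<rho> \<alpha> by (intro ennreal_leI powr_quotient_le w')
    qed
    then show "ennreal ((norm w / norm (z - w)) powr \<alpha>) * indicator (ball c \<rho>) z \<le> f z * indicator (ball c \<rho>) z"
      by (auto split: split_indicator)
  qed
  \<comment> \<open>The centre is removed because division by 0 makes \<open>f w'\<close> equal to
    0, below the level \<open>(d / \<rho>) powr \<alpha>\<close>.\<close>
  also have "\<dots> \<le> (\<integral>\<^sup>+z\<in>ball w' \<rho> - {w'}. f z \<partial>lborel)"
  proof (rule nn_integral_rearrangement[where c="ennreal ((d / \<rho>) powr \<alpha>)"])
    have "emeasure lborel (ball w' \<rho> - {w'}) = emeasure lborel (ball w' \<rho>)"
      by (rule emeasure_Diff_null_set) (auto simp: null_sets_def)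
    then show "emeasure lborel (ball c \<rho>) = emeasure lborel (ball w' \<rho> - {w'})" "emeasure lborel (ball w' \<rho> - {w'}) \<noteq> \<infinity>"
      using \<rho> by (simp_all add: emeasure_ball_complex)
    show "f z \<le> ennreal ((d / \<rho>) powr \<alpha>)" if "z \<in> ball c \<rho> - (ball w' \<rho> - {w'})" for z
    proof (cases "z = w'")
      case False
      then have "\<rho> \<le> norm (z - w')" using that by (auto simp: dist_norm norm_minus_commute)
      then show ?thesis unfolding f_def using \<rho> \<alpha> False
        by (intro ennreal_leI powr_mono2 divide_left_mono) auto
    qed (use \<rho> in \<open>simp add: f_def\<close>)
    show "ennreal ((d / \<rho>) powr \<alpha>) \<le> f z" if "z \<in> ball w' \<rho> - {w'} - ball c \<rho>" for z
      using that \<rho> \<alpha> unfolding f_def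
      by (intro ennreal_leI powr_mono2 divide_left_mono) (auto simp: dist_norm norm_minus_commute)
  qed auto
  also have "\<dots> \<le> (\<integral>\<^sup>+z\<in>ball w' \<rho>. f z \<partial>lborel)"
    by (intro nn_set_integral_set_mono) auto
  also have "\<dots> \<le> ennreal (2 * pi * \<rho>\<^sup>2 * (d / \<rho>) powr \<alpha> / (2 - \<alpha>))"
    unfolding f_def using \<alpha> \<rho> by (intro nn_integral_disc_powr) auto
  also have "d / \<rho> = 2" using \<rho> by (simp add: d_def)
  finally show ?thesis by (simp add: \<rho>_def)
qed

lemma nn_integral_interval_powr:
  assumes \<alpha>: "0 < \<alpha>" "\<alpha> < 1" and l: "l > 0" and K: "K > 0"
  shows "(\<integral>\<^sup>+x\<in>{e - l..e + l}. ennreal ((K / \<bar>x - e\<bar>) powr \<alpha>) \<partial>lborel)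
    \<le> ennreal (2 * (K powr \<alpha> * (l powr (1 - \<alpha>) / (1 - \<alpha>))))"
proof -
  define h where "h = (\<lambda>x::real. ennreal (K powr \<alpha>) * (ennreal (x powr (- \<alpha>)) * indicator {0..l} x))"
  have [measurable]: "h \<in> borel_measurable borel" unfolding h_def by measurable
  have h_int: "(\<integral>\<^sup>+x. h x \<partial>lborel) = ennreal (K powr \<alpha> * (l powr (1 - \<alpha>) / (1 - \<alpha>)))"
    unfolding h_def using nn_integral_powr_from_0[of "- \<alpha>" l] \<alpha> l
    by (subst nn_integral_cmult) (auto simp flip: ennreal_mult)
  have "(\<integral>\<^sup>+x\<in>{e - l..e + l}. ennreal ((K / \<bar>x - e\<bar>) powr \<alpha>) \<partial>lborel)
      = (\<integral>\<^sup>+x\<in>{- l..l}. ennreal ((K / \<bar>x\<bar>) powr \<alpha>) \<partial>lborel)"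
    using nn_integral_lborel_shift[of "\<lambda>x. ennreal ((K / \<bar>x - e\<bar>) powr \<alpha>) * indicator {e - l..e + l} x" e]
    by (simp add: indicator_def)
  also have "\<dots> \<le> (\<integral>\<^sup>+x. h x + h (0 - x) \<partial>lborel)"
  proof (intro nn_integral_mono_AE eventually_mono[OF AE_lborel_singleton[of 0]])
    fix x :: real assume "x \<noteq> 0"
    have eq: "ennreal ((K / \<bar>x\<bar>) powr \<alpha>) = ennreal (K powr \<alpha>) * ennreal (\<bar>x\<bar> powr (- \<alpha>))"
    proof -
      have "(K / \<bar>x\<bar>) powr \<alpha> = K powr \<alpha> * \<bar>x\<bar> powr (- \<alpha>)"
        using K by (simp add: powr_divide powr_minus_divide)
      then show ?thesis by (simp add: ennreal_mult)
    qed
    show "ennreal ((K / \<bar>x\<bar>) powr \<alpha>) * indicator {- l..l} x \<le> h x + h (0 - x)"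
      unfolding eq h_def using \<open>x \<noteq> 0\<close> by (cases "x > 0") (auto split: split_indicator)
  qed
  also have "\<dots> = (\<integral>\<^sup>+x. h x \<partial>lborel) + (\<integral>\<^sup>+x. h (0 - x) \<partial>lborel)"
    by (rule nn_integral_add) measurable
  also have "(\<integral>\<^sup>+x. h (0 - x) \<partial>lborel) = (\<integral>\<^sup>+x. h x \<partial>lborel)"
    by (rule nn_integral_lborel_reflect) measurable
  finally show ?thesis
    using \<alpha> unfolding h_int by (simp flip: ennreal_plus)
qed

text \<open>As for discs, with one more step: taking real parts gives |x - e| <= |x + \<zeta> - w'|,
  so the singularity may be put on the real line, and the extremal interval is the one centred at
  it.\<close>

lemma nn_integral_interval_quotient_le:
  fixes \<zeta> w :: complex
  assumes \<alpha>: "0 < \<alpha>" "\<alpha> < 1" and ab: "a < b" and K: "K > 0" "\<And>x. a \<le> x \<Longrightarrow> x \<le> b \<Longrightarrow> norm (of_real x + \<zeta>) \<le> K"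
  shows "(\<integral>\<^sup>+x\<in>{a..b}. ennreal ((norm w / norm (of_real x + \<zeta> - w)) powr \<alpha>) \<partial>lborel)
    \<le> ennreal ((2 * K) powr \<alpha> * (b - a) powr (1 - \<alpha>) / (1 - \<alpha>))"
proof -
  define l where "l = (b - a) / 2"
  have l: "l > 0" using ab by (simp add: l_def)
  obtain w' where w': "\<And>z. norm z \<le> K \<Longrightarrow> norm w * norm (z - w') \<le> K * norm (z - w)"
    using inversion_quotient_le[OF K(1)] by blast
  define e where "e = Re (w' - \<zeta>)"
  define f where "f = (\<lambda>x. ennreal ((K / \<bar>x - e\<bar>) powr \<alpha>))"
  have [measurable]: "f \<in> borel_measurable borel" unfolding f_def by measurable
  have "(\<integral>\<^sup>+x\<in>{a..b}. ennreal ((norm w / norm (of_real x + \<zeta> - w)) powr \<alpha>) \<partial>lborel) \<le> (\<integral>\<^sup>+x\<in>{a..b}. f x \<partial>lborel)"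
  proof (intro nn_integral_mono_AE eventually_mono[OF AE_lborel_singleton[of e]])
    fix x assume "x \<noteq> e"
    have "(norm w / norm (of_real x + \<zeta> - w)) powr \<alpha> \<le> (K / \<bar>x - e\<bar>) powr \<alpha>" if "x \<in> {a..b}"
    proof -
      have dist: "\<bar>x - e\<bar> \<le> norm (of_real x + \<zeta> - w')"
        using abs_Re_le_cmod[of "of_real x + \<zeta> - w'"] by (simp add: e_def algebra_simps)
      have "(norm w / norm (of_real x + \<zeta> - w)) powr \<alpha> \<le> (K / norm (of_real x + \<zeta> - w')) powr \<alpha>"
        using that K \<alpha> dist \<open>x \<noteq> e\<close> by (intro powr_quotient_le w') auto
      also have "\<dots> \<le> (K / \<bar>x - e\<bar>) powr \<alpha>"
      proof -
        have "0 < \<bar>x - e\<bar>" using \<open>x \<noteq> e\<close> by simp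
        moreover from this have "0 < norm (of_real x + \<zeta> - w')" using dist by linarith
        ultimately have "0 < norm (of_real x + \<zeta> - w') * \<bar>x - e\<bar>" by (rule mult_pos_pos[rotated])
        then show ?thesis using dist K(1) \<alpha> by (intro powr_mono2 divide_left_mono) auto
      qed
      finally show ?thesis .
    qed
    then show "ennreal ((norm w / norm (of_real x + \<zeta> - w)) powr \<alpha>) * indicator {a..b} x \<le> f x * indicator {a..b} x"
      by (auto split: split_indicator simp: f_def intro: ennreal_leI)
  qed
  also have "\<dots> \<le> (\<integral>\<^sup>+x\<in>{e - l..e + l} - {e}. f x \<partial>lborel)"
  proof (rule nn_integral_rearrangement[where c="ennreal ((K / l) powr \<alpha>)"])
    have "emeasure lborel ({e - l..e + l} - {e}) = emeasure lborel {e - l..e + l}"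
      by (rule emeasure_Diff_null_set) (auto simp: null_sets_def)
    also have "\<dots> = ennreal (e + l - (e - l))" using l by (intro emeasure_lborel_Icc) simp
    also have "e + l - (e - l) = b - a" by (simp add: l_def)
    finally show "emeasure lborel {a..b} = emeasure lborel ({e - l..e + l} - {e})" "emeasure lborel ({e - l..e + l} - {e}) \<noteq> \<infinity>"
      using ab by simp_all
    show "f x \<le> ennreal ((K / l) powr \<alpha>)" if "x \<in> {a..b} - ({e - l..e + l} - {e})" for x
    proof (cases "x = e")
      case False
      then have "l \<le> \<bar>x - e\<bar>" using that by auto
      then show ?thesis unfolding f_def using l K \<alpha> False
        by (intro ennreal_leI powr_mono2 divide_left_mono) auto
    qed (use l in \<open>simp add: f_def\<close>)
    show "ennreal ((K / l) powr \<alpha>) \<le> f x" if "x \<in> {e - l..e + l} - {e} - {a..b}" for x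
      using that l K \<alpha> unfolding f_def
      by (intro ennreal_leI powr_mono2 divide_left_mono) auto
  qed auto
  also have "\<dots> \<le> (\<integral>\<^sup>+x\<in>{e - l..e + l}. f x \<partial>lborel)"
    by (intro nn_set_integral_set_mono) auto
  also have "\<dots> \<le> ennreal (2 * (K powr \<alpha> * (l powr (1 - \<alpha>) / (1 - \<alpha>))))"
    unfolding f_def using \<alpha> l K by (intro nn_integral_interval_powr) auto
  also have "2 * (K powr \<alpha> * (l powr (1 - \<alpha>) / (1 - \<alpha>))) = (2 * K) powr \<alpha> * (b - a) powr (1 - \<alpha>) / (1 - \<alpha>)"
  proof -
    have "l powr (1 - \<alpha>) = (b - a) powr (1 - \<alpha>) / 2 powr (1 - \<alpha>)"
      using ab by (simp add: l_def powr_divide)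
    also have "(2::real) powr (1 - \<alpha>) = 2 / 2 powr \<alpha>" by (simp add: powr_diff)
    finally show ?thesis using K by (simp add: powr_mult field_simps)
  qed
  finally show ?thesis .
qed

text \<open>Convexity of t -> b^t: the graph lies below its chord between t = 0 and t = 1.\<close>

lemma powr_le_chord:
  assumes "0 \<le> t" "t \<le> 1" "b > 0"
  shows "b powr t \<le> 1 + t * (b - 1::real)"
proof -
  have "convex_on UNIV (exp :: real \<Rightarrow> real)" by (rule exp_convex)
  from convex_onD[OF this assms(1,2), of 0 "ln b"] show ?thesis
    using assms by (simp add: powr_def algebra_simps)
qed

section \<open>Exponential bounds on discs and segments of a complex line\<close>

lemma line_lelong_measurable: "line_lelong u \<Longrightarrow> u \<in> borel_measurable borel"
  by (simp add: line_lelong_def upper_semicontinuous_measurable)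

text \<open>The kernel integral gives the factor 2 * 2^\<alpha>/(2 - \<alpha>). The chord bound
  2^\<alpha> = 4^(\<alpha>/2) <= 1 + 3\<alpha>/2 makes it at most (2 + 3\<alpha>)/(2 - \<alpha>) = 1
  + 4\<alpha>/(2 - \<alpha>), which separates the area of the disc from an excess that vanishes with
  \<alpha>.\<close>

lemma disc_exp_integral_le:
  assumes u: "line_lelong u" "u 0 \<noteq> - \<infinity>" and \<alpha>: "0 < \<alpha>" "\<alpha> < 2" and c: "c \<noteq> 0"
  shows "(\<integral>\<^sup>+z\<in>ball c (norm c). exp_ereal (ereal \<alpha> * (u 0 - u z)) \<partial>lborel)
    \<le> ennreal (pi * (norm c)\<^sup>2 * (1 + 4 * (\<alpha> / (2 - \<alpha>))))"
proof -
  note [measurable] = line_lelong_measurable[OF u(1)]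
  define \<nu> where "\<nu> = density lborel (indicator (ball c (norm c)) :: complex \<Rightarrow> ennreal)"
  have \<nu>: "(\<integral>\<^sup>+z. g z \<partial>\<nu>) = (\<integral>\<^sup>+z\<in>ball c (norm c). g z \<partial>lborel)" if [measurable]: "g \<in> borel_measurable borel" for g
    unfolding \<nu>_def by (subst nn_integral_density) (auto simp: mult.commute)
  have sp: "space \<nu> = UNIV" by (simp add: \<nu>_def)
  have e: "emeasure \<nu> UNIV = ennreal (pi * (norm c)\<^sup>2)"
    by (simp add: \<nu>_def emeasure_density emeasure_ball_complex)
  have "(2::real) powr \<alpha> = (2 powr 2) powr (\<alpha> / 2)" by (simp only: powr_powr) simp
  also have "(2::real) powr 2 = 4" by simp
  also have "4 powr (\<alpha> / 2) \<le> 1 + \<alpha> / 2 * (4 - 1)" using \<alpha> by (intro powr_le_chord) auto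
  finally have "2 * 2 powr \<alpha> / (2 - \<alpha>) \<le> (2 + 3 * \<alpha>) / (2 - \<alpha>)"
    using \<alpha> by (intro divide_right_mono) auto
  also have "\<dots> = 1 + 4 * (\<alpha> / (2 - \<alpha>))" using \<alpha> by (simp add: field_simps)
  finally have "pi * (norm c)\<^sup>2 * (2 * 2 powr \<alpha> / (2 - \<alpha>)) \<le> pi * (norm c)\<^sup>2 * (1 + 4 * (\<alpha> / (2 - \<alpha>)))"
    by (intro mult_left_mono) auto
  then have S: "2 * pi * (norm c)\<^sup>2 * 2 powr \<alpha> / (2 - \<alpha>) \<le> pi * (norm c)\<^sup>2 * (1 + 4 * (\<alpha> / (2 - \<alpha>)))"
    by (simp add: mult_ac)
  have "(\<integral>\<^sup>+z. exp_ereal (ereal \<alpha> * (u 0 - u z)) \<partial>\<nu>) \<le> ennreal (pi * (norm c)\<^sup>2 * (1 + 4 * (\<alpha> / (2 - \<alpha>))))"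
  proof (rule line_lelong_exp_integral_le[where K="2 * norm c", OF u _ _ _ \<alpha>(1)])
    show "finite_measure \<nu>"
      by (rule finite_measureI) (simp add: sp e)
    show "sets \<nu> = sets borel" by (simp add: \<nu>_def)
    show "AE z in \<nu>. norm z \<le> 2 * norm c"
      unfolding \<nu>_def
    proof (subst AE_density)
      show "AE z in lborel. 0 < (indicator (ball c (norm c)) z :: ennreal) \<longrightarrow> norm z \<le> 2 * norm c"
      proof (rule AE_I2, rule impI)
        fix z assume "0 < (indicator (ball c (norm c)) z :: ennreal)"
        then have "norm (z - c) < norm c" by (auto split: split_indicator_asm simp: dist_norm norm_minus_commute)
        then show "norm z \<le> 2 * norm c" using norm_triangle_ineq2[of z c] by simp
      qed
    qed measurable
    show "(\<integral>\<^sup>+z. ennreal ((norm w / norm (z - w)) powr \<alpha>) \<partial>\<nu>) \<le> ennreal (pi * (norm c)\<^sup>2 * (1 + 4 * (\<alpha> / (2 - \<alpha>))))" for w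
      using nn_integral_disc_quotient_le[OF \<alpha> c, of w] S
      by (subst \<nu>) (auto intro: order_trans ennreal_leI)
    have "pi * (norm c)\<^sup>2 * 1 \<le> pi * (norm c)\<^sup>2 * (1 + 4 * (\<alpha> / (2 - \<alpha>)))"
      using \<alpha> by (intro mult_left_mono) auto
    then show "emeasure \<nu> UNIV \<le> ennreal (pi * (norm c)\<^sup>2 * (1 + 4 * (\<alpha> / (2 - \<alpha>))))"
      unfolding e by (intro ennreal_leI) simp
  qed
  then show ?thesis by (subst (asm) \<nu>) measurable
qed

text \<open>The general estimate for the image of Lebesgue measure on [a, b] under x -> x + \<zeta>.
  A general \<open>\<zeta>\<close> admits segments that avoid the base point 0, as
  \<open>exists_finite_on_segment\<close> needs.\<close>

lemma segment_exp_integral_le: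
  assumes u: "line_lelong u" "u 0 \<noteq> - \<infinity>" and \<alpha>: "0 < \<alpha>" "\<alpha> < 1" and ab: "a < b"
    and K: "K > 0" "\<And>x. a \<le> x \<Longrightarrow> x \<le> b \<Longrightarrow> norm (of_real x + \<zeta>) \<le> K"
    and S: "(2 * K) powr \<alpha> * (b - a) powr (1 - \<alpha>) / (1 - \<alpha>) \<le> S" "b - a \<le> S"
  shows "(\<integral>\<^sup>+x\<in>{a..b}. exp_ereal (ereal \<alpha> * (u 0 - u (of_real x + \<zeta>))) \<partial>lborel) \<le> ennreal S"
proof -
  note [measurable] = line_lelong_measurable[OF u(1)]
  define \<mu> where "\<mu> = density lborel (indicator {a..b} :: real \<Rightarrow> ennreal)"
  define \<nu> where "\<nu> = distr \<mu> borel (\<lambda>x. complex_of_real x + \<zeta>)"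
  have [measurable_cong]: "sets \<mu> = sets borel" by (simp add: \<mu>_def)
  have \<nu>: "(\<integral>\<^sup>+z. g z \<partial>\<nu>) = (\<integral>\<^sup>+x\<in>{a..b}. g (of_real x + \<zeta>) \<partial>lborel)" if [measurable]: "g \<in> borel_measurable borel" for g
    unfolding \<nu>_def \<mu>_def by (simp add: nn_integral_distr nn_integral_density mult.commute)
  have e: "emeasure \<nu> UNIV = ennreal (b - a)"
    using ab \<nu>[of "\<lambda>_. 1"] by (simp add: \<nu>_def)
  have "(\<integral>\<^sup>+z. exp_ereal (ereal \<alpha> * (u 0 - u z)) \<partial>\<nu>) \<le> ennreal S"
  proof (rule line_lelong_exp_integral_le[where K=K, OF u _ _ _ \<alpha>(1)])
    show "finite_measure \<nu>"
      using e by (intro finite_measureI) (simp add: \<nu>_def)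
    show "sets \<nu> = sets borel" by (simp add: \<nu>_def)
    show "AE z in \<nu>. norm z \<le> K"
    proof -
      have "AE x in lborel. 0 < (indicator {a..b} x :: ennreal) \<longrightarrow> norm (complex_of_real x + \<zeta>) \<le> K"
        using K by (auto split: split_indicator)
      then have "AE x in \<mu>. norm (complex_of_real x + \<zeta>) \<le> K"
        unfolding \<mu>_def by (subst AE_density) measurable
      then show ?thesis unfolding \<nu>_def by (subst AE_distr_iff) measurable
    qed
    show "(\<integral>\<^sup>+z. ennreal ((norm w / norm (z - w)) powr \<alpha>) \<partial>\<nu>) \<le> ennreal S" for w
      using nn_integral_interval_quotient_le[OF \<alpha> ab K, of w] S(1)
      by (subst \<nu>) (auto intro: order_trans ennreal_leI)
    show "emeasure \<nu> UNIV \<le> ennreal S" unfolding e using S(2) by (rule ennreal_leI)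
  qed
  then show ?thesis by (subst (asm) \<nu>) measurable
qed

text \<open>With 2^\<alpha> <= 1 + \<alpha> the segment estimate gives 1 + 2\<alpha>/(1 - \<alpha>);
  the 2 is relaxed to the 8 of the final bound.\<close>

lemma interval_exp_integral_le:
  assumes u: "line_lelong u" "u 0 \<noteq> - \<infinity>" and \<alpha>: "0 < \<alpha>" "\<alpha> < 1" and L: "L > 0"
  shows "(\<integral>\<^sup>+x\<in>{0..L}. exp_ereal (ereal \<alpha> * (u 0 - u (of_real x))) \<partial>lborel)
    \<le> ennreal (L * (1 + 8 * (\<alpha> / (1 - \<alpha>))))"
proof -
  have "(2 * L) powr \<alpha> * (L - 0) powr (1 - \<alpha>) / (1 - \<alpha>) = L * (2 powr \<alpha> / (1 - \<alpha>))"
    using L by (simp add: powr_mult powr_diff)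
  also have "\<dots> \<le> L * ((1 + \<alpha> * (2 - 1)) / (1 - \<alpha>))"
    using L \<alpha> powr_le_chord[of \<alpha> 2] by (intro mult_left_mono divide_right_mono) auto
  also have "(1 + \<alpha> * (2 - 1)) / (1 - \<alpha>) = 1 + 2 * (\<alpha> / (1 - \<alpha>))" using \<alpha> by (simp add: field_simps)
  also have "L * (1 + 2 * (\<alpha> / (1 - \<alpha>))) \<le> L * (1 + 8 * (\<alpha> / (1 - \<alpha>)))"
    using L \<alpha> by (intro mult_left_mono add_left_mono mult_right_mono) auto
  finally have 1: "(2 * L) powr \<alpha> * (L - 0) powr (1 - \<alpha>) / (1 - \<alpha>) \<le> L * (1 + 8 * (\<alpha> / (1 - \<alpha>)))" .
  have 2: "L - 0 \<le> L * (1 + 8 * (\<alpha> / (1 - \<alpha>)))"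
    using L \<alpha> by (simp add: distrib_left)
  show ?thesis
    using segment_exp_integral_le[OF u \<alpha> L L _ 1 2, of 0] by simp
qed

text \<open>Were u equal to -\<infinity> on the whole segment, the exponential integral with
  exponent 1/2 would be infinite, against \<open>segment_exp_integral_le\<close>.\<close>

lemma exists_finite_on_segment:
  assumes u: "line_lelong u" "u 0 \<noteq> - \<infinity>" and \<eta>: "\<eta> > 0"
  obtains x where "\<bar>x\<bar> \<le> \<eta>" "u (of_real x + \<zeta>) \<noteq> - \<infinity>"
proof -
  have "\<exists>x. \<bar>x\<bar> \<le> \<eta> \<and> u (of_real x + \<zeta>) \<noteq> - \<infinity>"
  proof (rule ccontr)
    assume *: "\<not> ?thesis"
    then have inf: "u (of_real x + \<zeta>) = - \<infinity>" if "\<bar>x\<bar> \<le> \<eta>" for x using that by blast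
    define K where "K = \<eta> + norm \<zeta>"
    define S where "S = max ((2 * K) powr (1/2) * (\<eta> - (- \<eta>)) powr (1 - 1/2) / (1 - 1/2)) (\<eta> - (- \<eta>))"
    have "(\<integral>\<^sup>+x\<in>{- \<eta>..\<eta>}. exp_ereal (ereal (1/2) * (u 0 - u (of_real x + \<zeta>))) \<partial>lborel) \<le> ennreal S"
    proof (rule segment_exp_integral_le[OF u])
      show "K > 0" using \<eta> norm_ge_zero[of \<zeta>] unfolding K_def by linarith
      show "norm (of_real x + \<zeta>) \<le> K" if "- \<eta> \<le> x" "x \<le> \<eta>" for x
        using that norm_triangle_ineq[of "complex_of_real x" \<zeta>] by (simp add: K_def abs_le_iff)
    qed (use \<eta> in \<open>auto simp: S_def\<close>)
    moreover have "(\<integral>\<^sup>+x\<in>{- \<eta>..\<eta>}. exp_ereal (ereal (1/2) * (u 0 - u (of_real x + \<zeta>))) \<partial>lborel)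
        = (\<integral>\<^sup>+x\<in>{- \<eta>..\<eta>}. top \<partial>lborel)"
    proof (intro nn_integral_cong)
      fix x
      have "exp_ereal (ereal (1/2) * (u 0 - u (of_real x + \<zeta>))) = top" if "\<bar>x\<bar> \<le> \<eta>"
        using inf[OF that] u(2) by (cases "u 0") (auto simp: exp_ereal_def)
      then show "exp_ereal (ereal (1/2) * (u 0 - u (of_real x + \<zeta>))) * indicator {- \<eta>..\<eta>} x = top * indicator {- \<eta>..\<eta>} x"
        by (auto split: split_indicator)
    qed
    moreover have "\<dots> = top" using \<eta> by (subst nn_integral_cmult_indicator) (auto simp: ennreal_top_mult)
    ultimately show False by (simp add: top_unique)
  qed
  then obtain x where "\<bar>x\<bar> \<le> \<eta>" "u (of_real x + \<zeta>) \<noteq> - \<infinity>" by (elim exE conjE)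
  then show ?thesis by (rule that)
qed

section \<open>Generic subspaces\<close>

lemma vector_scalar_mult_eq_scaleR: "(c::complex) *s (v::complex^'n) = Re c *\<^sub>R v + Im c *\<^sub>R (\<i> *s v)"
  by (simp add: vec_eq_iff complex_eq_iff)

lemma of_real_scalar_mult: "complex_of_real c *s (v::complex^'n) = c *\<^sub>R v"
  by (simp add: vec_eq_iff complex_eq_iff)

lemma linear_vector_scalar_mult: "linear (\<lambda>v::complex^'n. c *s v)"
  by (auto simp: linear_iff vec_eq_iff algebra_simps)

text \<open>Multiplication by \<i> permutes the generators on the right up to sign, so their real
  span is already a complex subspace.\<close>

lemma complex_span_subset: "vec.span (S :: (complex^'n) set) \<subseteq> span (S \<union> (\<lambda>z. \<i> *s z) ` S)"
proof (rule vec.span_minimal)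
  let ?X = "S \<union> (\<lambda>z. \<i> *s z) ` S"
  show "S \<subseteq> span ?X" using span_superset by blast
  have "(\<lambda>z. \<i> *s z) ` span ?X = span ((\<lambda>z. \<i> *s z) ` ?X)"
    by (rule linear_span_image[symmetric, OF linear_vector_scalar_mult])
  also have "\<dots> \<subseteq> span ?X"
  proof (rule span_minimal)
    show "(\<lambda>z. \<i> *s z) ` ?X \<subseteq> span ?X"
    proof
      fix y assume "y \<in> (\<lambda>z. \<i> *s z) ` ?X"
      then consider z where "z \<in> S" "y = \<i> *s z" | z where "z \<in> S" "y = \<i> *s (\<i> *s z)" by blast
      then show "y \<in> span ?X"
      proof cases
        case 1 then show ?thesis by (intro span_base) blast
      next
        case 2
        then have "y = - z" by (simp add: vec_eq_iff)
        then show ?thesis using 2 by (simp add: span_neg span_base)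
      qed
    qed
  qed simp
  finally have sub: "(\<lambda>z. \<i> *s z) ` span ?X \<subseteq> span ?X" .
  have i: "\<i> *s z \<in> span ?X" if "z \<in> span ?X" for z
    by (rule subsetD[OF sub imageI[OF that]])
  show "vec.subspace (span ?X)"
    unfolding vec.subspace_def
  proof (intro conjI ballI allI)
    show "c *s z \<in> span ?X" if "z \<in> span ?X" for c z
      unfolding vector_scalar_mult_eq_scaleR[of c] by (intro span_add span_scale that i)
    show "x + y \<in> span ?X" if "x \<in> span ?X" "y \<in> span ?X" for x y
      using that by (rule span_add)
  qed (rule span_zero)
qed

lemma complex_subspace_imp_subspace:
  assumes "vec.subspace (W :: (complex^'n) set)" shows "subspace W"
proof (rule subspaceI)
  show "c *\<^sub>R x \<in> W" if "x \<in> W" for c x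
    using vec.subspace_scale[OF assms that, of "of_real c"] by (simp only: of_real_scalar_mult)
qed (rule vec.subspace_0[OF assms], rule vec.subspace_add[OF assms])

lemma dim_complex_span_le:
  assumes "finite B" shows "dim (vec.span (B :: (complex^'n) set)) \<le> 2 * card B"
proof -
  have "dim (vec.span B) \<le> card (B \<union> (\<lambda>z. \<i> *s z) ` B)"
    using assms by (intro dim_le_card complex_span_subset) auto
  also have "\<dots> \<le> card B + card ((\<lambda>z. \<i> *s z) ` B)" by (rule card_Un_le)
  also have "\<dots> \<le> 2 * card B" using card_image_le[OF assms, of "\<lambda>z. \<i> *s z"] by simp
  finally show ?thesis .
qed

text \<open>A complex basis and its multiple by \<i> span over the reals, which gives one
  inequality. For the other, the same inequality is applied to the span of the vectors that extend
  the basis, the total real dimension being 2n.\<close>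

lemma dim_complex_subspace:
  assumes W: "vec.subspace (W :: (complex^'n) set)"
  shows "dim W = 2 * vec.dim W"
proof (rule antisym)
  obtain B where B: "B \<subseteq> W" "vec.independent B" "W \<subseteq> vec.span B" "card B = vec.dim W"
    using vec.basis_exists by blast
  have fB: "finite B" using B(2) by (rule vec.finiteI_independent)
  have WB: "W = vec.span B" by (rule subset_antisym[OF B(3) vec.span_minimal[OF B(1) W]])
  show "dim W \<le> 2 * vec.dim W" using dim_complex_span_le[OF fB] WB B(4) by simp
  define B' where "B' = vec.extend_basis B"
  have B': "B \<subseteq> B'" "vec.independent B'" "vec.span B' = UNIV"
    using vec.extend_basis_superset[OF B(2)] vec.independent_extend_basis[OF B(2)] vec.span_extend_basis[OF B(2)]
    unfolding B'_def by auto
  have fB': "finite B'" using B'(2) by (rule vec.finiteI_independent)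
  have cB': "card B' = CARD('n)"
  proof -
    have "vec.span B' = vec.span UNIV" by (simp only: B'(3) vec.span_UNIV)
    then have "vec.dim (UNIV :: (complex^'n) set) = card B'" using B'(2) by (rule vec.dim_eq_card)
    then show ?thesis by (simp only: vec_dim_card)
  qed
  let ?E = "vec.span (B' - B)"
  have sW: "subspace W" "subspace ?E"
    by (rule complex_subspace_imp_subspace, rule W vec.subspace_span)+
  have "{x + y | x y. x \<in> W \<and> y \<in> ?E} = UNIV"
  proof -
    have "B \<union> (B' - B) = B'" using B'(1) by auto
    then have "vec.span (B \<union> (B' - B)) = UNIV" using B'(3) by simp
    then show ?thesis unfolding vec.span_Un WB[symmetric] .
  qed
  then have "dim (UNIV :: (complex^'n) set) + dim (W \<inter> ?E) = dim W + dim ?E"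
    using dim_sums_Int[OF sW] by simp
  then have "2 * CARD('n) \<le> dim W + dim ?E" by simp
  also have "dim ?E \<le> 2 * card (B' - B)" using fB' by (intro dim_complex_span_le) simp
  also have "card (B' - B) = CARD('n) - vec.dim W"
    using fB B'(1) cB' B(4) by (simp add: card_Diff_subset)
  finally show "2 * vec.dim W \<le> dim W"
    using card_mono[OF fB' B'(1)] cB' B(4) by simp
qed

text \<open>The dimension formula for sum and intersection reads 2n + 2m = 2 dim G, since the sum is
  the whole space and the intersection is a complex subspace.\<close>

lemma dim_generic_subspace:
  assumes G: "generic_subspace (G :: (complex^'n) set)" and m: "complex_dim G = m"
  shows "dim G = CARD('n) + m"
proof -
  let ?i = "\<lambda>z::complex^'n. \<i> *s z"
  have sG: "subspace G" and sum: "{x + y | x y. x \<in> G \<and> y \<in> ?i ` G} = UNIV"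
    using G by (auto simp: generic_subspace_def)
  have siG: "subspace (?i ` G)" using sG linear_vector_scalar_mult linear_subspace_image by blast
  have inj: "inj ?i" by (rule injI) (auto simp: vec_eq_iff)
  have dimi: "dim (?i ` G) = dim G"
    by (intro dim_image_eq linear_vector_scalar_mult inj_on_subset[OF inj]) auto
  have "dim (UNIV :: (complex^'n) set) + dim (G \<inter> ?i ` G) = dim G + dim (?i ` G)"
    using dim_sums_Int[OF sG siG] sum by simp
  then have "2 * CARD('n) + dim (G \<inter> ?i ` G) = 2 * dim G" using dimi by simp
  moreover have "dim (G \<inter> ?i ` G) = 2 * vec.dim (G \<inter> ?i ` G)"
  proof (rule dim_complex_subspace)
    have s: "subspace (G \<inter> ?i ` G)" using sG siG by (rule subspace_inter)
    have i: "?i z \<in> G \<inter> ?i ` G" if z: "z \<in> G \<inter> ?i ` G" for z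
    proof -
      obtain y where y: "y \<in> G" "z = ?i y" using z by blast
      have "?i z = - y" by (simp add: y vec_eq_iff)
      then have "?i z \<in> G" using y sG by (simp add: subspace_neg)
      then show ?thesis using z by blast
    qed
    show "vec.subspace (G \<inter> ?i ` G)"
      unfolding vec.subspace_def
    proof (intro conjI ballI allI)
      show "0 \<in> G \<inter> ?i ` G" using s by (rule subspace_0)
      show "x + y \<in> G \<inter> ?i ` G" if "x \<in> G \<inter> ?i ` G" "y \<in> G \<inter> ?i ` G" for x y
        using s that by (rule subspace_add)
      show "c *s z \<in> G \<inter> ?i ` G" if "z \<in> G \<inter> ?i ` G" for c z
        unfolding vector_scalar_mult_eq_scaleR[of c] by (intro subspace_add subspace_scale s that i)
    qed
  qed
  ultimately show ?thesis using m by (simp add: complex_dim_def)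
qed

text \<open>Lets the argument that balls in generic subspaces are not pluripolar serve ordinary
  balls as well.\<close>

lemma generic_subspace_UNIV: "generic_subspace (UNIV :: (complex^'n) set)"
proof -
  have "\<exists>x y. z = x + y \<and> x \<in> UNIV \<and> y \<in> range (\<lambda>v. \<i> *s v)" for z :: "complex^'n"
    by (intro exI[of _ z] exI[of _ 0]) (auto intro: image_eqI[of _ _ 0])
  then show ?thesis unfolding generic_subspace_def by auto
qed

lemma generic_complex_span:
  assumes "generic_subspace (G :: (complex^'n) set)" shows "vec.span G = UNIV"
proof -
  have "x + \<i> *s y \<in> vec.span G" if "x \<in> G" "y \<in> G" for x y
    using that by (intro vec.span_add vec.span_scale vec.span_base)
  then have "{x + y | x y. x \<in> G \<and> y \<in> (\<lambda>z. \<i> *s z) ` G} \<subseteq> vec.span G" by blast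
  then show ?thesis using assms by (auto simp: generic_subspace_def)
qed

text \<open>Balls in a generic subspace are not pluripolar: the coordinates of a point where \<open>u\<close> is finite, with
  respect to a complex basis contained in \<open>G\<close>, are replaced one by one by small real numbers.\<close>

lemma lelong_finite_on_generic_ball:
  assumes G: "generic_subspace (G :: (complex^'n) set)" and u: "u \<in> lelong_class" and a: "a \<in> G" and r: "r > 0"
  obtains z where "z \<in> ball a r" "z \<in> G" "u z \<noteq> - \<infinity>"
proof -
  obtain B where B: "B \<subseteq> G" "vec.independent B" "G \<subseteq> vec.span B"
    using vec.maximal_independent_subset by blast
  have fB: "finite B" using B(2) by (rule vec.finiteI_independent)
  have spB: "vec.span B = UNIV"
    using vec.span_mono[OF B(3)] generic_complex_span[OF G] by (auto simp: vec.span_span)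
  obtain p where p: "u p \<noteq> - \<infinity>" using u by (auto simp: lelong_class_def)
  have "p - a \<in> vec.span B" by (simp add: spB)
  then obtain \<zeta>0 where \<zeta>0: "p - a = (\<Sum>b\<in>B. \<zeta>0 b *s b)" using vec.span_finite[OF fB] by auto
  \<comment> \<open>Real coordinates of modulus at most \<open>\<eta>\<close> give a combination of
    the basis vectors of norm less than r.\<close>
  define \<eta> where "\<eta> = r / (1 + (\<Sum>b\<in>B. norm b))"
  have S0: "(\<Sum>b\<in>B. norm b) \<ge> 0" by (intro sum_nonneg) auto
  then have \<eta>: "\<eta> > 0" using r by (simp add: \<eta>_def)
  have "\<exists>\<zeta>. (\<forall>b\<in>F. \<exists>x. \<zeta> b = of_real x \<and> \<bar>x\<bar> \<le> \<eta>) \<and> u (a + (\<Sum>b\<in>B. \<zeta> b *s b)) \<noteq> - \<infinity>"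
    if "F \<subseteq> B" for F
    using finite_subset[OF that fB] that
  proof (induction F rule: finite_induct)
    case empty
    have "u (a + (\<Sum>b\<in>B. \<zeta>0 b *s b)) \<noteq> - \<infinity>" using p unfolding \<zeta>0[symmetric] by simp
    then show ?case by blast
  next
    case (insert b0 F)
    then obtain \<zeta> where \<zeta>: "\<forall>b\<in>F. \<exists>x. \<zeta> b = of_real x \<and> \<bar>x\<bar> \<le> \<eta>" "u (a + (\<Sum>b\<in>B. \<zeta> b *s b)) \<noteq> - \<infinity>"
      by auto
    let ?q = "a + (\<Sum>b\<in>B. \<zeta> b *s b)"
    \<comment> \<open>On the line through \<open>?q\<close> in direction \<open>b0\<close>, the
      parameter \<open>of_real x + (- \<zeta> b0)\<close> cancels the old coordinate and puts the
      real number x in its place.\<close>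
    obtain x where x: "\<bar>x\<bar> \<le> \<eta>" "u (?q + (of_real x + (- \<zeta> b0)) *s b0) \<noteq> - \<infinity>"
    proof (rule exists_finite_on_segment[OF lelong_class_line[OF u, of ?q b0] _ \<eta>, of "- \<zeta> b0"])
      show "u (?q + 0 *s b0) \<noteq> - \<infinity>" using \<zeta>(2) by simp
    qed
    have "(\<Sum>b\<in>B. (\<zeta>(b0 := of_real x)) b *s b) = of_real x *s b0 + (\<Sum>b\<in>B - {b0}. \<zeta> b *s b)"
      using insert.prems fB by (subst sum.remove[of B b0]) (auto intro!: sum.cong)
    moreover have "(\<Sum>b\<in>B. \<zeta> b *s b) = \<zeta> b0 *s b0 + (\<Sum>b\<in>B - {b0}. \<zeta> b *s b)"
      using insert.prems fB by (subst sum.remove[of B b0]) auto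
    ultimately have E: "a + (\<Sum>b\<in>B. (\<zeta>(b0 := of_real x)) b *s b) = ?q + (of_real x + (- \<zeta> b0)) *s b0"
      by (simp add: vec.scale_left_distrib)
    have "u (a + (\<Sum>b\<in>B. (\<zeta>(b0 := of_real x)) b *s b)) \<noteq> - \<infinity>" unfolding E by (rule x(2))
    then show ?case using \<zeta>(1) x(1) by (intro exI[of _ "\<zeta>(b0 := of_real x)"]) auto
  qed
  from this[of B] obtain \<zeta> where \<zeta>: "\<forall>b\<in>B. \<exists>x. \<zeta> b = of_real x \<and> \<bar>x\<bar> \<le> \<eta>" "u (a + (\<Sum>b\<in>B. \<zeta> b *s b)) \<noteq> - \<infinity>"
    by auto
  then obtain x where x: "\<And>b. b \<in> B \<Longrightarrow> \<zeta> b = of_real (x b)" "\<And>b. b \<in> B \<Longrightarrow> \<bar>x b\<bar> \<le> \<eta>" by metis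
  have eq: "(\<Sum>b\<in>B. \<zeta> b *s b) = (\<Sum>b\<in>B. x b *\<^sub>R b)"
    using x(1) by (intro sum.cong) (auto simp: of_real_scalar_mult)
  have sG: "subspace G" using G by (simp add: generic_subspace_def)
  show ?thesis
  proof (rule that)
    show "u (a + (\<Sum>b\<in>B. x b *\<^sub>R b)) \<noteq> - \<infinity>" using \<zeta>(2) eq by simp
    show "a + (\<Sum>b\<in>B. x b *\<^sub>R b) \<in> G"
      using sG a B(1) by (intro subspace_add subspace_sum subspace_scale) auto
    have "norm (\<Sum>b\<in>B. x b *\<^sub>R b) \<le> (\<Sum>b\<in>B. \<eta> * norm b)"
      using x(2) by (intro sum_norm_le) (auto intro!: mult_right_mono)
    also have "\<dots> = r * (\<Sum>b\<in>B. norm b) / (1 + (\<Sum>b\<in>B. norm b))"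
      by (simp add: \<eta>_def sum_distrib_left sum_divide_distrib)
    also have "\<dots> < r" using r S0 by (simp add: field_simps)
    finally show "a + (\<Sum>b\<in>B. x b *\<^sub>R b) \<in> ball a r" by (simp add: dist_norm)
  qed
qed

section \<open>Maximum points of plurisubharmonic functions on balls\<close>

text \<open>Without a maximum the open sets {u < u y}, y in K, would cover K; in a finite subcover
  the y with the largest value of u would remain uncovered.\<close>

lemma upper_semicontinuous_attains_sup:
  assumes u: "upper_semicontinuous u" and K: "compact K" "K \<noteq> {}"
  obtains x where "x \<in> K" "\<And>y. y \<in> K \<Longrightarrow> u y \<le> u x"
proof (rule ccontr)
  assume "\<not> thesis"
  then have "\<forall>x\<in>K. \<exists>y\<in>K. u x < u y" using that by (metis not_le)
  then have cover: "K \<subseteq> (\<Union>y\<in>K. {x. u x < u y})" by auto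
  have op: "open {x. u x < u y}" for y using u by (simp add: upper_semicontinuous_def)
  obtain Y where Y: "Y \<subseteq> K" "finite Y" "K \<subseteq> (\<Union>y\<in>Y. {x. u x < u y})"
    using op by (rule compactE_image[OF K(1) _ cover])
  have "Y \<noteq> {}" using K(2) Y(3) by auto
  then have "Max (u ` Y) \<in> u ` Y" using Y(2) by (intro Max_in) auto
  then obtain y where y: "y \<in> Y" "Max (u ` Y) = u y" by (elim imageE)
  have "u y' \<le> u y" if "y' \<in> Y" for y' using Max_ge[of "u ` Y" "u y'"] Y(2) that y(2) by simp
  moreover obtain y' where "y' \<in> Y" "u y < u y'"
    using subsetD[OF Y(3) subsetD[OF Y(1) y(1)]] by (elim UN_E) simp
  ultimately show False by (simp add: leD)
qed

text \<open>Equality in the sub-mean inequality: the nonnegative function M - u has integral at most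
  0 over the circle, so it vanishes almost everywhere.\<close>

lemma psh_max_propagates:
  assumes u: "plurisubharmonic u" and M: "u a = ereal M" "\<And>t. u (a + cis t *s b) \<le> ereal M"
  shows "AE t in lborel. t \<in> {0..2 * pi} \<longrightarrow> u (a + cis t *s b) = ereal M"
proof -
  define g where "g = (\<lambda>t. u (a + cis t *s b))"
  have usc: "upper_semicontinuous u" and mean: "u a \<le> ereal_mean lborel {0..2 * pi} g"
    using u by (auto simp: plurisubharmonic_def g_def)
  have [measurable]: "u \<in> borel_measurable borel" using usc by (rule upper_semicontinuous_measurable)
  have [measurable]: "(\<lambda>t. a + cis t *s b) \<in> borel_measurable borel"
    by (intro borel_measurable_continuous_onI continuous_intros continuous_on_compose2[OF continuous_on_vector_scalar_mult[of UNIV]]) auto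
  have [measurable]: "g \<in> borel_measurable borel" unfolding g_def by measurable
  have gM: "g t \<le> ereal M" for t using M(2) by (simp add: g_def)
  \<comment> \<open>\<open>ereal_mean_circle_le\<close> asks for a nonnegative bound, but M may be
    negative; the constant H - M is cancelled afterwards.\<close>
  define H where "H = max 0 M"
  have HM: "M \<le> H" by (simp add: H_def)
  have gH: "g t \<le> ereal H" for t unfolding g_def by (rule order_trans[OF M(2)]) (simp add: H_def)
  have "(\<integral>\<^sup>+t\<in>{0..2 * pi}. e2ennreal (ereal H - g t) \<partial>lborel) \<le> ennreal (2 * pi) * e2ennreal (ereal H - u a)"
    using gH mean M(1) by (intro ereal_mean_circle_le) (auto simp: H_def)
  moreover have "e2ennreal (ereal H - g t) = ennreal (H - M) + e2ennreal (ereal M - g t)" for t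
    using gM[of t] HM by (cases "g t") (auto simp flip: ennreal_plus)
  ultimately have "(\<integral>\<^sup>+t\<in>{0..2 * pi}. (ennreal (H - M) + e2ennreal (ereal M - g t)) \<partial>lborel) \<le> ennreal (2 * pi) * ennreal (H - M)"
    using M(1) by simp
  moreover have "(\<integral>\<^sup>+t\<in>{0..2 * pi}. (ennreal (H - M) + e2ennreal (ereal M - g t)) \<partial>lborel)
     = ennreal (2 * pi) * ennreal (H - M) + (\<integral>\<^sup>+t\<in>{0..2 * pi}. e2ennreal (ereal M - g t) \<partial>lborel)"
    by (subst distrib_right, subst nn_integral_add) (auto simp: nn_integral_cmult_indicator mult.commute)
  ultimately have "ennreal (2 * pi) * ennreal (H - M) + (\<integral>\<^sup>+t\<in>{0..2 * pi}. e2ennreal (ereal M - g t) \<partial>lborel)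
     \<le> ennreal (2 * pi) * ennreal (H - M) + 0" by simp
  then have "(\<integral>\<^sup>+t\<in>{0..2 * pi}. e2ennreal (ereal M - g t) \<partial>lborel) \<le> 0"
    by (subst (asm) ennreal_add_left_cancel_le) (auto simp: ennreal_mult_eq_top_iff)
  then have "AE t in lborel. e2ennreal (ereal M - g t) * indicator {0..2 * pi} t = 0"
    by (subst (asm) le_zero_eq, subst (asm) nn_integral_0_iff_AE) auto
  then show ?thesis
  proof eventually_elim
    case (elim t)
    show ?case
    proof
      assume "t \<in> {0..2 * pi}"
      then have "e2ennreal (ereal M - g t) = 0" using elim by simp
      then have "g t = ereal M"
        using gM[of t] by (cases "g t") (auto simp: ennreal_eq_0_iff)
      then show "u (a + cis t *s b) = ereal M" by (simp add: g_def)
    qed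
  qed
qed

text \<open>Among the maximum points the one farthest from the centre lies on the sphere.\<close>

lemma psh_max_on_sphere:
  fixes u :: "complex^'n \<Rightarrow> ereal"
  assumes u: "plurisubharmonic u" and r: "r > 0" and fin: "z \<in> cball a r" "u z \<noteq> - \<infinity>"
  obtains x where "x \<in> sphere a r" "u x \<noteq> - \<infinity>" "\<And>y. y \<in> cball a r \<Longrightarrow> u y \<le> u x"
proof -
  have usc: "upper_semicontinuous u" and lt: "\<And>z. u z < \<infinity>" using u by (auto simp: plurisubharmonic_def)
  obtain x0 where x0: "x0 \<in> cball a r" "\<And>y. y \<in> cball a r \<Longrightarrow> u y \<le> u x0"
    using upper_semicontinuous_attains_sup[OF usc, of "cball a r"] r by (metis cball_eq_empty compact_cball not_less_iff_gr_or_eq)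
  have "u x0 \<noteq> - \<infinity>" using x0(2)[OF fin(1)] fin(2) by auto
  then obtain M where M: "u x0 = ereal M" using lt[of x0] by (cases "u x0") auto
  define X where "X = cball a r - {z. u z < ereal M}"
  have "compact X" unfolding X_def using usc
    by (intro compact_diff compact_cball) (auto simp: upper_semicontinuous_def)
  have "X \<noteq> {}" using x0(1) M by (auto simp: X_def)
  obtain x where x: "x \<in> X" "\<And>y. y \<in> X \<Longrightarrow> dist a y \<le> dist a x"
  proof -
    have "continuous_on X (dist a)" by (intro continuous_intros)
    with \<open>compact X\<close> \<open>X \<noteq> {}\<close> have "\<exists>x\<in>X. \<forall>y\<in>X. dist a y \<le> dist a x" by (rule continuous_attains_sup)
    then show ?thesis using that by blast
  qed
  have ux: "u x = ereal M" using x(1) x0(2) M by (auto simp: X_def not_less intro: antisym)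
  have "dist a x = r"
  proof (rule ccontr)
    assume "dist a x \<noteq> r"
    then have "norm (x - a) < r" using x(1) by (simp add: X_def dist_norm norm_minus_commute)
    \<comment> \<open>From the centre every direction leads away. Otherwise the radial direction is
      taken; on the circle about x the points with 0 < t < \<pi>/2 are then farther from
      \<open>a\<close> than x.\<close>
    define w where "w = (if x = a then axis undefined 1 else x - a)"
    have "w \<noteq> 0" by (simp add: w_def axis_eq_0_iff)
    \<comment> \<open>The circle about x gets the radius r - |x - a| and so stays in the closed
      ball.\<close>
    define \<tau> where "\<tau> = (r - norm (x - a)) / norm w"
    have \<tau>: "\<tau> > 0" "\<tau> * norm w = r - norm (x - a)"
      using \<open>norm (x - a) < r\<close> \<open>w \<noteq> 0\<close> by (simp_all add: \<tau>_def)
    let ?y = "\<lambda>t. x + cis t *s (\<tau> *\<^sub>R w)"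
    have in_ball: "?y t \<in> cball a r" for t
    proof -
      have "norm (?y t - a) \<le> norm (x - a) + norm (cis t *s (\<tau> *\<^sub>R w))"
        using norm_triangle_ineq[of "x - a" "cis t *s (\<tau> *\<^sub>R w)"] by (simp add: algebra_simps)
      also have "\<dots> = r" using \<tau> by (simp add: norm_vector_scalar_mult)
      finally show ?thesis by (simp add: dist_norm norm_minus_commute)
    qed
    have ae: "AE t in lborel. t \<in> {0..2 * pi} \<longrightarrow> u (?y t) = ereal M"
      using u ux by (rule psh_max_propagates) (use x0(2)[OF in_ball] M in simp)
    have far: "u (?y t) \<noteq> ereal M" if t: "t \<in> {0<..<pi / 2}" for t
    proof
      assume "u (?y t) = ereal M"
      then have "?y t \<in> X" using in_ball by (simp add: X_def)
      then have le: "norm (?y t - a) \<le> norm (x - a)"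
        using x(2)[of "?y t"] by (simp add: dist_norm norm_minus_commute)
      show False
      proof (cases "x = a")
        case True
        then show ?thesis using le \<tau> \<open>norm (x - a) < r\<close> by (simp add: norm_vector_scalar_mult)
      next
        case False
        then have "w = x - a" by (simp add: w_def)
        have "\<tau> *\<^sub>R (x - a) = of_real \<tau> *s (x - a)" by (rule of_real_scalar_mult[symmetric])
        then have "?y t - a = (x - a) + (of_real \<tau> * cis t) *s (x - a)"
          unfolding \<open>w = x - a\<close> by (simp add: vec.scale_scale mult.commute)
        then have E: "?y t - a = (1 + of_real \<tau> * cis t) *s (x - a)"
          by (simp only: vec.scale_left_distrib vec.scale_one)
        have "norm (1 + of_real \<tau> * cis t) * norm (x - a) \<le> norm (x - a)"
          using le unfolding E norm_vector_scalar_mult .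
        then have "norm (1 + of_real \<tau> * cis t) \<le> 1"
          using False by (simp add: mult_le_cancel_right2)
        moreover have "Re (1 + of_real \<tau> * cis t) > 1"
          using \<tau> t cos_gt_zero[of t] by simp
        ultimately show False using complex_Re_le_cmod[of "1 + of_real \<tau> * cis t"] by linarith
      qed
    qed
    \<comment> \<open>Almost all points of the circle are maximum points, but the points of this arc
      are farther out than x and cannot be; the arc would have measure 0.\<close>
    have "AE t in lborel. t \<notin> {0<..<pi / 2}"
      using ae
    proof (rule eventually_mono)
      fix t assume t: "t \<in> {0..2 * pi} \<longrightarrow> u (?y t) = ereal M"
      show "t \<notin> {0<..<pi / 2}"
      proof
        assume t': "t \<in> {0<..<pi / 2}"
        then have "t \<in> {0..2 * pi}" by auto
        then show False using t far[OF t'] by simp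
      qed
    qed
    then have "{0<..<pi / 2} \<in> null_sets lborel"
      by (subst AE_iff_null_sets) auto
    then have "emeasure lborel {0<..<pi / 2} = 0" by (simp only: null_sets_def mem_Collect_eq)
    moreover have "emeasure lborel {0<..<pi / 2} = ennreal (pi / 2)" by simp
    ultimately show False by (simp only: ennreal_eq_0_iff) (use pi_gt_zero in linarith)
  qed
  then show ?thesis
    using that[of x] ux x0(2) M by simp
qed

section \<open>Slicing by lines through a point\<close>

text \<open>Integration in polar coordinates without spherical measures: the directions \<open>v\<close> are taken from the shell
  \<open>1 \<le> \<bar>v\<bar> \<le> 2\<close>, and the scaling behaviour of \<open>M\<close> makes the total weight of each point \<open>w\<close> a constant.\<close>

lemma polar_slices:
  fixes M :: "'a::euclidean_space measure" and \<kappa> :: "'s::euclidean_space measure"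
    and act :: "'s \<Rightarrow> 'a \<Rightarrow> 'a" and \<omega> \<gamma> :: "'s \<Rightarrow> ennreal" and N :: "'s \<Rightarrow> real"
  assumes M: "sigma_finite_measure M" "sets M = sets borel" "AE w in M. w \<noteq> 0"
    and \<kappa>: "sigma_finite_measure \<kappa>" "sets \<kappa> = sets borel"
    and act: "(\<lambda>p. act (fst p) (snd p)) \<in> borel_measurable (borel \<Otimes>\<^sub>M borel)" "\<And>s v. norm (act s v) = N s * norm v"
    and [measurable]: "\<omega> \<in> borel_measurable borel" "\<gamma> \<in> borel_measurable borel" "N \<in> borel_measurable borel"
    and pos: "\<And>s. \<omega> s \<noteq> 0 \<Longrightarrow> N s > 0"
    and scaling: "\<And>s h. h \<in> borel_measurable borel \<Longrightarrow> \<omega> s * (\<integral>\<^sup>+v. h (act s v) \<partial>M) = \<gamma> s * (\<integral>\<^sup>+v. h v \<partial>M)"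
    and total: "\<And>\<rho>. \<rho> > 0 \<Longrightarrow> (\<integral>\<^sup>+s. \<gamma> s * indicator {\<rho> / 2..\<rho>} (N s) \<partial>\<kappa>) = c"
    and F[measurable]: "F \<in> borel_measurable borel"
  shows "(\<integral>\<^sup>+v. indicator {1..2} (norm v) * (\<integral>\<^sup>+s. F (act s v) * \<omega> s \<partial>\<kappa>) \<partial>M) = c * (\<integral>\<^sup>+w. F w \<partial>M)"
proof -
  note [measurable_cong] = M(2) \<kappa>(2)
  interpret M: sigma_finite_measure M by (rule M(1))
  interpret K: sigma_finite_measure \<kappa> by (rule \<kappa>(1))
  interpret pair_sigma_finite \<kappa> M ..
  interpret P: pair_sigma_finite M \<kappa> ..
  have act_m: "(\<lambda>x. act (f x) (g x)) \<in> borel_measurable L"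
    if "f \<in> borel_measurable L" "g \<in> borel_measurable L" for f g and L :: "'b measure"
    using measurable_compose[OF measurable_Pair[OF that] act(1)] by simp
  note [measurable] = act_m
  let ?I = "\<lambda>a b x. indicator {a..b} x :: ennreal"
  have "(\<integral>\<^sup>+v. ?I 1 2 (norm v) * (\<integral>\<^sup>+s. F (act s v) * \<omega> s \<partial>\<kappa>) \<partial>M)
      = (\<integral>\<^sup>+v. \<integral>\<^sup>+s. ?I 1 2 (norm v) * (F (act s v) * \<omega> s) \<partial>\<kappa> \<partial>M)"
    by (intro nn_integral_cong nn_integral_cmult[symmetric]) measurable
  also have "\<dots> = (\<integral>\<^sup>+s. \<integral>\<^sup>+v. ?I 1 2 (norm v) * (F (act s v) * \<omega> s) \<partial>M \<partial>\<kappa>)"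
    by (rule P.Fubini'[symmetric]) measurable
  also have "\<dots> = (\<integral>\<^sup>+s. \<gamma> s * (\<integral>\<^sup>+w. F w * ?I (norm w / 2) (norm w) (N s) \<partial>M) \<partial>\<kappa>)"
  proof (rule nn_integral_cong)
    fix s
    have [measurable]: "(\<lambda>w. F w * ?I (norm w / 2) (norm w) (N s)) \<in> borel_measurable borel"
      unfolding indicator_def atLeastAtMost_iff by measurable
    have "(\<integral>\<^sup>+v. ?I 1 2 (norm v) * (F (act s v) * \<omega> s) \<partial>M)
        = \<omega> s * (\<integral>\<^sup>+v. F (act s v) * ?I (norm (act s v) / 2) (norm (act s v)) (N s) \<partial>M)"
    proof (cases "\<omega> s = 0")
      case False
      \<comment> \<open>With w = act s v the shell condition 1 <= |v| <= 2 reads |w|/2 <= N s <=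
        |w|, a condition on w and s alone, so that \<open>scaling\<close> can be applied.\<close>
      then have "?I 1 2 (norm v) = ?I (norm (act s v) / 2) (norm (act s v)) (N s)" for v
        using pos[of s] unfolding act(2) by (auto split: split_indicator simp: field_simps)
      then have "(\<integral>\<^sup>+v. ?I 1 2 (norm v) * (F (act s v) * \<omega> s) \<partial>M)
          = (\<integral>\<^sup>+v. \<omega> s * (F (act s v) * ?I (norm (act s v) / 2) (norm (act s v)) (N s)) \<partial>M)"
        by (intro nn_integral_cong) (simp add: mult_ac)
      also have "\<dots> = \<omega> s * (\<integral>\<^sup>+v. F (act s v) * ?I (norm (act s v) / 2) (norm (act s v)) (N s) \<partial>M)"
        unfolding indicator_def atLeastAtMost_iff by (rule nn_integral_cmult) measurable
      finally show ?thesis .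
    qed simp
    also have "\<dots> = \<gamma> s * (\<integral>\<^sup>+w. F w * ?I (norm w / 2) (norm w) (N s) \<partial>M)"
      by (rule scaling[of "\<lambda>w. F w * ?I (norm w / 2) (norm w) (N s)"]) measurable
    finally show "(\<integral>\<^sup>+v. ?I 1 2 (norm v) * (F (act s v) * \<omega> s) \<partial>M)
        = \<gamma> s * (\<integral>\<^sup>+w. F w * ?I (norm w / 2) (norm w) (N s) \<partial>M)" .
  qed
  also have "\<dots> = (\<integral>\<^sup>+s. \<integral>\<^sup>+w. \<gamma> s * (F w * ?I (norm w / 2) (norm w) (N s)) \<partial>M \<partial>\<kappa>)"
    unfolding indicator_def atLeastAtMost_iff by (intro nn_integral_cong nn_integral_cmult[symmetric]) measurable
  also have "\<dots> = (\<integral>\<^sup>+w. \<integral>\<^sup>+s. \<gamma> s * (F w * ?I (norm w / 2) (norm w) (N s)) \<partial>\<kappa> \<partial>M)"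
    unfolding indicator_def atLeastAtMost_iff by (rule Fubini'[symmetric]) measurable
  also have "\<dots> = (\<integral>\<^sup>+w. F w * (\<integral>\<^sup>+s. \<gamma> s * ?I (norm w / 2) (norm w) (N s) \<partial>\<kappa>) \<partial>M)"
    unfolding indicator_def atLeastAtMost_iff
    by (intro nn_integral_cong, subst nn_integral_cmult[symmetric]) (auto simp: mult_ac)
  also have "\<dots> = (\<integral>\<^sup>+w. c * F w \<partial>M)"
    using M(3) by (intro nn_integral_cong_AE, eventually_elim) (simp add: total mult.commute)
  also have "\<dots> = c * (\<integral>\<^sup>+w. F w \<partial>M)" by (rule nn_integral_cmult) measurable
  finally show ?thesis .
qed

text \<open>An inequality on every slice survives integration over the directions, and polar
  integration carries the same factor \<open>c\<close> on both sides.\<close>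

lemma slice_comparison:
  fixes c k :: ennreal
  assumes "\<And>v. (\<integral>\<^sup>+s. F (act s v) * \<omega> s \<partial>\<kappa>) \<le> k * (\<integral>\<^sup>+s. G (act s v) * \<omega> s \<partial>\<kappa>)"
    and "(\<integral>\<^sup>+v. indicator {1..2} (norm v) * (\<integral>\<^sup>+s. F (act s v) * \<omega> s \<partial>\<kappa>) \<partial>M) = c * (\<integral>\<^sup>+w. F w \<partial>M)"
    and "(\<integral>\<^sup>+v. indicator {1..2} (norm v) * (\<integral>\<^sup>+s. G (act s v) * \<omega> s \<partial>\<kappa>) \<partial>M) = c * (\<integral>\<^sup>+w. G w \<partial>M)"
    and c: "c \<noteq> 0" "c \<noteq> top" and kG: "k = ennreal k'" "0 \<le> k'"
    and [measurable]: "(\<lambda>v. indicator {1..2} (norm v) * (\<integral>\<^sup>+s. G (act s v) * \<omega> s \<partial>\<kappa>)) \<in> borel_measurable M"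
  shows "(\<integral>\<^sup>+w. F w \<partial>M) \<le> k * (\<integral>\<^sup>+w. G w \<partial>M)"
proof -
  have "c * (\<integral>\<^sup>+w. F w \<partial>M) \<le> (\<integral>\<^sup>+v. k * (indicator {1..2} (norm v) * (\<integral>\<^sup>+s. G (act s v) * \<omega> s \<partial>\<kappa>)) \<partial>M)"
    unfolding assms(2)[symmetric]
    by (intro nn_integral_mono) (auto split: split_indicator intro: assms(1))
  also have "\<dots> = k * (c * (\<integral>\<^sup>+w. G w \<partial>M))"
    by (subst nn_integral_cmult) (simp_all add: assms(3))
  finally have "c * (\<integral>\<^sup>+w. F w \<partial>M) \<le> c * (k * (\<integral>\<^sup>+w. G w \<partial>M))" by (simp add: mult_ac)
  then show ?thesis using c by (simp add: ennreal_mult_le_mult_iff)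
qed

section \<open>Polar integration along complex lines and real rays\<close>

lemma nn_integral_lborel_scaleR:
  fixes h :: "'a::euclidean_space \<Rightarrow> ennreal"
  assumes "c \<noteq> 0" and [measurable]: "h \<in> borel_measurable borel"
  shows "ennreal (\<bar>c\<bar> ^ DIM('a)) * (\<integral>\<^sup>+x. h (c *\<^sub>R x) \<partial>lborel) = (\<integral>\<^sup>+x. h x \<partial>lborel)"
proof -
  have "(\<integral>\<^sup>+x. h x \<partial>lborel) = (\<integral>\<^sup>+x. h x \<partial>density (distr lborel borel (\<lambda>x. 0 + c *\<^sub>R x)) (\<lambda>_. \<bar>c\<bar> ^ DIM('a)))"
    using lborel_affine[OF assms(1), of "0::'a"] by (rule arg_cong)
  also have "\<dots> = ennreal (\<bar>c\<bar> ^ DIM('a)) * (\<integral>\<^sup>+x. h (c *\<^sub>R x) \<partial>lborel)"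
    by (simp add: nn_integral_density nn_integral_distr nn_integral_cmult)
  finally show ?thesis by simp
qed

text \<open>Multiplication by \<zeta> is an isometry, given by the argument, followed by dilation by
  |\<zeta>| in real dimension 2n.\<close>

lemma nn_integral_lborel_scalar_mult:
  fixes h :: "complex^'n \<Rightarrow> ennreal"
  assumes "\<zeta> \<noteq> 0" and [measurable]: "h \<in> borel_measurable borel"
  shows "ennreal (norm \<zeta> ^ (2 * CARD('n))) * (\<integral>\<^sup>+x. h (\<zeta> *s x) \<partial>lborel) = (\<integral>\<^sup>+x. h x \<partial>lborel)"
proof -
  have "\<zeta> *s x = norm \<zeta> *\<^sub>R (cis (Arg \<zeta>) *s x)" for x :: "complex^'n"
    unfolding of_real_scalar_mult[symmetric] vec.scale_scale
    using rcis_cmod_Arg[of \<zeta>] by (simp add: rcis_def)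
  then have "(\<integral>\<^sup>+x. h (\<zeta> *s x) \<partial>lborel) = (\<integral>\<^sup>+x. h (norm \<zeta> *\<^sub>R (cis (Arg \<zeta>) *s x)) \<partial>lborel)" by simp
  also have "\<dots> = (\<integral>\<^sup>+x. h (norm \<zeta> *\<^sub>R x) \<partial>lborel)"
    by (rule nn_integral_lborel_isometry[where g="\<lambda>x. h (norm \<zeta> *\<^sub>R x)"])
      (auto simp: norm_vector_scalar_mult linear_vector_scalar_mult)
  finally show ?thesis
    using nn_integral_lborel_scaleR[of "norm \<zeta>" h] assms by (simp add: mult.commute)
qed

lemma nn_integral_inverse_Icc:
  assumes "0 < a" "a \<le> b"
  shows "(\<integral>\<^sup>+s. ennreal (1 / s) * indicator {a..b} s \<partial>lborel) = ennreal (ln b - ln a)"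
  using assms by (intro nn_integral_FTC_Icc) (auto intro!: derivative_eq_intros)

lemma scalar_mult_measurable:
  "(\<lambda>p. fst p *s (snd p :: complex^'n)) \<in> borel_measurable (borel \<Otimes>\<^sub>M borel)"
  unfolding borel_prod vector_scalar_mult_def by (intro borel_measurable_continuous_onI continuous_intros)

text \<open>The weight |\<zeta>|^(2n-2) is |\<zeta>|^(-2) times the volume factor |\<zeta>|^(2n),
  and |\<zeta>|^(-2) has the integral \<pi> ln 4 over the annulus from \<rho>/2 to \<rho>, whatever
  \<rho> is. This independence is the hypothesis \<open>total\<close> of
  \<open>polar_slices\<close>.\<close>

lemma complex_slice_comparison:
  fixes F G :: "complex^'n \<Rightarrow> ennreal"
  assumes [measurable]: "F \<in> borel_measurable borel" "G \<in> borel_measurable borel" and k: "0 \<le> k"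
    and le: "\<And>v. (\<integral>\<^sup>+\<zeta>. F (\<zeta> *s v) * ennreal (norm \<zeta> ^ (2 * CARD('n) - 2)) \<partial>lborel)
      \<le> ennreal k * (\<integral>\<^sup>+\<zeta>. G (\<zeta> *s v) * ennreal (norm \<zeta> ^ (2 * CARD('n) - 2)) \<partial>lborel)"
  shows "(\<integral>\<^sup>+w. F w \<partial>lborel) \<le> ennreal k * (\<integral>\<^sup>+w. G w \<partial>lborel)"
proof -
  \<comment> \<open>Set to 0 at the origin because the power is 1 there when n = 1, whereas
    \<open>polar_slices\<close> wants a positive norm wherever the weight is nonzero.\<close>
  define \<omega> where "\<omega> = (\<lambda>\<zeta>::complex. if \<zeta> = 0 then 0 else ennreal (norm \<zeta> ^ (2 * CARD('n) - 2)))"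
  define \<gamma> where "\<gamma> = (\<lambda>\<zeta>::complex. if \<zeta> = 0 then 0 else ennreal (1 / (norm \<zeta>)\<^sup>2))"
  have [measurable]: "\<omega> \<in> borel_measurable borel" "\<gamma> \<in> borel_measurable borel"
    unfolding \<omega>_def \<gamma>_def by measurable
  have act_m: "(\<lambda>x. (f x *s g x :: complex^'n)) \<in> borel_measurable L"
    if "f \<in> borel_measurable L" "g \<in> borel_measurable L" for f g and L :: "'b measure"
    using measurable_compose[OF measurable_Pair[OF that] scalar_mult_measurable] by simp
  note [measurable] = act_m
  have card: "CARD('n) > 0" by simp
  have polar: "(\<integral>\<^sup>+v. indicator {1..2} (norm v) * (\<integral>\<^sup>+s. f (s *s v) * \<omega> s \<partial>lborel) \<partial>lborel) = ennreal (pi * ln 4) * (\<integral>\<^sup>+w. f w \<partial>lborel)"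
    if [measurable]: "f \<in> borel_measurable borel" for f :: "complex^'n \<Rightarrow> ennreal"
  proof (rule polar_slices[where N=norm and \<gamma>=\<gamma>])
    show "\<omega> s * (\<integral>\<^sup>+v. h (s *s v) \<partial>lborel) = \<gamma> s * (\<integral>\<^sup>+v. h v \<partial>lborel)"
      if h: "h \<in> borel_measurable borel" for s and h :: "complex^'n \<Rightarrow> ennreal"
    proof (cases "s = 0")
      case False
      have "norm s ^ (2 * CARD('n) - 2) = 1 / (norm s)\<^sup>2 * norm s ^ (2 * CARD('n))"
        using False card by (simp add: power_diff)
      then have "\<omega> s = \<gamma> s * ennreal (norm s ^ (2 * CARD('n)))"
        using False by (simp add: \<omega>_def \<gamma>_def flip: ennreal_mult)
      then show ?thesis using nn_integral_lborel_scalar_mult[OF False h] by (simp add: mult.assoc)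
    qed (simp add: \<omega>_def \<gamma>_def)
    show "(\<integral>\<^sup>+s. \<gamma> s * indicator {\<rho> / 2..\<rho>} (norm s) \<partial>lborel) = ennreal (pi * ln 4)" if "\<rho> > 0" for \<rho>
    proof -
      have "(\<integral>\<^sup>+s. \<gamma> s * indicator {\<rho> / 2..\<rho>} (norm s) \<partial>lborel)
          = (\<integral>\<^sup>+s. (\<lambda>x. ennreal (1 / x) * indicator {\<rho>\<^sup>2 / 4..\<rho>\<^sup>2} x) ((norm (s::complex))\<^sup>2) \<partial>lborel)"
      proof (rule nn_integral_cong)
        fix s :: complex
        have "norm s \<in> {\<rho> / 2..\<rho>} \<longleftrightarrow> (norm s)\<^sup>2 \<in> {\<rho>\<^sup>2 / 4..\<rho>\<^sup>2}"
          using that power2_le_iff_abs_le[of \<rho> "norm s"] power2_le_iff_abs_le[of "norm s" "\<rho> / 2"]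
          by (auto simp: power_divide)
        moreover have "s \<noteq> 0" if "norm s \<in> {\<rho> / 2..\<rho>}" using that \<open>\<rho> > 0\<close> by auto
        ultimately show "\<gamma> s * indicator {\<rho> / 2..\<rho>} (norm s) = ennreal (1 / (norm s)\<^sup>2) * indicator {\<rho>\<^sup>2 / 4..\<rho>\<^sup>2} ((norm s)\<^sup>2)"
          by (simp add: \<gamma>_def indicator_def)
      qed
      also have "\<dots> = ennreal pi * (\<integral>\<^sup>+x\<in>{0..}. (ennreal (1 / x) * indicator {\<rho>\<^sup>2 / 4..\<rho>\<^sup>2} x) \<partial>lborel)"
        by (rule nn_integral_complex_radial) measurable
      also have "(\<integral>\<^sup>+x\<in>{0..}. (ennreal (1 / x) * indicator {\<rho>\<^sup>2 / 4..\<rho>\<^sup>2} x) \<partial>lborel)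
          = (\<integral>\<^sup>+x. ennreal (1 / x) * indicator {\<rho>\<^sup>2 / 4..\<rho>\<^sup>2} x \<partial>lborel)"
        by (intro nn_integral_cong) (auto split: split_indicator intro: order_trans[rotated])
      also have "\<dots> = ennreal (ln (\<rho>\<^sup>2) - ln (\<rho>\<^sup>2 / 4))"
        using that by (intro nn_integral_inverse_Icc) auto
      also have "ln (\<rho>\<^sup>2) - ln (\<rho>\<^sup>2 / 4) = ln 4" using that by (simp add: ln_div)
      finally show ?thesis by (simp add: ennreal_mult')
    qed
    show "AE w in lborel. w \<noteq> (0::complex^'n)" by (rule AE_lborel_singleton)
  qed (auto simp: sigma_finite_lborel scalar_mult_measurable norm_vector_scalar_mult \<omega>_def split: if_splits)
  have \<omega>_eq: "(\<integral>\<^sup>+\<zeta>. f (\<zeta> *s v) * ennreal (norm \<zeta> ^ (2 * CARD('n) - 2)) \<partial>lborel) = (\<integral>\<^sup>+s. f (s *s v) * \<omega> s \<partial>lborel)"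
    for f :: "complex^'n \<Rightarrow> ennreal" and v
    by (intro nn_integral_cong_AE eventually_mono[OF AE_lborel_singleton[of 0]]) (simp add: \<omega>_def)
  show ?thesis
  proof (rule slice_comparison[where act="(*s)" and \<omega>=\<omega> and \<kappa>=lborel and c="ennreal (pi * ln 4)"])
    show "(\<integral>\<^sup>+s. F (s *s v) * \<omega> s \<partial>lborel) \<le> ennreal k * (\<integral>\<^sup>+s. G (s *s v) * \<omega> s \<partial>lborel)" for v
      using le[of v] unfolding \<omega>_eq .
    show "ennreal (pi * ln 4) \<noteq> 0" by (simp add: ennreal_eq_0_iff not_le)
  qed (use k in \<open>auto intro!: polar\<close>)
qed

text \<open>The weight t^(d-1) is t^d/t, and dt/t has mass ln 2 on every [\<rho>/2, \<rho>].
  \<open>M\<close> is any measure homogeneous of degree d in the sense of \<open>scaling\<close>, so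
  that Lebesgue measure on a subspace qualifies.\<close>

lemma real_slice_comparison:
  fixes M :: "'a::euclidean_space measure"
  assumes M: "sigma_finite_measure M" "sets M = sets borel" "AE w in M. w \<noteq> 0" and d: "d > 0"
    and scaling: "\<And>t h. t > 0 \<Longrightarrow> h \<in> borel_measurable borel \<Longrightarrow>
       ennreal (t ^ d) * (\<integral>\<^sup>+v. h (t *\<^sub>R v) \<partial>M) = (\<integral>\<^sup>+v. h v \<partial>M)"
    and [measurable]: "F \<in> borel_measurable borel" "G \<in> borel_measurable borel" and k: "0 \<le> k"
    and le: "\<And>v. (\<integral>\<^sup>+t\<in>{0<..}. (F (t *\<^sub>R v) * ennreal (t ^ (d - 1))) \<partial>lborel)
      \<le> ennreal k * (\<integral>\<^sup>+t\<in>{0<..}. (G (t *\<^sub>R v) * ennreal (t ^ (d - 1))) \<partial>lborel)"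
  shows "(\<integral>\<^sup>+w. F w \<partial>M) \<le> ennreal k * (\<integral>\<^sup>+w. G w \<partial>M)"
proof -
  note [measurable_cong] = M(2)
  define \<omega> where "\<omega> = (\<lambda>t::real. ennreal (t ^ (d - 1)) * indicator {0<..} t)"
  define \<gamma> where "\<gamma> = (\<lambda>t::real. ennreal (1 / t) * indicator {0<..} t)"
  have [measurable]: "\<omega> \<in> borel_measurable borel" "\<gamma> \<in> borel_measurable borel"
    unfolding \<omega>_def \<gamma>_def by measurable
  have polar: "(\<integral>\<^sup>+v. indicator {1..2} (norm v) * (\<integral>\<^sup>+s. f (s *\<^sub>R v) * \<omega> s \<partial>lborel) \<partial>M) = ennreal (ln 2) * (\<integral>\<^sup>+w. f w \<partial>M)"
    if [measurable]: "f \<in> borel_measurable borel" for f :: "'a \<Rightarrow> ennreal"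
  proof (rule polar_slices[where N=abs and \<gamma>=\<gamma>])
    show "\<omega> s * (\<integral>\<^sup>+v. h (s *\<^sub>R v) \<partial>M) = \<gamma> s * (\<integral>\<^sup>+v. h v \<partial>M)"
      if h: "h \<in> borel_measurable borel" for s and h :: "'a \<Rightarrow> ennreal"
    proof (cases "s > 0")
      case True
      have "s ^ (d - 1) = 1 / s * s ^ d" using True d by (simp add: power_diff)
      then have "\<omega> s = \<gamma> s * ennreal (s ^ d)"
        using True by (simp add: \<omega>_def \<gamma>_def flip: ennreal_mult)
      then show ?thesis using scaling[OF True h] by (simp add: mult.assoc)
    qed (simp add: \<omega>_def \<gamma>_def)
    show "(\<integral>\<^sup>+s. \<gamma> s * indicator {\<rho> / 2..\<rho>} \<bar>s\<bar> \<partial>lborel) = ennreal (ln 2)" if "\<rho> > 0" for \<rho>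
    proof -
      have "(\<integral>\<^sup>+s. \<gamma> s * indicator {\<rho> / 2..\<rho>} \<bar>s\<bar> \<partial>lborel) = (\<integral>\<^sup>+s. ennreal (1 / s) * indicator {\<rho> / 2..\<rho>} s \<partial>lborel)"
        using that by (intro nn_integral_cong) (auto simp: \<gamma>_def split: split_indicator)
      also have "\<dots> = ennreal (ln \<rho> - ln (\<rho> / 2))"
        using that by (intro nn_integral_inverse_Icc) auto
      also have "ln \<rho> - ln (\<rho> / 2) = ln 2" using that by (simp add: ln_div)
      finally show ?thesis .
    qed
    show "(\<lambda>p. fst p *\<^sub>R snd p :: 'a) \<in> borel_measurable (borel \<Otimes>\<^sub>M borel)" by measurable
  qed (use M in \<open>auto simp: sigma_finite_lborel \<omega>_def split: split_indicator_asm\<close>)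
  have \<omega>_eq: "(\<integral>\<^sup>+t\<in>{0<..}. (f (t *\<^sub>R v) * ennreal (t ^ (d - 1))) \<partial>lborel) = (\<integral>\<^sup>+s. f (s *\<^sub>R v) * \<omega> s \<partial>lborel)"
    for f :: "'a \<Rightarrow> ennreal" and v
    by (intro nn_integral_cong) (simp add: \<omega>_def mult.assoc)
  show ?thesis
  proof (rule slice_comparison[where act="(*\<^sub>R)" and \<omega>=\<omega> and \<kappa>=lborel and c="ennreal (ln 2)"])
    show "(\<integral>\<^sup>+s. F (s *\<^sub>R v) * \<omega> s \<partial>lborel) \<le> ennreal k * (\<integral>\<^sup>+s. G (s *\<^sub>R v) * \<omega> s \<partial>lborel)" for v
      using le[of v] unfolding \<omega>_eq .
    show "ennreal (ln 2) \<noteq> 0" by (simp add: ennreal_eq_0_iff not_le)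
  qed (use k in \<open>auto intro!: polar\<close>)
qed

text \<open>A product measure is determined by its values on boxes, and on boxes the claim splits
  into one-dimensional affine changes of variable.\<close>

lemma nn_integral_PiM_affine:
  assumes I: "finite I" and t: "t > 0" and g[measurable]: "g \<in> borel_measurable (\<Pi>\<^sub>M i\<in>I. (borel :: real measure))"
  shows "ennreal (t ^ card I) * (\<integral>\<^sup>+f. g (\<lambda>i\<in>I. c i + t * f i) \<partial>(\<Pi>\<^sub>M i\<in>I. lborel)) = (\<integral>\<^sup>+f. g f \<partial>(\<Pi>\<^sub>M i\<in>I. lborel))"
proof -
  interpret product_sigma_finite "\<lambda>_::'a. lborel :: real measure" ..
  let ?P = "\<Pi>\<^sub>M i\<in>I. (lborel :: real measure)"
  let ?T = "\<lambda>f. \<lambda>i\<in>I. c i + t * f i :: real"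
  have sP: "sets ?P = sets (\<Pi>\<^sub>M i\<in>I. (borel :: real measure))" by (intro sets_PiM_cong) auto
  note [measurable_cong] = sP
  have T[measurable]: "?T \<in> measurable ?P ?P" by measurable
  let ?Q = "density (distr ?P ?P ?T) (\<lambda>_. ennreal (t ^ card I))"
  have "?Q = ?P"
  proof (rule PiM_eqI[OF I])
    show "sets ?Q = sets ?P" by simp
    fix A :: "'a \<Rightarrow> real set" assume A: "\<And>i. i \<in> I \<Longrightarrow> A i \<in> sets lborel"
    have meas: "Pi\<^sub>E I A \<in> sets ?P" using I A by (intro sets_PiM_I_finite) auto
    have vim: "?T -` Pi\<^sub>E I A \<inter> space ?P = Pi\<^sub>E I (\<lambda>i. (\<lambda>x. c i + t * x) -` A i)"
      by (auto simp: space_PiM PiE_iff)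
    have em: "ennreal t * emeasure lborel ((\<lambda>x. c i + t * x) -` A i) = emeasure lborel (A i)" if "i \<in> I" for i
    proof -
      have "emeasure lborel (A i) = emeasure (density (distr lborel borel (\<lambda>x. c i + t * x)) (\<lambda>_. ennreal \<bar>t\<bar>)) (A i)"
        using lborel_real_affine[of t "c i"] t by (intro arg_cong2[where f=emeasure] refl) simp
      also have "\<dots> = ennreal t * emeasure lborel ((\<lambda>x. c i + t * x) -` A i)"
        using A[OF that] t by (simp add: emeasure_density_const emeasure_distr)
      finally show ?thesis by simp
    qed
    have "emeasure ?Q (Pi\<^sub>E I A) = ennreal (t ^ card I) * emeasure ?P (Pi\<^sub>E I (\<lambda>i. (\<lambda>x. c i + t * x) -` A i))"
      using meas by (simp add: emeasure_density_const emeasure_distr[OF T] vim)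
    also have "emeasure ?P (Pi\<^sub>E I (\<lambda>i. (\<lambda>x. c i + t * x) -` A i)) = (\<Prod>i\<in>I. emeasure lborel ((\<lambda>x. c i + t * x) -` A i))"
    proof (rule emeasure_PiM[OF I])
      show "(\<lambda>x. c i + t * x) -` A i \<in> sets lborel" if "i \<in> I" for i
        using measurable_sets[of "\<lambda>x. c i + t * x" borel borel "A i"] A[OF that] by simp
    qed
    also have "ennreal (t ^ card I) * \<dots> = (\<Prod>i\<in>I. ennreal t * emeasure lborel ((\<lambda>x. c i + t * x) -` A i))"
      using t by (simp add: prod.distrib ennreal_power)
    also have "\<dots> = (\<Prod>i\<in>I. emeasure lborel (A i))" by (intro prod.cong refl em)
    finally show "emeasure ?Q (Pi\<^sub>E I A) = (\<Prod>i\<in>I. emeasure lborel (A i))" .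
  qed
  then have "(\<integral>\<^sup>+f. g f \<partial>?P) = (\<integral>\<^sup>+f. g f \<partial>?Q)" by simp
  also have "\<dots> = ennreal (t ^ card I) * (\<integral>\<^sup>+f. g (?T f) \<partial>?P)"
    by (simp add: nn_integral_density nn_integral_distr nn_integral_cmult)
  finally show ?thesis by simp
qed

section \<open>Lebesgue measure on a subspace\<close>

text \<open>Everything is shown for an arbitrary orthonormal basis;
  \<open>subspace_lebesgue_measure\<close> specialises it to the one selected in the
  definition.\<close>

locale subspace_measure =
  fixes S b :: "'a::euclidean_space set"
  assumes b: "orthonormal_basis S b"
begin

definition L :: "('a \<Rightarrow> real) \<Rightarrow> 'a" where
  "L f = (\<Sum>x\<in>b. f x *\<^sub>R x)"

definition N :: "'a measure" where
  "N = distr (\<Pi>\<^sub>M x\<in>b. (lborel :: real measure)) borel L"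

lemma b_props: "b \<subseteq> S" "pairwise orthogonal b" "\<And>x. x \<in> b \<Longrightarrow> norm x = 1" "span b = S" "independent b" "finite b" "card b = dim S"
proof -
  show 1: "b \<subseteq> S" "pairwise orthogonal b" "\<And>x. x \<in> b \<Longrightarrow> norm x = 1" "span b = S"
    using b by (auto simp: orthonormal_basis_def)
  have "0 \<notin> b" using 1(3)[of 0] by auto
  then show ind: "independent b" using 1(2) by (intro pairwise_orthogonal_independent)
  then show "finite b" by (rule independent_imp_finite)
  show "card b = dim S" using dim_span_eq_card_independent[OF ind] 1(4) by simp
qed

lemma subspace_S: "subspace S"
  using b_props(4) subspace_span by metis

lemma L_inner: "x \<in> b \<Longrightarrow> L f \<bullet> x = f x"
proof -
  assume x: "x \<in> b"
  have "L f \<bullet> x = (\<Sum>y\<in>b. f y * (y \<bullet> x))" by (simp add: L_def inner_sum_left)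
  also have "\<dots> = (\<Sum>y\<in>b. if y = x then f y else 0)"
  proof (rule sum.cong)
    fix y assume y: "y \<in> b"
    have "y \<bullet> x = 0" if "y \<noteq> x" using b_props(2) x y that by (auto simp: pairwise_def orthogonal_def)
    moreover have "x \<bullet> x = 1" using b_props(3)[OF x] by (simp add: dot_square_norm)
    ultimately show "f y * (y \<bullet> x) = (if y = x then f y else 0)" by simp
  qed simp
  also have "\<dots> = f x" using x b_props(6) by simp
  finally show "L f \<bullet> x = f x" .
qed

lemma L_in: "L f \<in> S"
  unfolding L_def using b_props(1) subspace_S by (intro subspace_sum subspace_scale) auto

lemma sets_PiM_borel: "sets (\<Pi>\<^sub>M x\<in>b. (lborel :: real measure)) = sets (\<Pi>\<^sub>M x\<in>b. (borel :: real measure))"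
  by (intro sets_PiM_cong) auto

lemma L_measurable_borel [measurable]: "L \<in> borel_measurable (\<Pi>\<^sub>M x\<in>b. (borel :: real measure))"
  unfolding L_def[abs_def] by measurable

lemma L_measurable [measurable]: "L \<in> measurable (\<Pi>\<^sub>M x\<in>b. (lborel :: real measure)) borel"
  using L_measurable_borel measurable_cong_sets[OF sets_PiM_borel refl] by blast

lemma nn_integral_N:
  assumes [measurable]: "h \<in> borel_measurable borel"
  shows "(\<integral>\<^sup>+v. h v \<partial>N) = (\<integral>\<^sup>+f. h (L f) \<partial>(\<Pi>\<^sub>M x\<in>b. (lborel :: real measure)))"
  unfolding N_def by (rule nn_integral_distr) measurable

lemma sets_N: "sets N = sets borel" and space_N: "space N = UNIV"
  by (simp_all add: N_def)

text \<open>For a in S the map v -> a + t v acts on the orthonormal coordinates by one affine map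
  each. The case t = 1 is translation invariance, the case a = 0 homogeneity.\<close>

lemma nn_integral_N_affine:
  assumes a: "a \<in> S" and t: "t > 0" and h[measurable]: "h \<in> borel_measurable borel"
  shows "ennreal (t ^ dim S) * (\<integral>\<^sup>+v. h (a + t *\<^sub>R v) \<partial>N) = (\<integral>\<^sup>+v. h v \<partial>N)"
proof -
  have eq: "a + t *\<^sub>R L f = L (\<lambda>i\<in>b. a \<bullet> i + t * f i)" for f
  proof -
    have "a = (\<Sum>x\<in>b. (a \<bullet> x) *\<^sub>R x)"
      using orthonormal_basis_expand[of b a] b_props a by simp
    then have "a + t *\<^sub>R L f = (\<Sum>x\<in>b. (a \<bullet> x) *\<^sub>R x) + t *\<^sub>R L f" by simp
    also have "\<dots> = L (\<lambda>i\<in>b. a \<bullet> i + t * f i)"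
      by (simp add: L_def scaleR_sum_right scaleR_add_left sum.distrib)
    finally show ?thesis .
  qed
  have m: "(\<lambda>f. h (L f)) \<in> borel_measurable (\<Pi>\<^sub>M x\<in>b. (borel :: real measure))" by measurable
  have E: "(\<integral>\<^sup>+v. h (a + t *\<^sub>R v) \<partial>N) = (\<integral>\<^sup>+f. h (L (\<lambda>i\<in>b. a \<bullet> i + t * f i)) \<partial>(\<Pi>\<^sub>M x\<in>b. (lborel :: real measure)))"
    by (subst nn_integral_N) (auto simp: eq)
  show ?thesis
    unfolding E nn_integral_N[OF h] b_props(7)[symmetric]
    by (rule nn_integral_PiM_affine[OF b_props(6) t m])
qed

lemma AE_N_in: "AE v in N. v \<in> S"
proof -
  have "S \<in> sets borel" by (rule borel_closed[OF closed_subspace[OF subspace_S]])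
  then have "{v \<in> space borel. v \<in> S} \<in> sets borel" by simp
  from AE_distr_iff[OF L_measurable this] have "AE v in distr (\<Pi>\<^sub>M x\<in>b. (lborel :: real measure)) borel L. v \<in> S"
    by (rule iffD2) (simp add: L_in)
  then show ?thesis unfolding N_def .
qed

lemma emeasure_PiE_N: "emeasure (\<Pi>\<^sub>M x\<in>b. (lborel :: real measure)) (Pi\<^sub>E b (\<lambda>_. {- r..r})) = ennreal ((2 * r) ^ dim S)" if "r \<ge> 0"
proof -
  interpret product_sigma_finite "\<lambda>_::'a. lborel :: real measure" ..
  show ?thesis
    using that by (subst emeasure_PiM) (auto simp: b_props ennreal_power)
qed

text \<open>The ball is squeezed between two coordinate cubes: each coordinate is bounded by the
  norm, and the norm by the sum of the moduli of the coordinates. The summand 1 in \<open>s\<close>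
  makes the last inequality strict and covers dimension 0.\<close>

lemma emeasure_N_ball_0: "0 < emeasure N (ball 0 r)" "emeasure N (ball 0 r) < \<infinity>" if r: "r > 0"
proof -
  let ?P = "\<Pi>\<^sub>M x\<in>b. (lborel :: real measure)"
  have em: "emeasure N (ball 0 r) = emeasure ?P (L -` ball 0 r \<inter> space ?P)"
    unfolding N_def by (rule emeasure_distr) auto
  have meas: "Pi\<^sub>E b (\<lambda>_. {- s..s}) \<in> sets ?P" for s
    using b_props(6) by (intro sets_PiM_I_finite) auto
  have "L -` ball 0 r \<inter> space ?P \<subseteq> Pi\<^sub>E b (\<lambda>_. {- r..r})"
  proof
    fix f assume f: "f \<in> L -` ball 0 r \<inter> space ?P"
    have "\<bar>f x\<bar> \<le> r" if "x \<in> b" for x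
      using Cauchy_Schwarz_ineq2[of "L f" x] f L_inner[OF that, of f] b_props(3)[OF that] by simp
    then have "f x \<in> {- r..r}" if "x \<in> b" for x using that by (simp add: abs_le_iff minus_le_iff)
    then show "f \<in> Pi\<^sub>E b (\<lambda>_. {- r..r})" using f by (auto simp: space_PiM PiE_iff)
  qed
  then have "emeasure N (ball 0 r) \<le> emeasure ?P (Pi\<^sub>E b (\<lambda>_. {- r..r}))"
    unfolding em by (rule emeasure_mono) (rule meas)
  also have "\<dots> < \<infinity>" using r by (simp add: emeasure_PiE_N)
  finally show "emeasure N (ball 0 r) < \<infinity>" .
  define s where "s = r / (1 + real (card b))"
  have s: "s > 0" using r by (simp add: s_def)
  have "Pi\<^sub>E b (\<lambda>_. {- s..s}) \<subseteq> L -` ball 0 r \<inter> space ?P"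
  proof
    fix f assume f: "f \<in> Pi\<^sub>E b (\<lambda>_. {- s..s})"
    have "norm (L f) \<le> (\<Sum>x\<in>b. s)"
      unfolding L_def
    proof (rule sum_norm_le)
      fix x assume x: "x \<in> b"
      then have "f x \<in> {- s..s}" using f by (rule PiE_mem[rotated])
      then show "norm (f x *\<^sub>R x) \<le> s" using b_props(3)[OF x] by (simp add: abs_le_iff)
    qed
    also have "\<dots> < r" using r by (simp add: s_def field_simps)
    finally show "f \<in> L -` ball 0 r \<inter> space ?P" using f by (auto simp: space_PiM PiE_iff)
  qed
  then have "emeasure ?P (Pi\<^sub>E b (\<lambda>_. {- s..s})) \<le> emeasure N (ball 0 r)"
    unfolding em using measurable_sets[OF L_measurable, of "ball 0 r"] by (intro emeasure_mono) auto
  moreover have "0 < emeasure ?P (Pi\<^sub>E b (\<lambda>_. {- s..s}))"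
    using s by (simp add: emeasure_PiE_N)
  ultimately show "0 < emeasure N (ball 0 r)" by (rule less_le_trans[rotated])
qed

lemma nn_integral_N_shift:
  assumes "a \<in> S" "h \<in> borel_measurable borel"
  shows "(\<integral>\<^sup>+v. h (a + v) \<partial>N) = (\<integral>\<^sup>+v. h v \<partial>N)"
  using nn_integral_N_affine[of a 1 h] assms by simp

lemma emeasure_N_ball:
  assumes a: "a \<in> S" and r: "r > 0"
  shows "0 < emeasure N (ball a r \<inter> S)" "emeasure N (ball a r \<inter> S) < \<infinity>"
proof -
  have S: "S \<in> sets borel" by (rule borel_closed[OF closed_subspace[OF subspace_S]])
  have "emeasure N (ball a r \<inter> S) = emeasure N (ball a r)"
    using AE_N_in S by (intro emeasure_eq_AE) (auto simp: sets_N)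
  also have "\<dots> = (\<integral>\<^sup>+v. indicator (ball a r) v \<partial>N)" by (simp add: sets_N)
  also have "\<dots> = (\<integral>\<^sup>+v. indicator (ball a r) (a + v) \<partial>N)"
    by (rule nn_integral_N_shift[OF a, symmetric]) measurable
  also have "\<dots> = (\<integral>\<^sup>+v. indicator (ball 0 r) v \<partial>N)"
    by (intro nn_integral_cong) (simp add: indicator_def dist_norm)
  also have "\<dots> = emeasure N (ball 0 r)" by (simp add: sets_N)
  finally show "0 < emeasure N (ball a r \<inter> S)" "emeasure N (ball a r \<inter> S) < \<infinity>"
    using emeasure_N_ball_0[OF r] by simp_all
qed

lemma sigma_finite_N: "sigma_finite_measure N"
proof
  show "\<exists>A. countable A \<and> A \<subseteq> sets N \<and> \<Union> A = space N \<and> (\<forall>a\<in>A. emeasure N a \<noteq> \<infinity>)"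
  proof (intro exI[of _ "range (\<lambda>n. ball 0 (real (Suc n)))"] conjI ballI)
    show "\<Union> (range (\<lambda>n. ball (0::'a) (real (Suc n)))) = space N"
    proof -
      have "\<exists>n. norm x < real (Suc n)" for x :: 'a
        using reals_Archimedean2[of "norm x"] by (metis lessI less_trans of_nat_less_iff)
      then show ?thesis by (auto simp: space_N simp del: of_nat_Suc)
    qed
    show "emeasure N A \<noteq> \<infinity>" if A: "A \<in> range (\<lambda>n. ball 0 (real (Suc n)))" for A
      using A emeasure_N_ball_0(2)[of "real (Suc _)"] by (auto simp: less_top[symmetric] simp del: of_nat_Suc)
  qed (auto simp: sets_N)
qed

text \<open>The origin is fixed by dilation by 2, so its finite mass equals 2^d times itself with d
  > 0.\<close>

lemma AE_N_nonzero:
  assumes "dim S > 0" shows "AE v in N. v \<noteq> 0"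
proof -
  have fin: "emeasure N {0} < \<infinity>"
  proof -
    have "emeasure N {0} \<le> emeasure N (ball 0 1)" by (intro emeasure_mono) (auto simp: sets_N)
    then show ?thesis using emeasure_N_ball_0(2)[of 1] by (simp add: order_le_less_trans)
  qed
  have "ennreal (2 ^ dim S) * (\<integral>\<^sup>+v. indicator {0} (0 + 2 *\<^sub>R v) \<partial>N) = (\<integral>\<^sup>+v. indicator {0} v \<partial>N)"
    by (rule nn_integral_N_affine) (auto simp: subspace_S subspace_0)
  moreover have "(\<lambda>v::'a. indicator {0} (0 + 2 *\<^sub>R v) :: ennreal) = indicator {0}"
    by (auto simp: indicator_def)
  ultimately have "ennreal (2 ^ dim S) * emeasure N {0} = emeasure N {0}"
    by (simp add: sets_N)
  then have "emeasure N {0} = 0"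
  proof -
    obtain x where x: "emeasure N {0} = ennreal x" "x \<ge> 0" using fin by (cases "emeasure N {0}") auto
    have "2 ^ dim S * x = x"
      using \<open>ennreal (2 ^ dim S) * emeasure N {0} = emeasure N {0}\<close> x by (simp flip: ennreal_mult)
    moreover have "(2::real) ^ dim S > 1" using assms by (intro one_less_power) auto
    ultimately show ?thesis using x by simp
  qed
  then have "{0} \<in> null_sets N" by (simp add: null_sets_def sets_N)
  then show ?thesis by (rule AE_not_in[THEN eventually_mono]) simp
qed

end

lemma subspace_lebesgue_measure:
  assumes "subspace (S :: 'a::euclidean_space set)"
  obtains b where "subspace_measure S b" "subspace_lebesgue S = subspace_measure.N b"
proof -
  define b where "b = (SOME b. orthonormal_basis S b)"
  have b: "orthonormal_basis S b"
    unfolding b_def using orthonormal_basis_exists[OF assms] by (rule someI_ex)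
  interpret subspace_measure S b by unfold_locales (rule b)
  have "subspace_lebesgue S = N"
    unfolding N_def subspace_lebesgue_def b_def[symmetric] Let_def L_def[abs_def] ..
  then show ?thesis by (rule that[OF subspace_measure_axioms])
qed

section \<open>From exponential bounds to mean oscillation\<close>

text \<open>Passing to the excess over 1 makes the bound vanish with x. On the slices only this
  excess is later compared with the maximal polar weight.\<close>

lemma nn_integral_minus_1_le:
  assumes [measurable]: "D \<in> sets M" "g \<in> borel_measurable M"
    and V: "emeasure M D = ennreal V" "0 \<le> V" and x: "0 \<le> x"
    and ge: "\<And>z. z \<in> D \<Longrightarrow> 1 \<le> g z"
    and le: "(\<integral>\<^sup>+z\<in>D. g z \<partial>M) \<le> ennreal (V * (1 + x))"
  shows "(\<integral>\<^sup>+z\<in>D. (g z - 1) \<partial>M) \<le> ennreal (V * x)"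
proof -
  have "(\<integral>\<^sup>+z\<in>D. (g z - 1) \<partial>M) + ennreal V = (\<integral>\<^sup>+z. (g z - 1) * indicator D z + indicator D z \<partial>M)"
    by (subst nn_integral_add) (auto simp: V)
  also have "\<dots> = (\<integral>\<^sup>+z\<in>D. g z \<partial>M)"
    using ge by (intro nn_integral_cong) (auto split: split_indicator simp: diff_add_cancel_ennreal)
  also have "\<dots> \<le> ennreal (V * x) + ennreal V"
    using le V(2) x by (simp add: algebra_simps flip: ennreal_plus)
  finally show ?thesis
    by (simp add: add.commute[of _ "ennreal V"] ennreal_add_left_cancel_le)
qed

lemma one_le_exp_ereal: "0 \<le> x \<Longrightarrow> 1 \<le> exp_ereal x"
  by (cases x) (auto simp: exp_ereal_def simp flip: ennreal_1)

text \<open>The positive and negative parts in \<open>ereal_mean\<close> are related by an identity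
  of nonnegative integrals. The sign of m is handled by the truncations \<open>ennreal m\<close> and
  \<open>ennreal (- m)\<close>, of which at most one is nonzero.\<close>

lemma ereal_mean_eq_max_minus:
  fixes M :: "'a measure" and u :: "'a \<Rightarrow> ereal"
  assumes [measurable]: "A \<in> sets M" "u \<in> borel_measurable M"
    and V: "emeasure M A = ennreal V" "V > 0" and top: "\<And>z. z \<in> A \<Longrightarrow> u z \<le> ereal m"
    and d: "(\<integral>\<^sup>+z\<in>A. e2ennreal (ereal m - u z) \<partial>M) = ennreal d" "0 \<le> d"
  shows "ereal_mean M A u = ereal (m - d / V)"
proof -
  define U W where "U = (\<integral>\<^sup>+z\<in>A. e2ennreal (u z) \<partial>M)" and "W = (\<integral>\<^sup>+z\<in>A. e2ennreal (- u z) \<partial>M)"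
  have const: "(\<integral>\<^sup>+z\<in>A. ennreal c \<partial>M) = ennreal (max 0 c * V)" for c
    using V by (simp add: nn_integral_cmult_indicator ennreal_mult' max_def ennreal_neg)
  have "U \<le> (\<integral>\<^sup>+z\<in>A. ennreal m \<partial>M)"
    unfolding U_def using e2ennreal_mono[OF top] by (intro nn_integral_mono) (auto split: split_indicator)
  then have "U < \<infinity>" unfolding const by (simp add: order_le_less_trans)
  then obtain p where p: "U = ennreal p" "p \<ge> 0" by (cases U) auto
  have "U + ennreal d + ennreal (max 0 (- m) * V)
      = (\<integral>\<^sup>+z\<in>A. (e2ennreal (u z) + e2ennreal (ereal m - u z) + ennreal (- m)) \<partial>M)"
    unfolding U_def d(1)[symmetric] const[symmetric] by (simp add: distrib_right nn_integral_add)
  also have "\<dots> = (\<integral>\<^sup>+z\<in>A. (e2ennreal (- u z) + ennreal m) \<partial>M)"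
  proof (rule nn_integral_cong)
    fix z
    have "e2ennreal (u z) + e2ennreal (ereal m - u z) + ennreal (- m) = e2ennreal (- u z) + ennreal m" if "z \<in> A"
    proof (cases "u z")
      case (real y)
      then have "y \<le> m" using top[OF that] by simp
      then show ?thesis using real
        by (cases "y \<ge> 0"; cases "m \<ge> 0") (auto simp: ennreal_neg simp flip: ennreal_plus)
    next
      case PInf then show ?thesis using top[OF that] by simp
    qed simp
    then show "(e2ennreal (u z) + e2ennreal (ereal m - u z) + ennreal (- m)) * indicator A z = (e2ennreal (- u z) + ennreal m) * indicator A z"
      by (auto split: split_indicator)
  qed
  also have "\<dots> = W + ennreal (max 0 m * V)"
    unfolding W_def const[symmetric] by (simp add: distrib_right nn_integral_add)
  finally have E: "U + ennreal d + ennreal (max 0 (- m) * V) = W + ennreal (max 0 m * V)" .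
  then have "W \<noteq> top" unfolding p by (metis ennreal_add_eq_top ennreal_neq_top)
  then obtain q where q: "W = ennreal q" "q \<ge> 0" by (cases W) auto
  have "p + d + max 0 (- m) * V = q + max 0 m * V"
    using E p q d V by (simp flip: ennreal_plus)
  moreover have "max 0 m * V - max 0 (- m) * V = m * V" by (simp add: max_def)
  ultimately have "p - q = m * V - d" by linarith
  moreover have "measure M A = V" using V by (simp add: measure_def)
  moreover have "(m * V - d) / V = m - d / V" using V by (simp add: diff_divide_distrib)
  ultimately show ?thesis
    using p q V unfolding ereal_mean_def ereal_set_integral_def U_def[symmetric] W_def[symmetric]
    by (simp add: enn2ereal_ennreal)
qed

text \<open>The exponential bounds for small \<open>\<beta>\<close> bound \<open>m - u\<^sub>A\<close> by \<open>c / p\<close>, because \<open>exp (\<beta> x) - 1 \<ge> \<beta> x\<close>.\<close>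

lemma exp_oscillation_mean_le:
  fixes M :: "'a measure" and u :: "'a \<Rightarrow> ereal"
  assumes [measurable]: "A \<in> sets M" "u \<in> borel_measurable M"
    and A: "0 < emeasure M A" "emeasure M A < \<infinity>" and top: "\<And>z. z \<in> A \<Longrightarrow> u z \<le> ereal m"
    and c: "0 \<le> c" and \<alpha>: "0 < \<alpha>" "\<alpha> < p"
    and bound: "\<And>\<beta>. 0 < \<beta> \<Longrightarrow> \<beta> < p \<Longrightarrow>
      (\<integral>\<^sup>+z\<in>A. (exp_ereal (ereal \<beta> * (ereal m - u z)) - 1) \<partial>M) \<le> ennreal (c * (\<beta> / (p - \<beta>))) * emeasure M A"
  shows "exp_oscillation_mean M A \<alpha> u \<le> ennreal ((1 + c * (\<alpha> / (p - \<alpha>))) * exp (\<alpha> * (c / p)))"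
proof -
  obtain V where V: "emeasure M A = ennreal V" "V > 0"
    using A by (cases "emeasure M A") auto
  define D where "D = (\<integral>\<^sup>+z\<in>A. e2ennreal (ereal m - u z) \<partial>M)"
  have D_le: "D \<le> ennreal (c / (p - \<beta>) * V)" if \<beta>: "0 < \<beta>" "\<beta> < p" for \<beta>
  proof -
    have "ennreal \<beta> * D = (\<integral>\<^sup>+z. ennreal \<beta> * (e2ennreal (ereal m - u z) * indicator A z) \<partial>M)"
      unfolding D_def by (rule nn_integral_cmult[symmetric]) measurable
    also have "\<dots> \<le> (\<integral>\<^sup>+z\<in>A. (exp_ereal (ereal \<beta> * (ereal m - u z)) - 1) \<partial>M)"
    proof (rule nn_integral_mono)
      fix z
      have "ennreal \<beta> * e2ennreal (ereal m - u z) \<le> exp_ereal (ereal \<beta> * (ereal m - u z)) - 1" if "z \<in> A"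
      proof (cases "u z")
        case (real y)
        then have "y \<le> m" using top[OF that] by simp
        have "\<beta> * (m - y) \<le> exp (\<beta> * (m - y)) - 1" using exp_ge_add_one_self[of "\<beta> * (m - y)"] by linarith
        then have "ennreal (\<beta> * (m - y)) \<le> ennreal (exp (\<beta> * (m - y)) - 1)" by (rule ennreal_leI)
        also have "\<dots> = ennreal (exp (\<beta> * (m - y))) - 1" by (simp add: ennreal_minus[symmetric])
        finally show ?thesis using real \<beta> \<open>y \<le> m\<close> by (simp add: exp_ereal_def ennreal_mult)
      next
        case MInf
        then show ?thesis using \<beta> by (simp add: exp_ereal_def)
      qed (use top[OF that] in simp)
      then show "ennreal \<beta> * (e2ennreal (ereal m - u z) * indicator A z)
          \<le> (exp_ereal (ereal \<beta> * (ereal m - u z)) - 1) * indicator A z"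
        by (auto split: split_indicator)
    qed
    also have "\<dots> \<le> ennreal (c * (\<beta> / (p - \<beta>))) * ennreal V" using bound[OF \<beta>] V by simp
    also have "\<dots> = ennreal \<beta> * ennreal (c / (p - \<beta>) * V)"
      using \<beta> c V by (simp add: ennreal_mult[symmetric] mult_ac)
    finally show ?thesis using \<beta> by (simp add: ennreal_mult_le_mult_iff)
  qed
  have p: "p > 0" using \<alpha> by simp
  have "D < \<infinity>" using D_le[OF \<alpha>] by (simp add: order_le_less_trans)
  then obtain d where d: "D = ennreal d" "0 \<le> d" by (cases D) auto
  have "d \<le> c / p * V"
  proof -
    have "((\<lambda>\<beta>. c / (p - \<beta>) * V) \<longlongrightarrow> c / (p - 0) * V) (at_right 0)"
      using p by (intro tendsto_intros) auto
    moreover have "\<forall>\<^sub>F \<beta> in at_right 0. d \<le> c / (p - \<beta>) * V"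
      unfolding eventually_at_right_field
    proof (intro exI[of _ p] conjI allI impI)
      fix \<beta> assume \<beta>: "0 < \<beta>" "\<beta> < p"
      have "c / (p - \<beta>) * V \<ge> 0" using \<beta> c V by simp
      then show "d \<le> c / (p - \<beta>) * V" using D_le[OF \<beta>] d by (simp add: ennreal_le_iff)
    qed (rule p)
    ultimately show ?thesis by (intro tendsto_lowerbound[where F="at_right 0"]) auto
  qed
  then have dV: "d / V \<le> c / p" using V by (simp add: field_simps)
  have mean: "ereal_mean M A u = ereal (m - d / V)"
    using V top d unfolding D_def by (intro ereal_mean_eq_max_minus) auto
  have "(\<integral>\<^sup>+z\<in>A. exp_ereal (ereal \<alpha> * \<bar>u z - ereal_mean M A u\<bar>) \<partial>M)
      \<le> (\<integral>\<^sup>+z\<in>A. (ennreal (exp (\<alpha> * (c / p))) * exp_ereal (ereal \<alpha> * (ereal m - u z))) \<partial>M)"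
  proof (rule nn_integral_mono)
    fix z
    have "exp_ereal (ereal \<alpha> * \<bar>u z - ereal (m - d / V)\<bar>) \<le> ennreal (exp (\<alpha> * (c / p))) * exp_ereal (ereal \<alpha> * (ereal m - u z))" if "z \<in> A"
    proof (cases "u z")
      case (real y)
      then have "y \<le> m" using top[OF that] by simp
      moreover have "d / V \<ge> 0" using d V by simp
      ultimately have "\<bar>y - (m - d / V)\<bar> \<le> c / p + (m - y)" using dV by linarith
      then have "\<alpha> * \<bar>y - (m - d / V)\<bar> \<le> \<alpha> * (c / p) + \<alpha> * (m - y)"
        using \<alpha> unfolding distrib_left[symmetric] by (intro mult_left_mono) auto
      then have "exp (\<alpha> * \<bar>y - (m - d / V)\<bar>) \<le> exp (\<alpha> * (c / p)) * exp (\<alpha> * (m - y))"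
        unfolding mult_exp_exp by simp
      then show ?thesis using real by (simp add: exp_ereal_def ennreal_leI flip: ennreal_mult)
    next
      case MInf
      then show ?thesis using \<alpha> by (simp add: exp_ereal_def ennreal_mult_top)
    qed (use top[OF that] in simp)
    then show "exp_ereal (ereal \<alpha> * \<bar>u z - ereal_mean M A u\<bar>) * indicator A z
        \<le> (ennreal (exp (\<alpha> * (c / p))) * exp_ereal (ereal \<alpha> * (ereal m - u z))) * indicator A z"
      unfolding mean by (auto split: split_indicator)
  qed
  also have "\<dots> = ennreal (exp (\<alpha> * (c / p))) * (\<integral>\<^sup>+z\<in>A. exp_ereal (ereal \<alpha> * (ereal m - u z)) \<partial>M)"
    by (subst nn_integral_cmult[symmetric]) (auto simp: mult.assoc)
  also have "(\<integral>\<^sup>+z\<in>A. exp_ereal (ereal \<alpha> * (ereal m - u z)) \<partial>M)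
      = (\<integral>\<^sup>+z. (exp_ereal (ereal \<alpha> * (ereal m - u z)) - 1) * indicator A z + indicator A z \<partial>M)"
  proof (rule nn_integral_cong)
    fix z
    have "exp_ereal (ereal \<alpha> * (ereal m - u z)) = (exp_ereal (ereal \<alpha> * (ereal m - u z)) - 1) + 1" if "z \<in> A"
    proof -
      have "0 \<le> ereal \<alpha> * (ereal m - u z)"
        using top[OF that] \<alpha> by (cases "u z") auto
      then show ?thesis by (simp add: one_le_exp_ereal diff_add_cancel_ennreal)
    qed
    then show "exp_ereal (ereal \<alpha> * (ereal m - u z)) * indicator A z
        = (exp_ereal (ereal \<alpha> * (ereal m - u z)) - 1) * indicator A z + indicator A z"
      by (auto split: split_indicator)
  qed
  also have "\<dots> = (\<integral>\<^sup>+z\<in>A. (exp_ereal (ereal \<alpha> * (ereal m - u z)) - 1) \<partial>M) + ennreal V"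
    by (subst nn_integral_add) (auto simp: V)
  also have "\<dots> \<le> ennreal (c * (\<alpha> / (p - \<alpha>))) * ennreal V + ennreal V"
    using bound[OF \<alpha>] V by (intro add_right_mono) simp
  also have "\<dots> = ennreal ((1 + c * (\<alpha> / (p - \<alpha>))) * V)"
    using c \<alpha> V by (simp add: distrib_right add.commute flip: ennreal_mult ennreal_plus)
  finally have "(\<integral>\<^sup>+z\<in>A. exp_ereal (ereal \<alpha> * \<bar>u z - ereal_mean M A u\<bar>) \<partial>M)
      \<le> ennreal (exp (\<alpha> * (c / p))) * ennreal ((1 + c * (\<alpha> / (p - \<alpha>))) * V)"
    by (simp add: mult_left_mono)
  also have "\<dots> = ennreal ((1 + c * (\<alpha> / (p - \<alpha>))) * exp (\<alpha> * (c / p))) * ennreal V"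
    using c \<alpha> V by (simp add: ennreal_mult[symmetric] mult_ac)
  finally show ?thesis
    unfolding exp_oscillation_mean_def V(1) using V(2)
    by (intro divide_le_posI_ennreal) (auto simp: mult.commute)
qed

section \<open>Oscillation on balls\<close>

text \<open>A geometric sum over roots of unity of order m + 1; for k different from l the
  inequality |k - l| <= m excludes the ratio 1.\<close>

lemma sum_roots_of_unity:
  assumes "k \<le> m" "l \<le> m"
  shows "(\<Sum>j<Suc m. cis (2 * pi * (real k - real l) / real (Suc m)) ^ j) = (if k = l then of_nat (Suc m) else 0)"
proof (cases "k = l")
  case False
  let ?x = "cis (2 * pi * (real k - real l) / real (Suc m))"
  have "?x \<noteq> 1"
  proof
    assume "?x = 1"
    then have "cos (2 * pi * (real k - real l) / real (Suc m)) = 1" by (metis Re_complex_of_real cis.sel(1) of_real_1)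
    then obtain n :: int where n: "2 * pi * (real k - real l) / real (Suc m) = of_int n * 2 * pi"
      unfolding cos_one_2pi_int by blast
    have "2 * pi * (real k - real l) = 2 * pi * (of_int n * real (Suc m))"
      using n by (simp add: divide_eq_eq mult_ac del: of_nat_Suc)
    then have "real k - real l = of_int n * real (Suc m)" by simp
    then have "real_of_int (int k - int l) = real_of_int (n * int (Suc m))" by simp
    then have eq: "int k - int l = n * int (Suc m)" by (simp only: of_int_eq_iff)
    then have "n \<noteq> 0" using False by auto
    then have "int (Suc m) \<le> \<bar>n * int (Suc m)\<bar>" by (simp add: abs_mult mult_le_cancel_right1 del: of_nat_Suc)
    moreover have "\<bar>int k - int l\<bar> \<le> int m" using assms by linarith
    ultimately show False unfolding eq by simp
  qed
  moreover have "?x ^ Suc m = 1"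
  proof -
    have "?x ^ Suc m = cis (real (Suc m) * (2 * pi * (real k - real l) / real (Suc m)))" by (rule Complex.DeMoivre)
    also have "real (Suc m) * (2 * pi * (real k - real l) / real (Suc m)) = 2 * pi * of_int (int k - int l)"
      by simp
    also have "cis \<dots> = 1" by (rule cis_multiple_2pi) simp
    finally show ?thesis .
  qed
  ultimately show ?thesis using False by (subst sum_gp_strict) simp
qed simp

text \<open>Parseval's identity for \<open>(c + w z)^m\<close>, with the circle replaced by the roots of unity of order \<open>m + 1\<close>.\<close>

lemma sum_norm_power_roots_of_unity:
  "(\<Sum>j<Suc m. norm (c + cis (2 * pi * real j / real (Suc m)) * w) ^ (2 * m))
    = real (Suc m) * (\<Sum>k\<le>m. (real (m choose k))\<^sup>2 * norm c ^ (2 * (m - k)) * norm w ^ (2 * k))"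
proof -
  let ?\<omega> = "\<lambda>j. cis (2 * pi * real j / real (Suc m))"
  define a where "a k = of_nat (m choose k) * w ^ k * c ^ (m - k)" for k
  have pow: "(c + ?\<omega> j * w) ^ m = (\<Sum>k\<le>m. a k * ?\<omega> j ^ k)" for j
    by (subst add.commute, subst binomial_ring) (simp add: a_def power_mult_distrib mult_ac)
  have "complex_of_real (norm (c + ?\<omega> j * w) ^ (2 * m)) = (\<Sum>k\<le>m. \<Sum>l\<le>m. a k * cnj (a l) * cis (2 * pi * (real k - real l) / real (Suc m)) ^ j)" for j
  proof -
    have "complex_of_real (norm (c + ?\<omega> j * w) ^ (2 * m)) = complex_of_real ((norm ((c + ?\<omega> j * w) ^ m))\<^sup>2)"
      by (simp add: norm_power power_mult[symmetric] mult.commute)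
    also have "\<dots> = (c + ?\<omega> j * w) ^ m * cnj ((c + ?\<omega> j * w) ^ m)" by (rule complex_norm_square)
    also have "\<dots> = (\<Sum>k\<le>m. \<Sum>l\<le>m. (a k * ?\<omega> j ^ k) * cnj (a l * ?\<omega> j ^ l))"
      unfolding pow cnj_sum by (rule sum_product)
    also have "\<dots> = (\<Sum>k\<le>m. \<Sum>l\<le>m. a k * cnj (a l) * cis (2 * pi * (real k - real l) / real (Suc m)) ^ j)"
    proof (intro sum.cong refl)
      fix k l
      have "?\<omega> j ^ k * cnj (?\<omega> j ^ l) = cis (real k * (2 * pi * real j / real (Suc m))) * cis (- (real l * (2 * pi * real j / real (Suc m))))"
        by (simp only: Complex.DeMoivre cis_cnj)
      also have "\<dots> = cis (real j * (2 * pi * (real k - real l) / real (Suc m)))"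
      proof -
        have "x * (2 * pi * y / N) + - (z * (2 * pi * y / N)) = y * (2 * pi * (x - z) / N)" for x y z N :: real
          by (simp add: algebra_simps diff_divide_distrib)
        then show ?thesis unfolding cis_mult by (rule arg_cong[where f=cis])
      qed
      also have "\<dots> = cis (2 * pi * (real k - real l) / real (Suc m)) ^ j" by (rule Complex.DeMoivre[symmetric])
      finally show "(a k * ?\<omega> j ^ k) * cnj (a l * ?\<omega> j ^ l) = a k * cnj (a l) * cis (2 * pi * (real k - real l) / real (Suc m)) ^ j"
        by (simp only: complex_cnj_mult mult_ac)
    qed
    finally show ?thesis .
  qed
  then have "complex_of_real (\<Sum>j<Suc m. norm (c + ?\<omega> j * w) ^ (2 * m))
      = (\<Sum>j<Suc m. \<Sum>k\<le>m. \<Sum>l\<le>m. a k * cnj (a l) * cis (2 * pi * (real k - real l) / real (Suc m)) ^ j)"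
    unfolding of_real_sum by (intro sum.cong refl)
  also have "\<dots> = (\<Sum>k\<le>m. \<Sum>j<Suc m. \<Sum>l\<le>m. a k * cnj (a l) * cis (2 * pi * (real k - real l) / real (Suc m)) ^ j)"
    by (rule sum.swap)
  also have "\<dots> = (\<Sum>k\<le>m. \<Sum>l\<le>m. \<Sum>j<Suc m. a k * cnj (a l) * cis (2 * pi * (real k - real l) / real (Suc m)) ^ j)"
    by (rule sum.cong[OF refl], rule sum.swap)
  also have "\<dots> = (\<Sum>k\<le>m. \<Sum>l\<le>m. if k = l then of_nat (Suc m) * (a k * cnj (a k)) else 0)"
  proof (intro sum.cong refl)
    fix k l assume "k \<in> {..m}" "l \<in> {..m}"
    then show "(\<Sum>j<Suc m. a k * cnj (a l) * cis (2 * pi * (real k - real l) / real (Suc m)) ^ j)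
        = (if k = l then of_nat (Suc m) * (a k * cnj (a k)) else 0)"
      unfolding sum_distrib_left[symmetric] by (subst sum_roots_of_unity) auto
  qed
  also have "\<dots> = (\<Sum>k\<le>m. of_nat (Suc m) * (a k * cnj (a k)))" by (simp del: of_nat_Suc)
  also have "\<dots> = (\<Sum>k\<le>m. complex_of_real (real (Suc m) * (norm (a k))\<^sup>2))"
    by (intro sum.cong refl) (simp only: of_real_mult complex_norm_square of_real_of_nat_eq)
  also have "\<dots> = complex_of_real (\<Sum>k\<le>m. real (Suc m) * (norm (a k))\<^sup>2)" by (rule of_real_sum[symmetric])
  finally have "(\<Sum>j<Suc m. norm (c + ?\<omega> j * w) ^ (2 * m)) = (\<Sum>k\<le>m. real (Suc m) * (norm (a k))\<^sup>2)"
    by (simp only: of_real_eq_iff)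
  also have "\<dots> = real (Suc m) * (\<Sum>k\<le>m. (real (m choose k))\<^sup>2 * norm c ^ (2 * (m - k)) * norm w ^ (2 * k))"
    unfolding sum_distrib_left
    by (intro sum.cong refl) (simp add: a_def norm_mult norm_power power_mult_distrib power_mult[symmetric] mult_ac del: of_nat_Suc)
  finally show ?thesis .
qed

text \<open>The factor 1/(k+1) is absorbed by (m choose k)/(k+1) = (m+1 choose k+1)/(m+1), after
  which Vandermonde's convolution applies.\<close>

lemma sum_choose_square_div:
  "(\<Sum>k\<le>m. (real (m choose k))\<^sup>2 / real (Suc k)) = fact (2 * m + 1) / (fact (m + 1))\<^sup>2"
proof -
  have "(\<Sum>k\<le>m. (real (m choose k))\<^sup>2 / real (Suc k)) = (\<Sum>k\<le>m. real ((m choose k) * (Suc m choose (m - k))) / real (Suc m))"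
  proof (intro sum.cong refl)
    fix k assume k: "k \<in> {..m}"
    have "Suc m choose (m - k) = Suc m choose Suc k"
      using binomial_symmetric[of "Suc k" "Suc m"] k by simp
    moreover have "real (m choose k) / real (Suc k) = real (Suc m choose Suc k) / real (Suc m)"
    proof -
      have "real (Suc k * (Suc m choose Suc k)) = real (Suc m * (m choose k))" by (simp only: Suc_times_binomial)
      then have "real (Suc k) * real (Suc m choose Suc k) = real (Suc m) * real (m choose k)" by (simp only: of_nat_mult)
      then show ?thesis by (simp add: field_simps del: of_nat_Suc binomial_Suc_Suc)
    qed
    ultimately show "(real (m choose k))\<^sup>2 / real (Suc k) = real ((m choose k) * (Suc m choose (m - k))) / real (Suc m)"
      by (simp only: power2_eq_square of_nat_mult times_divide_eq_right[symmetric])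
  qed
  also have "\<dots> = real (\<Sum>k\<le>m. (m choose k) * (Suc m choose (m - k))) / real (Suc m)"
    by (simp only: sum_divide_distrib of_nat_sum)
  also have "(\<Sum>k\<le>m. (m choose k) * (Suc m choose (m - k))) = (m + Suc m) choose m" by (rule vandermonde)
  also have "real ((m + Suc m) choose m) = fact (m + Suc m) / (fact m * fact (m + Suc m - m))"
    by (rule binomial_fact) simp
  also have "m + Suc m - m = m + 1" by simp
  also have "m + Suc m = 2 * m + 1" by simp
  finally have E: "(\<Sum>k\<le>m. (real (m choose k))\<^sup>2 / real (Suc k))
      = fact (2 * m + 1) / (fact m * fact (m + 1)) / real (Suc m)" .
  have "fact m * fact (m + 1) * real (Suc m) = (fact (m + 1) :: real)\<^sup>2"
  proof -
    have f: "(fact (m + 1) :: real) = real (Suc m) * fact m" by (simp only: Suc_eq_plus1[symmetric] fact_Suc)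
    have "fact m * x * real (Suc m) = real (Suc m) * fact m * x" for x :: real by (simp only: mult_ac)
    then show ?thesis unfolding power2_eq_square by (subst (2) f) simp
  qed
  then show ?thesis unfolding E divide_divide_eq_left by simp
qed

text \<open>After centring at c, the integral is averaged over the rotations by the roots of unity
  of order m + 1. This removes the mixed terms of |c + w|^(2m) and leaves a polynomial in |w|^2, to
  be integrated radially.\<close>

lemma nn_integral_disc_power:
  assumes c: "c \<noteq> (0::complex)"
  shows "(\<integral>\<^sup>+\<zeta>\<in>ball c (norm c). ennreal (norm \<zeta> ^ (2 * m)) \<partial>lborel)
    = ennreal (pi * norm c ^ (2 * m + 2) * (fact (2 * m + 1) / (fact (m + 1))\<^sup>2))"
proof -
  define \<rho> where "\<rho> = norm c"
  have \<rho>: "\<rho> > 0" using c by (simp add: \<rho>_def)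
  define q where "q = (\<lambda>k. (real (m choose k))\<^sup>2 * \<rho> ^ (2 * (m - k)))"
  have q: "q k \<ge> 0" for k using \<rho> by (simp add: q_def)
  let ?I = "\<integral>\<^sup>+\<zeta>\<in>ball c \<rho>. ennreal (norm \<zeta> ^ (2 * m)) \<partial>lborel"
  let ?\<omega> = "\<lambda>j. cis (2 * pi * real j / real (Suc m))"
  have I: "?I = (\<integral>\<^sup>+w. ennreal (norm (c + ?\<omega> j * w) ^ (2 * m)) * indicator (ball 0 \<rho>) w \<partial>lborel)" for j
  proof -
    let ?g = "\<lambda>w. ennreal (norm (c + w) ^ (2 * m)) * indicator (ball 0 \<rho>) w"
    have mg: "?g \<in> borel_measurable borel" by measurable
    have lin: "linear (\<lambda>w. ?\<omega> j * w)" by (simp add: linear_iff algebra_simps)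
    have "?I = (\<integral>\<^sup>+w. ?g w \<partial>lborel)"
      using nn_integral_lborel_shift[of "\<lambda>\<zeta>. ennreal (norm \<zeta> ^ (2 * m)) * indicator (ball c \<rho>) \<zeta>" c]
      by (simp add: indicator_def dist_norm)
    also have "\<dots> = (\<integral>\<^sup>+w. ?g (?\<omega> j * w) \<partial>lborel)"
      by (rule nn_integral_lborel_isometry[OF lin _ mg, symmetric]) (simp add: norm_mult)
    finally show ?thesis by (simp add: indicator_def norm_mult)
  qed
  have "of_nat (Suc m) * ?I = (\<Sum>j<Suc m. ?I)" by simp
  also have "\<dots> = (\<Sum>j<Suc m. \<integral>\<^sup>+w. ennreal (norm (c + ?\<omega> j * w) ^ (2 * m)) * indicator (ball 0 \<rho>) w \<partial>lborel)"
    by (intro sum.cong refl I)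
  also have "\<dots> = (\<integral>\<^sup>+w. (\<Sum>j<Suc m. ennreal (norm (c + ?\<omega> j * w) ^ (2 * m)) * indicator (ball 0 \<rho>) w) \<partial>lborel)"
    by (rule nn_integral_sum[symmetric]) measurable
  also have "\<dots> = (\<integral>\<^sup>+w. (\<lambda>s. ennreal (real (Suc m)) * (ennreal (\<Sum>k\<le>m. q k * s ^ k) * indicator {..<\<rho>\<^sup>2} s)) ((norm (w::complex))\<^sup>2) \<partial>lborel)"
  proof (rule nn_integral_cong)
    fix w :: complex
    have "w \<in> ball 0 \<rho> \<longleftrightarrow> (norm w)\<^sup>2 \<in> {..<\<rho>\<^sup>2}"
      using \<rho> by (auto intro: power_strict_mono dest: power2_less_imp_less)
    then have i: "indicator (ball 0 \<rho>) w = (indicator {..<\<rho>\<^sup>2} ((norm w)\<^sup>2) :: ennreal)" by (simp only: indicator_def)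
    have "(\<Sum>j<Suc m. ennreal (norm (c + ?\<omega> j * w) ^ (2 * m))) = ennreal (\<Sum>j<Suc m. norm (c + ?\<omega> j * w) ^ (2 * m))"
      by (rule sum_ennreal) simp
    also have "(\<Sum>j<Suc m. norm (c + ?\<omega> j * w) ^ (2 * m)) = real (Suc m) * (\<Sum>k\<le>m. q k * ((norm w)\<^sup>2) ^ k)"
      unfolding sum_norm_power_roots_of_unity q_def \<rho>_def by (simp only: power_mult)
    also have "ennreal \<dots> = ennreal (real (Suc m)) * ennreal (\<Sum>k\<le>m. q k * ((norm w)\<^sup>2) ^ k)"
      by (rule ennreal_mult') simp
    finally show "(\<Sum>j<Suc m. ennreal (norm (c + ?\<omega> j * w) ^ (2 * m)) * indicator (ball 0 \<rho>) w)
        = ennreal (real (Suc m)) * (ennreal (\<Sum>k\<le>m. q k * ((norm w)\<^sup>2) ^ k) * indicator {..<\<rho>\<^sup>2} ((norm w)\<^sup>2))"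
      unfolding sum_distrib_right[symmetric] i by (simp only: mult.assoc)
  qed
  also have "\<dots> = ennreal pi * (\<integral>\<^sup>+s\<in>{0..}. (ennreal (real (Suc m)) * (ennreal (\<Sum>k\<le>m. q k * s ^ k) * indicator {..<\<rho>\<^sup>2} s)) \<partial>lborel)"
    by (rule nn_integral_complex_radial) measurable
  also have "(\<integral>\<^sup>+s\<in>{0..}. (ennreal (real (Suc m)) * (ennreal (\<Sum>k\<le>m. q k * s ^ k) * indicator {..<\<rho>\<^sup>2} s)) \<partial>lborel)
      = (\<integral>\<^sup>+s. ennreal (real (Suc m)) * (ennreal (\<Sum>k\<le>m. q k * s ^ k) * indicator {0..\<rho>\<^sup>2} s) \<partial>lborel)"
    by (intro nn_integral_cong_AE eventually_mono[OF AE_lborel_singleton[of "\<rho>\<^sup>2"]]) (auto split: split_indicator)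
  also have "\<dots> = ennreal (real (Suc m)) * (\<integral>\<^sup>+s\<in>{0..\<rho>\<^sup>2}. ennreal (\<Sum>k\<le>m. q k * s ^ k) \<partial>lborel)"
    by (rule nn_integral_cmult) measurable
  also have "(\<integral>\<^sup>+s\<in>{0..\<rho>\<^sup>2}. ennreal (\<Sum>k\<le>m. q k * s ^ k) \<partial>lborel)
      = ennreal ((\<Sum>k\<le>m. q k * (\<rho>\<^sup>2) ^ Suc k / real (Suc k)) - (\<Sum>k\<le>m. q k * 0 ^ Suc k / real (Suc k)))"
  proof (rule nn_integral_FTC_Icc[where F="\<lambda>s. \<Sum>k\<le>m. q k * s ^ Suc k / real (Suc k)"])
    show "((\<lambda>s. \<Sum>k\<le>m. q k * s ^ Suc k / real (Suc k)) has_real_derivative (\<Sum>k\<le>m. q k * s ^ k)) (at s)" for s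
    proof (rule DERIV_sum)
      fix k
      have "((\<lambda>s. q k / real (Suc k) * s ^ Suc k) has_real_derivative q k / real (Suc k) * (real (Suc k) * s ^ (Suc k - Suc 0))) (at s)"
        by (intro DERIV_cmult DERIV_pow)
      then show "((\<lambda>s. q k * s ^ Suc k / real (Suc k)) has_real_derivative q k * s ^ k) (at s)"
        by (simp del: of_nat_Suc power_Suc)
    qed
    show "0 \<le> (\<Sum>k\<le>m. q k * s ^ k)" if "s \<in> {0..\<rho>\<^sup>2}" for s
      using q that by (intro sum_nonneg mult_nonneg_nonneg) auto
  qed auto
  also have "(\<Sum>k\<le>m. q k * (\<rho>\<^sup>2) ^ Suc k / real (Suc k)) - (\<Sum>k\<le>m. q k * 0 ^ Suc k / real (Suc k))
      = \<rho> ^ (2 * m + 2) * (\<Sum>k\<le>m. (real (m choose k))\<^sup>2 / real (Suc k))"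
  proof -
    have "q k * (\<rho>\<^sup>2) ^ Suc k / real (Suc k) = \<rho> ^ (2 * m + 2) * ((real (m choose k))\<^sup>2 / real (Suc k))" if "k \<le> m" for k
    proof -
      have "\<rho> ^ (2 * (m - k)) * (\<rho>\<^sup>2) ^ Suc k = \<rho> ^ (2 * (m - k) + 2 * Suc k)"
        by (simp only: power_add power_mult)
      also have "2 * (m - k) + 2 * Suc k = 2 * m + 2" using that by simp
      finally show ?thesis by (simp add: q_def mult_ac del: of_nat_Suc power_Suc)
    qed
    then show ?thesis unfolding sum_distrib_left by (simp del: of_nat_Suc)
  qed
  finally have "of_nat (Suc m) * ?I = ennreal pi * (ennreal (real (Suc m)) * ennreal (\<rho> ^ (2 * m + 2) * (fact (2 * m + 1) / (fact (m + 1))\<^sup>2)))"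
    unfolding sum_choose_square_div .
  also have "\<dots> = of_nat (Suc m) * ennreal (pi * \<rho> ^ (2 * m + 2) * (fact (2 * m + 1) / (fact (m + 1))\<^sup>2))"
    using \<rho> by (simp add: ennreal_of_nat_eq_real_of_nat mult_ac del: of_nat_Suc flip: ennreal_mult)
  finally show ?thesis
    unfolding \<rho>_def by (subst (asm) ennreal_mult_cancel_left) (auto simp del: of_nat_Suc)
qed

section \<open>Slices of a ball by complex lines and real rays\<close>

lemma norm_power2_less_iff: "(norm x)\<^sup>2 < (norm y)\<^sup>2 \<longleftrightarrow> norm x < norm y"
  by (auto intro: power_strict_mono dest: power2_less_imp_less)

text \<open>Because x is on the sphere, the condition |y + \<zeta> v|^2 < |y|^2 with y = x - a has
  no constant term in \<zeta>, so it describes a disc with 0 on its boundary circle. Lines that miss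
  the ball, and v = 0, are covered by c = 0, the empty disc.\<close>

lemma complex_line_ball:
  fixes x a v :: "complex^'n"
  assumes x: "norm (x - a) = r"
  obtains c where "{\<zeta>. x + \<zeta> *s v \<in> ball a r} = ball c (norm c)"
proof -
  define y where "y = x - a"
  \<comment> \<open>Chosen so that the real inner product of y with \<zeta> v is Re (\<zeta>
    s).\<close>
  define s where "s = Complex (y \<bullet> v) (- (y \<bullet> (\<i> *s v)))"
  have "x + \<zeta> *s v \<in> ball a r \<longleftrightarrow> 2 * Re (\<zeta> * s) + (norm \<zeta>)\<^sup>2 * (norm v)\<^sup>2 < 0" for \<zeta>
  proof -
    have "x + \<zeta> *s v \<in> ball a r \<longleftrightarrow> norm (y + \<zeta> *s v) < norm y"
      unfolding y_def x by (simp add: dist_norm norm_minus_commute algebra_simps)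
    also have "\<dots> \<longleftrightarrow> (norm (y + \<zeta> *s v))\<^sup>2 < (norm y)\<^sup>2"
      by (rule norm_power2_less_iff[symmetric])
    also have "(norm (y + \<zeta> *s v))\<^sup>2 = (norm y)\<^sup>2 + 2 * (y \<bullet> (\<zeta> *s v)) + (norm (\<zeta> *s v))\<^sup>2"
      unfolding power2_norm_eq_inner by (simp add: inner_add_left inner_add_right inner_commute)
    also have "y \<bullet> (\<zeta> *s v) = Re (\<zeta> * s)"
      unfolding vector_scalar_mult_eq_scaleR[of \<zeta>] s_def by (simp add: inner_add_right)
    also have "(norm (\<zeta> *s v))\<^sup>2 = (norm \<zeta>)\<^sup>2 * (norm v)\<^sup>2"
      by (simp add: norm_vector_scalar_mult power_mult_distrib)
    finally show ?thesis by auto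
  qed
  note mem = this
  show ?thesis
  proof (cases "v = 0")
    case True
    then have "s = 0" by (simp add: s_def complex_eq_iff)
    then have "{\<zeta>. x + \<zeta> *s v \<in> ball a r} = ball 0 (norm (0::complex))" using mem True by simp
    then show ?thesis by (rule that)
  next
    case False
    \<comment> \<open>The centre that results from completing the square in |\<zeta>|^2 |v|^2 + 2 Re
      (\<zeta> s).\<close>
    define c where "c = - cnj s / of_real ((norm v)\<^sup>2)"
    have disc: "2 * Re (\<zeta> * s) + (norm \<zeta>)\<^sup>2 * (norm v)\<^sup>2 < 0 \<longleftrightarrow> \<zeta> \<in> ball c (norm c)" for \<zeta>
    proof -
      have "(norm (\<zeta> - c))\<^sup>2 = (norm \<zeta>)\<^sup>2 - 2 * Re (\<zeta> * cnj c) + (norm c)\<^sup>2"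
        by (simp only: cmod_power2) (simp add: power2_eq_square algebra_simps)
      also have "Re (\<zeta> * cnj c) = - Re (\<zeta> * s) / (norm v)\<^sup>2"
      proof -
        have "\<zeta> * cnj c = - (\<zeta> * s) / of_real ((norm v)\<^sup>2)" by (simp add: c_def)
        then show ?thesis by (simp only: Re_divide_of_real uminus_complex.sel)
      qed
      finally have A: "(norm (\<zeta> - c))\<^sup>2 = (norm \<zeta>)\<^sup>2 - 2 * (- Re (\<zeta> * s) / (norm v)\<^sup>2) + (norm c)\<^sup>2" .
      have arith: "x - z = (2 * p + w * V) / V" if "x = w - 2 * (- p / V) + z" "V \<noteq> 0" for x z p w V :: real
        using that by (simp add: add_divide_distrib)
      have sign: "q < 0 \<longleftrightarrow> x < z" if "x - z = q / V" "V > 0" for x z q V :: real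
      proof -
        have "q < 0 \<longleftrightarrow> q / V < 0" using that(2) by (simp only: divide_less_0_iff) auto
        then show ?thesis unfolding that(1)[symmetric] by linarith
      qed
      have "(norm (\<zeta> - c))\<^sup>2 - (norm c)\<^sup>2 = (2 * Re (\<zeta> * s) + (norm \<zeta>)\<^sup>2 * (norm v)\<^sup>2) / (norm v)\<^sup>2"
        using A by (rule arith) (use False in simp)
      then have "2 * Re (\<zeta> * s) + (norm \<zeta>)\<^sup>2 * (norm v)\<^sup>2 < 0 \<longleftrightarrow> (norm (\<zeta> - c))\<^sup>2 < (norm c)\<^sup>2"
        by (rule sign) (use False in simp)
      also have "\<dots> \<longleftrightarrow> norm (\<zeta> - c) < norm c"
        by (rule norm_power2_less_iff)
      finally show ?thesis by (simp add: dist_norm norm_minus_commute)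
    qed
    have "{\<zeta>. x + \<zeta> *s v \<in> ball a r} = ball c (norm c)"
      by (rule set_eqI) (simp only: mem_Collect_eq mem disc)
    then show ?thesis by (rule that)
  qed
qed

lemma lelong_measurable:
  assumes "u \<in> lelong_class" shows "u \<in> borel_measurable borel"
  using assms by (auto simp: lelong_class_def plurisubharmonic_def intro: upper_semicontinuous_measurable)

lemma exp_ereal_0: "exp_ereal 0 = 1"
  by (simp add: exp_ereal_def zero_ereal_def)

lemma one_le_exp_gap:
  assumes "u z \<le> ereal m" "0 < \<beta>" shows "1 \<le> exp_ereal (ereal \<beta> * (ereal m - u z))"
  using assms by (intro one_le_exp_ereal) (cases "u z", auto)

text \<open>The constant is the quotient of (4 x^2)^n \<pi>, which is the largest weight (2x)^(2n-2)
  times 4 \<pi> x^2, by the weighted area of the disc from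
  \<open>nn_integral_disc_power\<close>.\<close>

lemma bm_const_eq: "n > 0 \<Longrightarrow> bm_const n * (pi * x ^ (2 * n) * (fact (2 * (n - 1) + 1) / (fact n)\<^sup>2)) = (4 * x\<^sup>2) ^ n * pi"
proof -
  assume "n > 0"
  then have "2 * (n - 1) + 1 = 2 * n - 1" by simp
  then have "fact (2 * (n - 1) + 1) = (fact (2 * n - 1) :: real)" by (rule arg_cong)
  then show ?thesis
    by (simp add: bm_const_def power_mult_distrib power_mult[symmetric] mult_ac)
qed

lemma bm_const_pos: "bm_const n > 0"
  by (simp add: bm_const_def)

text \<open>On the slice |\<zeta>| is at most the diameter 2|c|, which bounds the weight of the
  excess; the excess itself is at most 4 \<beta>/(2 - \<beta>) times the area by
  \<open>disc_exp_integral_le\<close>. On the right the weighted area is known exactly.\<close>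

lemma complex_slice_bound:
  fixes u :: "complex^'n \<Rightarrow> ereal"
  assumes u: "u \<in> lelong_class" and x: "norm (x - a) = r" "u x = ereal m"
    and top: "\<And>z. z \<in> ball a r \<Longrightarrow> u z \<le> ereal m" and \<beta>: "0 < \<beta>" "\<beta> < 2"
  shows "(\<integral>\<^sup>+\<zeta>. ((exp_ereal (ereal \<beta> * (ereal m - u (x + \<zeta> *s v))) - 1) * indicator (ball a r) (x + \<zeta> *s v)) * ennreal (norm \<zeta> ^ (2 * CARD('n) - 2)) \<partial>lborel)
    \<le> ennreal (bm_const CARD('n) * (\<beta> / (2 - \<beta>))) * (\<integral>\<^sup>+\<zeta>. indicator (ball a r) (x + \<zeta> *s v) * ennreal (norm \<zeta> ^ (2 * CARD('n) - 2)) \<partial>lborel)"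
proof -
  define n where "n = CARD('n)"
  have n: "n > 0" by (simp add: n_def)
  then have n2: "2 * n - 2 = 2 * (n - 1)" by simp
  obtain c where c: "{\<zeta>. x + \<zeta> *s v \<in> ball a r} = ball c (norm c)" using complex_line_ball[OF x(1)] .
  have ind: "indicator (ball a r) (x + \<zeta> *s v) = (indicator (ball c (norm c)) \<zeta> :: ennreal)" for \<zeta>
  proof -
    have "x + \<zeta> *s v \<in> ball a r \<longleftrightarrow> \<zeta> \<in> ball c (norm c)" unfolding c[symmetric] by simp
    then show ?thesis by (simp only: indicator_def)
  qed
  define U where "U = (\<lambda>\<zeta>. u (x + \<zeta> *s v))"
  have U: "line_lelong U" unfolding U_def using u by (rule lelong_class_line)
  have Ueq: "u (x + \<zeta> *s v) = U \<zeta>" for \<zeta> by (simp add: U_def)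
  note [measurable] = line_lelong_measurable[OF U]
  have U0: "U 0 = ereal m" by (simp add: U_def x)
  let ?e = "\<lambda>\<zeta>. exp_ereal (ereal \<beta> * (ereal m - U \<zeta>))"
  show ?thesis
  proof (cases "c = 0")
    case True
    then show ?thesis unfolding ind by simp
  next
    case False
    have "(\<integral>\<^sup>+\<zeta>. (?e \<zeta> - 1) * indicator (ball c (norm c)) \<zeta> * ennreal (norm \<zeta> ^ (2 * n - 2)) \<partial>lborel)
        \<le> (\<integral>\<^sup>+\<zeta>. ennreal ((2 * norm c) ^ (2 * n - 2)) * ((?e \<zeta> - 1) * indicator (ball c (norm c)) \<zeta>) \<partial>lborel)"
    proof (rule nn_integral_mono)
      fix \<zeta>
      have "ennreal (norm \<zeta> ^ (2 * n - 2)) \<le> ennreal ((2 * norm c) ^ (2 * n - 2))" if "\<zeta> \<in> ball c (norm c)"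
        using that norm_triangle_ineq2[of \<zeta> c] by (intro ennreal_leI power_mono) (auto simp: dist_norm norm_minus_commute)
      then show "(?e \<zeta> - 1) * indicator (ball c (norm c)) \<zeta> * ennreal (norm \<zeta> ^ (2 * n - 2))
          \<le> ennreal ((2 * norm c) ^ (2 * n - 2)) * ((?e \<zeta> - 1) * indicator (ball c (norm c)) \<zeta>)"
        by (auto split: split_indicator simp: mult.commute intro!: mult_left_mono ennreal_leI)
    qed
    also have "\<dots> = ennreal ((2 * norm c) ^ (2 * n - 2)) * (\<integral>\<^sup>+\<zeta>\<in>ball c (norm c). (?e \<zeta> - 1) \<partial>lborel)"
      by (rule nn_integral_cmult) measurable
    also have "\<dots> \<le> ennreal ((2 * norm c) ^ (2 * n - 2)) * ennreal (pi * (norm c)\<^sup>2 * (4 * (\<beta> / (2 - \<beta>))))"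
    proof (rule mult_left_mono[OF nn_integral_minus_1_le])
      show "1 \<le> ?e \<zeta>" if "\<zeta> \<in> ball c (norm c)" for \<zeta>
      proof -
        have "x + \<zeta> *s v \<in> ball a r" using that unfolding c[symmetric] by simp
        then show ?thesis unfolding U_def using \<beta>(1) by (intro one_le_exp_gap top)
      qed
      show "(\<integral>\<^sup>+\<zeta>\<in>ball c (norm c). ?e \<zeta> \<partial>lborel) \<le> ennreal (pi * (norm c)\<^sup>2 * (1 + 4 * (\<beta> / (2 - \<beta>))))"
        using disc_exp_integral_le[OF U _ \<beta> False] U0 by simp
    qed (use \<beta> in \<open>auto simp: emeasure_ball_complex\<close>)
    also have "ennreal ((2 * norm c) ^ (2 * n - 2)) * ennreal (pi * (norm c)\<^sup>2 * (4 * (\<beta> / (2 - \<beta>))))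
        = ennreal ((2 * norm c) ^ (2 * n - 2) * (pi * (norm c)\<^sup>2 * (4 * (\<beta> / (2 - \<beta>)))))"
      by (rule ennreal_mult'[symmetric]) simp
    also have "(2 * norm c) ^ (2 * n - 2) * (pi * (norm c)\<^sup>2 * (4 * (\<beta> / (2 - \<beta>)))) = (4 * (norm c)\<^sup>2) ^ n * pi * (\<beta> / (2 - \<beta>))"
    proof -
      have "(2 * norm c) ^ (2 * n - 2) = (4 * (norm c)\<^sup>2) ^ (n - 1)"
        unfolding n2 power_mult by (simp add: power_mult_distrib)
      moreover have "(4 * (norm c)\<^sup>2) ^ n = (4 * (norm c)\<^sup>2) ^ (n - 1) * (4 * (norm c)\<^sup>2)"
        using n by (metis Suc_diff_1 power_Suc mult.commute)
      ultimately show ?thesis by (simp add: mult_ac)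
    qed
    also have "\<dots> = bm_const n * (\<beta> / (2 - \<beta>)) * (pi * norm c ^ (2 * n) * (fact (2 * (n - 1) + 1) / (fact n)\<^sup>2))"
      unfolding bm_const_eq[OF n, symmetric] by (simp only: mult_ac)
    also have "ennreal \<dots> = ennreal (bm_const n * (\<beta> / (2 - \<beta>))) * ennreal (pi * norm c ^ (2 * n) * (fact (2 * (n - 1) + 1) / (fact n)\<^sup>2))"
      using \<beta> bm_const_pos[of n] by (intro ennreal_mult') simp
    also have "ennreal (pi * norm c ^ (2 * n) * (fact (2 * (n - 1) + 1) / (fact n)\<^sup>2))
        = (\<integral>\<^sup>+\<zeta>\<in>ball c (norm c). ennreal (norm \<zeta> ^ (2 * (n - 1))) \<partial>lborel)"
    proof -
      have "2 * (n - 1) + 2 = 2 * n" "n - 1 + 1 = n" using n by simp_all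
      then show ?thesis using nn_integral_disc_power[OF False, of "n - 1"] by (simp only:)
    qed
    also have "\<dots> = (\<integral>\<^sup>+\<zeta>. indicator (ball c (norm c)) \<zeta> * ennreal (norm \<zeta> ^ (2 * n - 2)) \<partial>lborel)"
      unfolding n2 by (intro nn_integral_cong mult.commute)
    finally show ?thesis
      unfolding ind Ueq n_def[symmetric] .
  qed
qed

text \<open>By convexity the parameters t > 0 with x + t v in the ball form an interval starting at
  0; \<open>L\<close> is its supremum, finite because v is nonzero. The endpoint, a null set, is
  left undecided.\<close>

lemma real_ray_ball:
  fixes x a v :: "'a::euclidean_space"
  assumes x: "x \<in> cball a r" and v: "v \<noteq> 0" and t0: "t0 > 0" "x + t0 *\<^sub>R v \<in> ball a r"
  obtains L where "L > 0" "\<And>t. t > 0 \<Longrightarrow> t < L \<Longrightarrow> x + t *\<^sub>R v \<in> ball a r" "\<And>t. t > L \<Longrightarrow> x + t *\<^sub>R v \<notin> ball a r"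
proof -
  define T where "T = {t. t > 0 \<and> x + t *\<^sub>R v \<in> ball a r}"
  have down: "s \<in> T" if "t \<in> T" "0 < s" "s \<le> t" for s t
  proof -
    have "x + s *\<^sub>R v - a = (1 - s / t) *\<^sub>R (x - a) + (s / t) *\<^sub>R (x + t *\<^sub>R v - a)"
      using that by (simp add: algebra_simps T_def)
    then have "norm (x + s *\<^sub>R v - a) \<le> (1 - s / t) * norm (x - a) + (s / t) * norm (x + t *\<^sub>R v - a)"
      using that norm_triangle_ineq[of "(1 - s / t) *\<^sub>R (x - a)" "(s / t) *\<^sub>R (x + t *\<^sub>R v - a)"] by (simp add: T_def)
    also have "\<dots> < (1 - s / t) * r + (s / t) * r"
      using that x by (intro add_le_less_mono mult_left_mono mult_strict_left_mono) (auto simp: T_def dist_norm norm_minus_commute)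
    also have "\<dots> = r" by (simp add: algebra_simps)
    finally show ?thesis using that by (simp add: T_def dist_norm norm_minus_commute)
  qed
  have bound: "t \<le> 2 * r / norm v" if "t \<in> T" for t
  proof -
    have "t * norm v = norm ((x + t *\<^sub>R v - a) - (x - a))" using that by (simp add: T_def)
    also have "\<dots> \<le> norm (x + t *\<^sub>R v - a) + norm (x - a)" by (rule norm_triangle_ineq4)
    also have "\<dots> \<le> 2 * r" using that x by (auto simp: T_def dist_norm norm_minus_commute)
    finally show ?thesis using v by (simp add: field_simps)
  qed
  have T: "t0 \<in> T" "bdd_above T" using t0 bound by (auto simp: T_def bdd_above_def)
  show ?thesis
  proof (rule that[of "Sup T"])
    have "t0 \<le> Sup T" using T by (rule cSup_upper)
    then show "Sup T > 0" using t0 by simp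
    show "x + t *\<^sub>R v \<in> ball a r" if t: "t > 0" "t < Sup T" for t
    proof -
      have "T \<noteq> {}" using T(1) by auto
      from less_cSupD[OF this t(2)] obtain s where s: "s \<in> T" "t < s" by (elim bexE)
      have "t \<in> T" using s(1) t(1) less_imp_le[OF s(2)] by (rule down)
      then show ?thesis by (simp add: T_def)
    qed
    show "x + t *\<^sub>R v \<notin> ball a r" if t: "t > Sup T" for t
    proof
      assume "x + t *\<^sub>R v \<in> ball a r"
      then have "t \<in> T" using t \<open>t0 \<le> Sup T\<close> t0 by (simp add: T_def)
      then have "t \<le> Sup T" using T(2) by (rule cSup_upper)
      then show False using t by simp
    qed
  qed
qed

text \<open>On a ray of length L the weight t^(d-1) is at most L^(d-1) on the excess and integrates
  to L^d/d, which accounts for the factor d; the 8 is that of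
  \<open>interval_exp_integral_le\<close>.\<close>

lemma real_slice_bound:
  fixes u :: "complex^'n \<Rightarrow> ereal"
  assumes u: "u \<in> lelong_class" and G: "subspace G" and x: "x \<in> cball a r" "x \<in> G" "u x = ereal m"
    and top: "\<And>z. z \<in> ball a r \<inter> G \<Longrightarrow> u z \<le> ereal m" and \<beta>: "0 < \<beta>" "\<beta> < 1" and d: "d > 0"
  shows "(\<integral>\<^sup>+t\<in>{0<..}. (((exp_ereal (ereal \<beta> * (ereal m - u (x + t *\<^sub>R v))) - 1) * indicator (ball a r \<inter> G) (x + t *\<^sub>R v)) * ennreal (t ^ (d - 1))) \<partial>lborel)
    \<le> ennreal (8 * real d * (\<beta> / (1 - \<beta>))) * (\<integral>\<^sup>+t\<in>{0<..}. (indicator (ball a r \<inter> G) (x + t *\<^sub>R v) * ennreal (t ^ (d - 1))) \<partial>lborel)"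
    (is "?lhs \<le> ?k * ?rhs")
proof (cases "v \<in> G \<and> v \<noteq> 0 \<and> (\<exists>t>0. x + t *\<^sub>R v \<in> ball a r)")
  case False
  have Z: "((exp_ereal (ereal \<beta> * (ereal m - u (x + t *\<^sub>R v))) - 1) * indicator (ball a r \<inter> G) (x + t *\<^sub>R v)) * ennreal (t ^ (d - 1)) * indicator {0<..} t = 0" for t
  proof (cases "t > 0 \<and> x + t *\<^sub>R v \<in> ball a r \<inter> G")
    case True
    \<comment> \<open>A point of the ray in the slice puts v into G, so in the present case v = 0;
      the point is then x itself, where the excess vanishes.\<close>
    have "v = (1 / t) *\<^sub>R ((x + t *\<^sub>R v) - x)" using True by simp
    also have "\<dots> \<in> G" using G x True by (intro subspace_scale subspace_diff) auto
    finally have "v = 0" using False True by auto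
    then show ?thesis using x by (simp add: exp_ereal_0)
  qed (auto split: split_indicator)
  have "?lhs = 0" unfolding Z by simp
  then show ?thesis by simp
next
  case True
  then have v: "v \<in> G" "v \<noteq> 0" by auto
  obtain L where L: "L > 0" "\<And>t. t > 0 \<Longrightarrow> t < L \<Longrightarrow> x + t *\<^sub>R v \<in> ball a r" "\<And>t. t > L \<Longrightarrow> x + t *\<^sub>R v \<notin> ball a r"
  proof -
    obtain t0 where "t0 > 0" "x + t0 *\<^sub>R v \<in> ball a r" using True by (elim conjE exE)
    from real_ray_ball[OF x(1) v(2) this] show ?thesis using that by metis
  qed
  have inG: "x + t *\<^sub>R v \<in> G" for t using G x v by (intro subspace_add subspace_scale)
  have ind: "AE t in lborel. indicator (ball a r \<inter> G) (x + t *\<^sub>R v) * indicator {0<..} t = (indicator {0<..<L} t :: ennreal)"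
  proof (rule eventually_mono[OF AE_lborel_singleton[of L]])
    fix t assume "t \<noteq> L"
    then show "indicator (ball a r \<inter> G) (x + t *\<^sub>R v) * indicator {0<..} t = (indicator {0<..<L} t :: ennreal)"
      using L(2,3)[of t] inG[of t] by (cases "t < L") (auto simp: indicator_def)
  qed
  define U where "U = (\<lambda>\<zeta>. u (x + \<zeta> *s v))"
  have U: "line_lelong U" unfolding U_def using u by (rule lelong_class_line)
  note [measurable] = line_lelong_measurable[OF U]
  have U0: "U 0 = ereal m" by (simp add: U_def x)
  have U_real: "u (x + t *\<^sub>R v) = U (of_real t)" for t by (simp add: U_def of_real_scalar_mult)
  let ?e = "\<lambda>t::real. exp_ereal (ereal \<beta> * (ereal m - U (of_real t)))"
  have "?lhs = (\<integral>\<^sup>+t. ((?e t - 1) * ennreal (t ^ (d - 1))) * indicator {0<..<L} t \<partial>lborel)"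
  proof -
    have "?lhs = (\<integral>\<^sup>+t. ((?e t - 1) * ennreal (t ^ (d - 1))) * (indicator (ball a r \<inter> G) (x + t *\<^sub>R v) * indicator {0<..} t) \<partial>lborel)"
      unfolding U_real by (intro nn_integral_cong) (simp only: mult_ac)
    also have "\<dots> = (\<integral>\<^sup>+t. ((?e t - 1) * ennreal (t ^ (d - 1))) * indicator {0<..<L} t \<partial>lborel)"
      using ind by (intro nn_integral_cong_AE, eventually_elim) simp
    finally show ?thesis .
  qed
  also have "\<dots> \<le> (\<integral>\<^sup>+t. ennreal (L ^ (d - 1)) * ((?e t - 1) * indicator {0<..<L} t) \<partial>lborel)"
  proof (rule nn_integral_mono)
    fix t
    have "ennreal (t ^ (d - 1)) \<le> ennreal (L ^ (d - 1))" if "t \<in> {0<..<L}"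
      using that by (intro ennreal_leI power_mono) auto
    then show "((?e t - 1) * ennreal (t ^ (d - 1))) * indicator {0<..<L} t \<le> ennreal (L ^ (d - 1)) * ((?e t - 1) * indicator {0<..<L} t)"
      by (auto split: split_indicator simp: mult.commute intro: mult_right_mono)
  qed
  also have "\<dots> = ennreal (L ^ (d - 1)) * (\<integral>\<^sup>+t\<in>{0<..<L}. (?e t - 1) \<partial>lborel)"
    by (rule nn_integral_cmult) measurable
  also have "\<dots> \<le> ennreal (L ^ (d - 1)) * ennreal (L * (8 * (\<beta> / (1 - \<beta>))))"
  proof (rule mult_left_mono[OF nn_integral_minus_1_le])
    show "1 \<le> ?e t" if "t \<in> {0<..<L}" for t
    proof -
      have "x + t *\<^sub>R v \<in> ball a r \<inter> G" using that L(2)[of t] inG[of t] by simp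
      then show ?thesis unfolding U_real[symmetric] using \<beta>(1) by (intro one_le_exp_gap top)
    qed
    have "(\<integral>\<^sup>+t\<in>{0<..<L}. ?e t \<partial>lborel) \<le> (\<integral>\<^sup>+t\<in>{0..L}. ?e t \<partial>lborel)"
      by (intro nn_set_integral_set_mono) auto
    also have "\<dots> \<le> ennreal (L * (1 + 8 * (\<beta> / (1 - \<beta>))))"
      using interval_exp_integral_le[OF U _ \<beta> L(1)] U0 by simp
    finally show "(\<integral>\<^sup>+t\<in>{0<..<L}. ?e t \<partial>lborel) \<le> ennreal (L * (1 + 8 * (\<beta> / (1 - \<beta>))))" .
  qed (use \<beta> L(1) in auto)
  also have "ennreal (L ^ (d - 1)) * ennreal (L * (8 * (\<beta> / (1 - \<beta>)))) = ?k * ennreal (L ^ d / real d)"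
  proof -
    have "L ^ d = L ^ (d - 1) * L" using d by (metis Suc_diff_1 power_Suc2)
    then have "L ^ (d - 1) * (L * (8 * (\<beta> / (1 - \<beta>)))) = (8 * real d * (\<beta> / (1 - \<beta>))) * (L ^ d / real d)"
      using d by simp
    then show ?thesis using \<beta> L(1) by (simp only: ennreal_mult'[symmetric] ennreal_mult''[symmetric] zero_le_power less_imp_le) (simp flip: ennreal_mult)
  qed
  also have "ennreal (L ^ d / real d) = ?rhs"
  proof -
    have "?rhs = (\<integral>\<^sup>+t\<in>{0..L}. ennreal (t ^ (d - 1)) \<partial>lborel)"
      using ind AE_lborel_singleton[of 0] AE_lborel_singleton[of L]
      by (intro nn_integral_cong_AE, eventually_elim) (auto split: split_indicator_asm split_indicator)
    also have "\<dots> = ennreal (L ^ d / real d - 0 ^ d / real d)"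
    proof (rule nn_integral_FTC_Icc[where F="\<lambda>t. t ^ d / real d"])
      show "((\<lambda>t. t ^ d / real d) has_real_derivative t ^ (d - 1)) (at t)" for t
        using d by (auto intro!: derivative_eq_intros)
    qed (use L(1) in auto)
    finally show ?thesis by (simp add: zero_power[OF d])
  qed
  finally show ?thesis by simp
qed

section \<open>The two oscillation bounds\<close>

lemma lelong_ball_bound:
  fixes u :: "complex^'n \<Rightarrow> ereal"
  assumes u: "u \<in> lelong_class" and r: "r > 0" and \<alpha>: "0 < \<alpha>" "\<alpha> < 2"
  shows "exp_oscillation_mean lborel (ball a r) \<alpha> u
    \<le> ennreal ((1 + bm_const CARD('n) * (\<alpha> / (2 - \<alpha>))) * exp (\<alpha> * (bm_const CARD('n) / 2)))"
proof -
  note [measurable] = lelong_measurable[OF u]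
  have psh: "plurisubharmonic u" using u by (simp add: lelong_class_def)
  obtain z where z: "z \<in> ball a r" "u z \<noteq> - \<infinity>"
    using lelong_finite_on_generic_ball[OF generic_subspace_UNIV u _ r] by blast
  have "z \<in> cball a r" using z(1) by simp
  from psh_max_on_sphere[OF psh r this z(2)] obtain x
    where x: "x \<in> sphere a r" "u x \<noteq> - \<infinity>" "\<And>y. y \<in> cball a r \<Longrightarrow> u y \<le> u x" by blast
  obtain m where m: "u x = ereal m" using x(2) psh by (cases "u x") (auto simp: plurisubharmonic_def)
  have top: "u y \<le> ereal m" if "y \<in> ball a r" for y using x(3)[of y] that m by simp
  have xr: "norm (x - a) = r" using x(1) by (simp add: dist_norm norm_minus_commute)
  show ?thesis
  proof (rule exp_oscillation_mean_le[where m=m])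
    show "0 < emeasure lborel (ball a r)" using r by (simp add: emeasure_ball)
    show "emeasure lborel (ball a r) < \<infinity>" using r by (simp add: emeasure_ball)
    show "(\<integral>\<^sup>+z\<in>ball a r. (exp_ereal (ereal \<beta> * (ereal m - u z)) - 1) \<partial>lborel)
        \<le> ennreal (bm_const CARD('n) * (\<beta> / (2 - \<beta>))) * emeasure lborel (ball a r)" if \<beta>: "0 < \<beta>" "\<beta> < 2" for \<beta>
    proof -
      let ?F = "\<lambda>z. (exp_ereal (ereal \<beta> * (ereal m - u z)) - 1) * indicator (ball a r) z"
      have "(\<integral>\<^sup>+w. ?F (x + w) \<partial>lborel) \<le> ennreal (bm_const CARD('n) * (\<beta> / (2 - \<beta>))) * (\<integral>\<^sup>+w. indicator (ball a r) (x + w) \<partial>lborel)"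
        using complex_slice_bound[OF u xr m top \<beta>] \<beta> bm_const_pos[of "CARD('n)"]
        by (intro complex_slice_comparison) auto
      moreover have "(\<integral>\<^sup>+w. ?F (x + w) \<partial>lborel) = (\<integral>\<^sup>+z. ?F z \<partial>lborel)"
        by (rule nn_integral_lborel_shift) measurable
      moreover have "(\<integral>\<^sup>+w. indicator (ball a r) (x + w) \<partial>lborel) = emeasure lborel (ball a r)"
        by (subst nn_integral_lborel_shift) auto
      ultimately show ?thesis by simp
    qed
    show "u z \<le> ereal m" if "z \<in> ball a r" for z using that by (rule top)
  qed (use \<alpha> bm_const_pos[of "CARD('n)"] in auto)
qed

text \<open>The maximum point over the closed ball within \<open>G\<close> may be interior. Rays are
  chosen because from every point of the closed ball they meet the ball in intervals starting at
  that point. The trailing \<open>/ 1\<close> is the division by p = 1 in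
  \<open>exp_oscillation_mean_le\<close>.\<close>

lemma lelong_generic_ball_bound:
  fixes u :: "complex^'n \<Rightarrow> ereal"
  assumes u: "u \<in> lelong_class" and G: "generic_subspace G" and a: "a \<in> G" and r: "r > 0" and \<alpha>: "0 < \<alpha>" "\<alpha> < 1"
    and d: "dim G = d" "d > 0"
  shows "exp_oscillation_mean (subspace_lebesgue G) (ball a r \<inter> G) \<alpha> u
    \<le> ennreal ((1 + 8 * real d * (\<alpha> / (1 - \<alpha>))) * exp (\<alpha> * (8 * real d / 1)))"
proof -
  have sG: "subspace G" using G by (simp add: generic_subspace_def)
  obtain b where "subspace_measure G b" and N_eq: "subspace_lebesgue G = subspace_measure.N b"
    using subspace_lebesgue_measure[OF sG] .
  interpret subspace_measure G b by fact
  note [measurable_cong] = sets_N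
  note [measurable] = lelong_measurable[OF u]
  have clG: "closed G" by (rule closed_subspace[OF sG])
  have [measurable]: "ball a r \<inter> G \<in> sets borel" using clG by (intro sets.Int) auto
  obtain z where z: "z \<in> ball a r" "z \<in> G" "u z \<noteq> - \<infinity>"
    using lelong_finite_on_generic_ball[OF G u a r] .
  have usc: "upper_semicontinuous u" and lt: "\<And>z. u z < \<infinity>" using u by (auto simp: lelong_class_def plurisubharmonic_def)
  have "compact (cball a r \<inter> G)" using clG by (intro compact_Int_closed) auto
  moreover have "a \<in> cball a r \<inter> G" using a r by simp
  then have "cball a r \<inter> G \<noteq> {}" by blast
  ultimately obtain x where x: "x \<in> cball a r \<inter> G" "\<And>y. y \<in> cball a r \<inter> G \<Longrightarrow> u y \<le> u x"
    using upper_semicontinuous_attains_sup[OF usc] by metis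
  have "u x \<noteq> - \<infinity>" using x(2)[of z] z by auto
  then obtain m where m: "u x = ereal m" using lt[of x] by (cases "u x") auto
  have top: "u y \<le> ereal m" if "y \<in> ball a r \<inter> G" for y using x(2)[of y] that m by simp
  have xb: "x \<in> cball a r" "x \<in> G" using x(1) by auto
  show ?thesis
    unfolding N_eq
  proof (rule exp_oscillation_mean_le[where m=m])
    show "0 < emeasure N (ball a r \<inter> G)" "emeasure N (ball a r \<inter> G) < \<infinity>" using emeasure_N_ball[OF a r] .
    show "(\<integral>\<^sup>+z\<in>ball a r \<inter> G. (exp_ereal (ereal \<beta> * (ereal m - u z)) - 1) \<partial>N)
        \<le> ennreal (8 * real d * (\<beta> / (1 - \<beta>))) * emeasure N (ball a r \<inter> G)" if \<beta>: "0 < \<beta>" "\<beta> < 1" for \<beta>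
    proof -
      let ?F = "\<lambda>z. (exp_ereal (ereal \<beta> * (ereal m - u z)) - 1) * indicator (ball a r \<inter> G) z"
      have "(\<integral>\<^sup>+w. ?F (x + w) \<partial>N) \<le> ennreal (8 * real d * (\<beta> / (1 - \<beta>))) * (\<integral>\<^sup>+w. indicator (ball a r \<inter> G) (x + w) \<partial>N)"
      proof (rule real_slice_comparison[OF sigma_finite_N sets_N _ d(2)])
        show "AE w in N. w \<noteq> 0" using d by (intro AE_N_nonzero) simp
        show "ennreal (t ^ d) * (\<integral>\<^sup>+v. h (t *\<^sub>R v) \<partial>N) = (\<integral>\<^sup>+v. h v \<partial>N)"
          if "t > 0" "h \<in> borel_measurable borel" for t h
          using nn_integral_N_affine[OF subspace_0[OF sG] that] d(1) by simp
        show "(\<integral>\<^sup>+t\<in>{0<..}. (?F (x + t *\<^sub>R v) * ennreal (t ^ (d - 1))) \<partial>lborel)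
            \<le> ennreal (8 * real d * (\<beta> / (1 - \<beta>))) * (\<integral>\<^sup>+t\<in>{0<..}. (indicator (ball a r \<inter> G) (x + t *\<^sub>R v) * ennreal (t ^ (d - 1))) \<partial>lborel)" for v
          by (rule real_slice_bound[OF u sG xb m top \<beta> d(2)])
      qed (use \<beta> in auto)
      moreover have "(\<integral>\<^sup>+w. ?F (x + w) \<partial>N) = (\<integral>\<^sup>+z. ?F z \<partial>N)"
        by (rule nn_integral_N_shift[OF xb(2)]) measurable
      moreover have "(\<integral>\<^sup>+w. indicator (ball a r \<inter> G) (x + w) \<partial>N) = emeasure N (ball a r \<inter> G)"
        by (subst nn_integral_N_shift[OF xb(2)]) (auto simp: sets_N)
      ultimately show ?thesis by simp
    qed
    show "u z \<le> ereal m" if "z \<in> ball a r \<inter> G" for z using that by (rule top)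
    show "ball a r \<inter> G \<in> sets N" unfolding sets_N by measurable
    show "u \<in> borel_measurable N" by measurable
  qed (use \<alpha> in auto)
qed

theorem theorem5p4:
  shows "(\<forall>(a :: complex^'n) r u \<alpha>.
            r > 0 \<and> u \<in> lelong_class \<and> 0 < \<alpha> \<and> \<alpha> < 2 \<longrightarrow>
            exp_oscillation_mean lborel (ball a r) \<alpha> u
              \<le> ennreal ((1 + bm_const CARD('n) * (\<alpha> / (2 - \<alpha>))) * exp (\<alpha> * bm_const CARD('n) / 2))) \<and>
         (\<forall>(G :: (complex^'n) set) m a r u \<alpha>.
            generic_subspace G \<and> complex_dim G = m \<and> m \<le> CARD('n) - 1 \<and>
            a \<in> G \<and> r > 0 \<and> u \<in> lelong_class \<and> 0 < \<alpha> \<and> \<alpha> < 1 \<longrightarrow>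
            exp_oscillation_mean (subspace_lebesgue G) (ball a r \<inter> G) \<alpha> u
              \<le> ennreal ((1 + 8 * real (CARD('n) + m) * (\<alpha> / (1 - \<alpha>))) * exp (8 * \<alpha> * real (CARD('n) + m))))"
proof (intro conjI allI impI; elim conjE)
  fix a :: "complex^'n" and r \<alpha> :: real and u :: "complex^'n \<Rightarrow> ereal"
  assume "r > 0" "u \<in> lelong_class" "0 < \<alpha>" "\<alpha> < 2"
  then show "exp_oscillation_mean lborel (ball a r) \<alpha> u
      \<le> ennreal ((1 + bm_const CARD('n) * (\<alpha> / (2 - \<alpha>))) * exp (\<alpha> * bm_const CARD('n) / 2))"
    using lelong_ball_bound[of u r \<alpha> a] by simp
next
  fix G :: "(complex^'n) set" and m and a :: "complex^'n" and r \<alpha> :: real and u :: "complex^'n \<Rightarrow> ereal"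
  assume G: "generic_subspace G" "complex_dim G = m" and *: "a \<in> G" "r > 0" "u \<in> lelong_class" "0 < \<alpha>" "\<alpha> < 1"
  have "dim G = CARD('n) + m" using G by (rule dim_generic_subspace)
  then have "exp_oscillation_mean (subspace_lebesgue G) (ball a r \<inter> G) \<alpha> u
      \<le> ennreal ((1 + 8 * real (CARD('n) + m) * (\<alpha> / (1 - \<alpha>))) * exp (\<alpha> * (8 * real (CARD('n) + m) / 1)))"
    using * G by (intro lelong_generic_ball_bound) auto
  then show "exp_oscillation_mean (subspace_lebesgue G) (ball a r \<inter> G) \<alpha> u
      \<le> ennreal ((1 + 8 * real (CARD('n) + m) * (\<alpha> / (1 - \<alpha>))) * exp (8 * \<alpha> * real (CARD('n) + m)))"
    by (simp add: mult_ac)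
qed

end
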